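(* Let $p$ be an odd prime, $1\le s\le r$ integers, and $b\in\mathbb{Q}_p\setminus\mathbb{Q}_p^p$. Then the extension $\mathbb{Q}_p(\zeta_{p^r},\sqrt[p^s]{b})/\mathbb{Q}_p$ is totally ramified.
   Context: $\zeta_{p^r}$ is a primitive $p^r$-th root of unity, $\sqrt[p^s]{b}$ a root of $x^{p^s}-b$, and $\mathbb{Q}_p^p$ the set of $p$-th powers in $\mathbb{Q}_p$. *)

theory Defs
  imports
    Complex_Main
    "HOL-Algebra.QuotRing"
    "HOL-Algebra.Ideal_Product"
    "HOL-Algebra.Generated_Fields"
    "HOL-Algebra.Embedded_Algebras"
    "HOL-Algebra.Algebraic_Closure_Type"
begin

section \<open>The field of \<open>p\<close>-adic numbers\<close>

text \<open>
  \<open>Qp p\<close> is the completion of the rationals with respect to the \<open>p\<close>-adic absolute value: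
  Cauchy sequences (with pointwise operations) modulo null sequences.
\<close>

definition padic_norm :: "nat \<Rightarrow> rat \<Rightarrow> real" where
  "padic_norm p q =
     (if q = 0 then 0
      else real p powi (int (multiplicity (int p) (snd (quotient_of q)))
                      - int (multiplicity (int p) (fst (quotient_of q)))))"

definition padic_Cauchy :: "nat \<Rightarrow> (nat \<Rightarrow> rat) set" where
  "padic_Cauchy p =
     {f. \<forall>e>0. \<exists>N. \<forall>m\<ge>N. \<forall>n\<ge>N. padic_norm p (f m - f n) < e}"

definition padic_null :: "nat \<Rightarrow> (nat \<Rightarrow> rat) set" where
  "padic_null p = {f. (\<lambda>n. padic_norm p (f n)) \<longlonglongrightarrow> 0}"

definition padic_Cauchy_ring :: "nat \<Rightarrow> (nat \<Rightarrow> rat) ring" where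
  "padic_Cauchy_ring p =
     \<lparr>carrier = padic_Cauchy p,
      monoid.mult = (\<lambda>f g n. f n * g n),
      one = (\<lambda>n. 1),
      ring.zero = (\<lambda>n. 0),
      add = (\<lambda>f g n. f n + g n)\<rparr>"

definition Qp :: "nat \<Rightarrow> (nat \<Rightarrow> rat) set ring" where
  "Qp p = padic_Cauchy_ring p Quot padic_null p"

text \<open>
  The absolute value of the class \<open>x\<close> is the limit of the absolute values along any
  representing sequence.
\<close>

definition Qp_norm :: "nat \<Rightarrow> (nat \<Rightarrow> rat) set \<Rightarrow> real" where
  "Qp_norm p x = (THE c. \<forall>f\<in>x. (\<lambda>n. padic_norm p (f n)) \<longlonglongrightarrow> c)"

definition Zp :: "nat \<Rightarrow> (nat \<Rightarrow> rat) set set" where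
  "Zp p = {x \<in> carrier (Qp p). Qp_norm p x \<le> 1}"


section \<open>Total ramification\<close>

text \<open>
  In the following, \<open>R\<close> is an ambient field, and \<open>A\<close>, \<open>K\<close>, \<open>L\<close> are subsets of it.
  Polynomials are lists of coefficients, leading coefficient first, so that
  \<open>\<one> # cs\<close> is a monic polynomial.
\<close>

definition integral_closure :: "('a, 'm) ring_scheme \<Rightarrow> 'a set \<Rightarrow> 'a set \<Rightarrow> 'a set" where
  "integral_closure R A L =
     {x \<in> L. \<exists>cs. set cs \<subseteq> A \<and> ring.eval R (\<one>\<^bsub>R\<^esub> # cs) x = \<zero>\<^bsub>R\<^esub>}"

text \<open>
  \<open>A\<close> is meant to be a complete discrete valuation ring and \<open>L\<close> a finite extension of its field
  of fractions, so that \<open>A\<close> and its integral closure \<open>B\<close> in \<open>L\<close> have exactly one maximal ideal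
  each, \<open>\<pp>\<close> and \<open>\<PP>\<close>. The ramification index is the exponent \<open>e\<close> with \<open>\<pp>B = \<PP>\<^sup>e\<close>; the power
  is taken in the monoid of ideals under ideal multiplication.
\<close>

definition has_ramification_index ::
    "('a, 'm) ring_scheme \<Rightarrow> 'a set \<Rightarrow> 'a set \<Rightarrow> nat \<Rightarrow> bool" where
  "has_ramification_index R A L e \<longleftrightarrow>
     (let B = R\<lparr>carrier := integral_closure R A L\<rparr>
      in \<exists>\<pp> \<PP>. maximalideal \<pp> (R\<lparr>carrier := A\<rparr>) \<and> maximalideal \<PP> B \<and>
           genideal B \<pp> = \<PP> [^]\<^bsub>ideals_set B\<^esub> e)"

text \<open>
  \<open>L\<close> is totally ramified over the fraction field \<open>K\<close> of \<open>A\<close> if it is a finite extension of \<open>K\<close>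
  and its ramification index is equal to its degree.
\<close>

definition totally_ramified ::
    "('a, 'm) ring_scheme \<Rightarrow> 'a set \<Rightarrow> 'a set \<Rightarrow> 'a set \<Rightarrow> bool" where
  "totally_ramified R A K L \<longleftrightarrow>
     (\<exists>n. ring.dimension R n K L \<and> has_ramification_index R A L n)"

definition primitive_root_of_unity :: "nat \<Rightarrow> 'a::field \<Rightarrow> bool" where
  "primitive_root_of_unity n z \<longleftrightarrow> z ^ n = 1 \<and> (\<forall>k. 0 < k \<and> k < n \<longrightarrow> z ^ k \<noteq> 1)"

end

theory Submission
  imports Defs "HOL-Number_Theory.Residues" "Jordan_Normal_Form.Char_Poly"
begin

text \<open>
  Let \<open>K = \<rat>\<^sub>p\<close>, \<open>F = K(\<zeta>)\<close> and \<open>L = F(\<beta>)\<close>. A maximal subring \<open>V\<close> of \<open>L\<close> that contains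
  \<open>\<int>\<^sub>p\<close> but not \<open>1/p\<close> is a valuation ring, and completeness makes it finitely generated
  over \<open>\<int>\<^sub>p\<close>, so that it is the integral closure. Every nonzero residue class of \<open>V\<close> has
  a power of exponent \<open>p\<^sup>a\<close> that contains a root of unity of order prime to \<open>p\<close>. A root of
  unity in \<open>L\<close> lies in \<open>F\<close>: since \<open>p\<close> is odd, there is an automorphism \<open>\<tau>\<close> with
  \<open>\<tau> \<zeta> = \<zeta>\<^sup>2\<close>, and \<open>\<tau> g = g\<^sup>2 \<tau>\<close> for a generator \<open>g\<close> of the Galois group of \<open>L/F\<close>, while
  automorphisms commute on roots of unity, so that \<open>g\<close> fixes them. As \<open>F\<close> is totally
  ramified with uniformizer \<open>\<zeta> - 1\<close>, the residue field of \<open>V\<close> has order \<open>p\<close>, and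
  then the ramification index is the degree.
\<close>

hide_const (open) up_ring.monom up_ring.coeff module.smult Polynomials.lead_coeff Polynomials.degree
  Divisibility.prime Ring_Hom.ring_hom

section \<open>Subrings of a field and extension of valuation rings\<close>

text \<open>The degree of \<beta> over F is never computed; it is only known to divide p^s. This is
  why the proof goes through the residue field: what must be excluded is an unramified part of L
  over K, and such a part would come from a root of unity of order prime to p, whatever the degrees
  are. The hypothesis s \<le> r puts the p^s-th roots of unity into F, so that L over F is a Kummer
  extension and g multiplies \<beta> by a root of unity. The exponent 2 is chosen because cancelling
  in g = g^2 leaves g = 1 outright; it is prime to p, and \<zeta>^2 is conjugate to \<zeta> because
  the cyclotomic polynomial is irreducible over K. Irreducibility is again a matter of values:
  \<zeta> - 1 has the value v(p) / ((p - 1) p^(r-1)), and polynomials in it of smaller degree have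
  terms of distinct values. The valuation does not come from a norm formula. V is found by
  maximality, and an integer-valued v is read off from a linear relation between the powers of each
  element. Limits in L are expressed by congruences modulo all powers of p.\<close>

locale closed_subring =
  fixes S :: "'a::field set"
  assumes one_mem: "1 \<in> S"
    and add_mem: "x \<in> S \<Longrightarrow> y \<in> S \<Longrightarrow> x + y \<in> S"
    and uminus_mem: "x \<in> S \<Longrightarrow> - x \<in> S"
    and mult_mem: "x \<in> S \<Longrightarrow> y \<in> S \<Longrightarrow> x * y \<in> S"
begin

lemma diff_mem: "x \<in> S \<Longrightarrow> y \<in> S \<Longrightarrow> x - y \<in> S"
  using add_mem[of x "- y"] uminus_mem[of y] by simp

lemma zero_mem: "0 \<in> S"
  using diff_mem[OF one_mem one_mem] by simp

lemma power_mem: "x \<in> S \<Longrightarrow> x ^ n \<in> S"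
  by (induction n) (auto intro: one_mem mult_mem)

lemma of_nat_mem: "of_nat n \<in> S"
  by (induction n) (auto intro: zero_mem one_mem add_mem)

lemma of_int_mem: "of_int n \<in> S"
  by (cases n) (auto intro!: of_nat_mem uminus_mem simp del: of_nat_Suc)

lemma sum_mem: "(\<And>i. i \<in> I \<Longrightarrow> f i \<in> S) \<Longrightarrow> (\<Sum>i\<in>I. f i) \<in> S"
  by (induction I rule: infinite_finite_induct) (auto intro: zero_mem add_mem)

lemma prod_mem: "(\<And>i. i \<in> I \<Longrightarrow> f i \<in> S) \<Longrightarrow> (\<Prod>i\<in>I. f i) \<in> S"
  by (induction I rule: infinite_finite_induct) (auto intro: one_mem mult_mem)

lemmas ring_mems = one_mem zero_mem add_mem uminus_mem mult_mem diff_mem power_mem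
  of_nat_mem of_int_mem sum_mem prod_mem

end

locale closed_subfield = closed_subring +
  assumes inverse_mem: "x \<in> S \<Longrightarrow> inverse x \<in> S"
begin

lemma divide_mem: "x \<in> S \<Longrightarrow> y \<in> S \<Longrightarrow> x / y \<in> S"
  by (simp add: divide_inverse mult_mem inverse_mem)

lemma powi_mem: "x \<in> S \<Longrightarrow> x powi k \<in> S"
  by (simp add: power_int_def power_mem inverse_mem)

end

text \<open>Polynomials live over the ambient field and the ring of coefficients is a predicate, so
  that one polynomial can be regarded over \<open>A\<close>, \<open>K\<close>, \<open>V\<close> or
  an intermediate field without coercions.\<close>

definition coeffs_in :: "'a::zero set \<Rightarrow> 'a poly \<Rightarrow> bool" where
  "coeffs_in S f \<longleftrightarrow> (\<forall>i. coeff f i \<in> S)"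

context closed_subring
begin

lemma coeffs_in_0 [simp]: "coeffs_in S 0"
  by (simp add: coeffs_in_def zero_mem)

lemma coeffs_in_1 [simp]: "coeffs_in S 1"
  by (simp add: coeffs_in_def zero_mem one_mem coeff_1)

lemma coeffs_in_pCons [simp]: "coeffs_in S (pCons a f) \<longleftrightarrow> a \<in> S \<and> coeffs_in S f"
  by (auto simp: coeffs_in_def coeff_pCons split: nat.splits)

lemma coeffs_in_monom [simp]: "a \<in> S \<Longrightarrow> coeffs_in S (monom a n)"
  by (auto simp: coeffs_in_def zero_mem)

lemma coeffs_in_add: "coeffs_in S f \<Longrightarrow> coeffs_in S g \<Longrightarrow> coeffs_in S (f + g)"
  by (auto simp: coeffs_in_def intro: add_mem)

lemma coeffs_in_uminus: "coeffs_in S f \<Longrightarrow> coeffs_in S (- f)"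
  by (auto simp: coeffs_in_def intro: uminus_mem)

lemma coeffs_in_diff: "coeffs_in S f \<Longrightarrow> coeffs_in S g \<Longrightarrow> coeffs_in S (f - g)"
  by (auto simp: coeffs_in_def intro: diff_mem)

lemma coeffs_in_mult: "coeffs_in S f \<Longrightarrow> coeffs_in S g \<Longrightarrow> coeffs_in S (f * g)"
  by (auto simp: coeffs_in_def coeff_mult intro!: sum_mem mult_mem)

lemma coeffs_in_smult: "c \<in> S \<Longrightarrow> coeffs_in S f \<Longrightarrow> coeffs_in S (smult c f)"
  by (auto simp: coeffs_in_def intro: mult_mem)

lemma coeffs_in_sum: "(\<And>i. i \<in> I \<Longrightarrow> coeffs_in S (f i)) \<Longrightarrow> coeffs_in S (\<Sum>i\<in>I. f i)"
  by (induction I rule: infinite_finite_induct) (auto intro: coeffs_in_add)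

lemma coeffs_in_prod: "(\<And>i. i \<in> I \<Longrightarrow> coeffs_in S (f i)) \<Longrightarrow> coeffs_in S (\<Prod>i\<in>I. f i)"
  by (induction I rule: infinite_finite_induct) (auto intro: coeffs_in_mult)

lemma coeffs_in_pcompose: "coeffs_in S f \<Longrightarrow> coeffs_in S g \<Longrightarrow> coeffs_in S (pcompose f g)"
  by (induction f) (auto simp: pcompose_pCons intro!: coeffs_in_add coeffs_in_mult)

lemma poly_mem: "coeffs_in S f \<Longrightarrow> x \<in> S \<Longrightarrow> poly f x \<in> S"
  by (auto simp: poly_altdef coeffs_in_def intro!: sum_mem mult_mem power_mem)

end

text \<open>The ring \<open>S[x]\<close>. For a field \<open>S\<close> and algebraic
  \<open>x\<close> it is already the field \<open>S(x)\<close>, which is how the cyclotomic field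
  and the Kummer extension above it are represented.\<close>

definition adjoin :: "'a::field set \<Rightarrow> 'a \<Rightarrow> 'a set" where
  "adjoin S x = {poly f x | f. coeffs_in S f}"

context closed_subring
begin

lemma adjoin_closed_subring: "closed_subring (adjoin S x)"
proof
  show "1 \<in> adjoin S x"
    unfolding adjoin_def by (intro CollectI exI[of _ 1]) auto
next
  fix a b assume "a \<in> adjoin S x" "b \<in> adjoin S x"
  then obtain f g where fg: "a = poly f x" "b = poly g x" "coeffs_in S f" "coeffs_in S g"
    by (auto simp: adjoin_def)
  show "a + b \<in> adjoin S x"
    unfolding adjoin_def by (intro CollectI exI[of _ "f + g"]) (use fg in \<open>auto intro: coeffs_in_add\<close>)
  show "a * b \<in> adjoin S x"
    unfolding adjoin_def by (intro CollectI exI[of _ "f * g"]) (use fg in \<open>auto intro: coeffs_in_mult\<close>)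
next
  fix a assume "a \<in> adjoin S x"
  then obtain f where f: "a = poly f x" "coeffs_in S f"
    by (auto simp: adjoin_def)
  show "- a \<in> adjoin S x"
    unfolding adjoin_def by (intro CollectI exI[of _ "- f"]) (use f in \<open>auto intro: coeffs_in_uminus\<close>)
qed

lemma adjoin_mem: "x \<in> adjoin S x"
  unfolding adjoin_def by (intro CollectI exI[of _ "[:0, 1:]"]) (auto simp: zero_mem one_mem)

lemma adjoin_superset: "S \<subseteq> adjoin S x"
proof
  fix a assume "a \<in> S"
  then show "a \<in> adjoin S x"
    unfolding adjoin_def by (intro CollectI exI[of _ "[:a:]"]) auto
qed

lemma adjoin_minimal: "closed_subring T \<Longrightarrow> S \<subseteq> T \<Longrightarrow> x \<in> T \<Longrightarrow> adjoin S x \<subseteq> T"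
  by (auto simp: adjoin_def coeffs_in_def subset_iff intro!: closed_subring.poly_mem)

text \<open>Clears the denominators of an element of \<open>S[1/u]\<close>. In the extension theorem
  it turns a representation of \<open>1/q\<close> in \<open>V[1/u]\<close> into
  \<open>u ^ m / q \<in> V\<close>.\<close>

lemma power_mult_poly_inverse_mem:
  assumes "coeffs_in S f" "u \<in> S" "u \<noteq> 0"
  shows "u ^ degree f * poly f (inverse u) \<in> S"
proof -
  have "u ^ degree f * poly f (inverse u) = (\<Sum>i\<le>degree f. coeff f i * u ^ (degree f - i))"
    unfolding poly_altdef sum_distrib_left
    by (intro sum.cong refl) (use assms in \<open>auto simp: power_diff power_inverse field_simps\<close>)
  also have "\<dots> \<in> S"
    using assms by (auto simp: coeffs_in_def intro!: sum_mem mult_mem power_mem)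
  finally show ?thesis .
qed

end

text \<open>
  A relation \<open>q g(1/x) = 1\<close> expresses the leading monomial of \<open>f\<close> by lower powers of \<open>x\<close>,
  since \<open>1 - q g\<^sub>0\<close> is a unit.
\<close>

lemma (in closed_subring) chevalley_reduce:
  assumes unit: "\<And>b. b \<in> S \<Longrightarrow> inverse (1 - q * b) \<in> S" and q: "q \<in> S" "inverse q \<notin> S"
    and f: "coeffs_in S f" "q * poly f x = 1"
    and g: "coeffs_in S g" "q * poly g (inverse x) = 1"
    and deg: "degree g \<le> degree f" and x: "x \<noteq> 0"
  shows "\<exists>h. coeffs_in S h \<and> q * poly h x = 1 \<and> degree h < degree f"
proof -
  have q0: "q \<noteq> 0" using f(2) by auto
  let ?m = "degree f"
  have m: "?m > 0"
  proof (rule ccontr)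
    assume "\<not> ?m > 0"
    then obtain a where "f = [:a:]" by (auto elim: degree_eq_zeroE)
    with f have "a \<in> S" "q * a = 1" by auto
    then show False using q inverse_unique[of q a] by simp
  qed
  let ?u = "1 - q * coeff g 0"
  have g0: "coeff g 0 \<in> S" using g(1) by (simp add: coeffs_in_def)
  have u0: "?u \<noteq> 0"
  proof
    assume "?u = 0"
    then have "inverse q = coeff g 0" by (intro inverse_unique) auto
    then show False using g0 q by simp
  qed
  \<comment> \<open>Multiplying \<open>q * poly g (inverse x) = 1\<close> by \<open>x ^ ?m\<close>
    and moving the constant term of \<open>g\<close> to the left gives
    \<open>?u * x ^ ?m = q * poly h x\<close>. The exponents \<open>?m - j\<close> are not truncated
    because \<open>degree g \<le> degree f\<close>.\<close>
  define h where "h = (\<Sum>j=1..degree g. monom (coeff g j) (?m - j))"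
  have h: "coeffs_in S h"
    unfolding h_def using g(1) by (intro coeffs_in_sum coeffs_in_monom) (auto simp: coeffs_in_def)
  have degh: "degree h < ?m"
    unfolding h_def using m
    by (intro degree_sum_less) (auto intro!: le_less_trans[OF degree_monom_le])
  have hx: "?u * x ^ ?m = q * poly h x"
  proof -
    have "poly g (inverse x) = coeff g 0 + (\<Sum>j=1..degree g. coeff g j * inverse x ^ j)"
      unfolding poly_altdef
      by (simp add: sum.atLeast_Suc_atMost flip: atLeast0AtMost)
    then have "x ^ ?m * 1 = q * coeff g 0 * x ^ ?m + q * (\<Sum>j=1..degree g. coeff g j * inverse x ^ j) * x ^ ?m"
      unfolding g(2)[symmetric] by (simp add: algebra_simps)
    moreover have "(\<Sum>j=1..degree g. coeff g j * inverse x ^ j) * x ^ ?m = poly h x"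
      unfolding h_def sum_distrib_right poly_sum poly_monom
      by (intro sum.cong refl) (use x deg in \<open>auto simp: power_diff power_inverse field_simps\<close>)
    ultimately show ?thesis by (simp add: algebra_simps)
  qed
  define f1 where "f1 = f - monom (coeff f ?m) ?m"
  have f1: "coeffs_in S f1"
    unfolding f1_def using f(1) by (intro coeffs_in_diff coeffs_in_monom) (auto simp: coeffs_in_def)
  have "coeff f1 i = 0" if "i \<ge> ?m" for i
    using that by (cases "i = ?m") (auto simp: f1_def coeff_eq_0)
  then have degf1: "degree f1 < ?m"
    using m by (metis leading_coeff_0_iff degree_0 not_le)
  have fx: "poly f x = poly f1 x + coeff f ?m * x ^ ?m"
    by (simp add: f1_def poly_monom)
  let ?c = "coeff f ?m * q * inverse ?u"
  have c: "?c \<in> S"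
    using f(1) q(1) unit[OF g0] by (intro mult_mem) (auto simp: coeffs_in_def)
  have "q * poly (f1 + smult ?c h) x = q * poly f1 x + coeff f ?m * q * inverse ?u * (q * poly h x)"
    by (simp add: algebra_simps)
  also have "\<dots> = q * poly f x"
    unfolding hx[symmetric] fx using u0 by (simp add: distrib_left mult_ac)
  finally have "q * poly (f1 + smult ?c h) x = 1" using f(2) by simp
  moreover have "coeffs_in S (f1 + smult ?c h)"
    by (intro coeffs_in_add f1 coeffs_in_smult c h)
  moreover have "degree (f1 + smult ?c h) < ?m"
    by (intro degree_add_less degf1 le_less_trans[OF degree_smult_le degh])
  ultimately show ?thesis by blast
qed

text \<open>Chevalley's extension theorem, with the omission of \<open>1/q\<close> in place of a
  prescribed maximal ideal. In a ring \<open>V\<close> maximal among those omitting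
  \<open>1/q\<close>, any \<open>x\<close> outside \<open>V\<close> makes \<open>1/q\<close> a
  polynomial in \<open>x\<close> over \<open>V\<close>. If this happens for both \<open>x\<close>
  and \<open>1/x\<close>, the two polynomials shorten each other indefinitely.\<close>

theorem valuation_ring_extension:
  fixes A L :: "'a::field set"
  assumes A: "closed_subring A" and L: "closed_subfield L" and A_in_L: "A \<subseteq> L"
    and q: "q \<in> A" "inverse q \<notin> A"
  obtains V where "closed_subring V" "A \<subseteq> V" "V \<subseteq> L" "inverse q \<notin> V"
    "\<And>x. x \<in> L \<Longrightarrow> x \<in> V \<or> inverse x \<in> V"
proof -
  interpret L: closed_subfield L by fact
  have q0: "q \<noteq> 0" using q by auto
  define Rings where "Rings = {R. closed_subring R \<and> A \<subseteq> R \<and> R \<subseteq> L \<and> inverse q \<notin> R}"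
  have "\<exists>M\<in>Rings. \<forall>R\<in>Rings. M \<subseteq> R \<longrightarrow> R = M"
  proof (rule subset_Zorn_nonempty)
    show "Rings \<noteq> {}" using A A_in_L q by (auto simp: Rings_def)
  next
    fix C assume C: "C \<noteq> {}" "subset.chain Rings C"
    then have CF: "\<And>R. R \<in> C \<Longrightarrow> R \<in> Rings"
      and tot: "\<And>R R'. R \<in> C \<Longrightarrow> R' \<in> C \<Longrightarrow> R \<subseteq> R' \<or> R' \<subseteq> R"
      by (auto simp: subset.chain_def)
    have two: "\<exists>R\<in>C. x \<in> R \<and> y \<in> R" if "x \<in> \<Union>C" "y \<in> \<Union>C" for x y
      using that tot by blast
    have sr: "closed_subring R" if "R \<in> C" for R using CF[OF that] by (simp add: Rings_def)
    have "closed_subring (\<Union>C)"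
    proof
      show "1 \<in> \<Union>C" using C(1) sr closed_subring.one_mem by blast
    next
      fix x y assume "x \<in> \<Union>C" "y \<in> \<Union>C"
      then obtain R where R: "R \<in> C" "x \<in> R" "y \<in> R" using two by blast
      show "x + y \<in> \<Union>C" using R closed_subring.add_mem[OF sr] by blast
      show "x * y \<in> \<Union>C" using R closed_subring.mult_mem[OF sr] by blast
    next
      fix x assume "x \<in> \<Union>C"
      then show "- x \<in> \<Union>C" using closed_subring.uminus_mem[OF sr] by blast
    qed
    then show "\<Union>C \<in> Rings" using C(1) CF by (fastforce simp: Rings_def)
  qed
  then obtain V where V: "V \<in> Rings" and max: "\<And>R. R \<in> Rings \<Longrightarrow> V \<subseteq> R \<Longrightarrow> R = V" by blast
  from V interpret V: closed_subring V by (simp add: Rings_def)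
  have AV: "A \<subseteq> V" and VL: "V \<subseteq> L" and qV: "inverse q \<notin> V" using V by (auto simp: Rings_def)
  have adj: "inverse q \<in> adjoin V x" if "x \<in> L" "x \<notin> V" for x
  proof (rule ccontr)
    assume "inverse q \<notin> adjoin V x"
    moreover have "adjoin V x \<subseteq> L"
      by (intro V.adjoin_minimal VL that) (rule L.closed_subring_axioms)
    ultimately have "adjoin V x \<in> Rings"
      using V.adjoin_closed_subring V.adjoin_superset[of x] AV by (auto simp: Rings_def)
    then have "adjoin V x = V" using max V.adjoin_superset by blast
    then show False using V.adjoin_mem that by blast
  qed
  \<comment> \<open>\<open>q\<close> lies in every maximal ideal of \<open>V\<close>. Otherwise some
    \<open>u = 1 - q * b\<close> has its inverse outside \<open>V\<close>, so \<open>1/q\<close> is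
    a polynomial of some degree \<open>m\<close> in \<open>1/u\<close>, and
    \<open>c = u ^ m / q\<close> lies in \<open>V\<close>. Since \<open>u ^ m = 1 - q * d\<close>,
    this gives \<open>1/q = c + d\<close> in \<open>V\<close>.\<close>
  have unit: "inverse (1 - q * b) \<in> V" if b: "b \<in> V" for b
  proof (rule ccontr)
    assume nV: "inverse (1 - q * b) \<notin> V"
    define u where "u = 1 - q * b"
    have qbV: "q * b \<in> V" using q AV b by (intro V.mult_mem) auto
    have uV: "u \<in> V" unfolding u_def by (intro V.diff_mem V.one_mem qbV)
    have u0: "u \<noteq> 0" using nV V.zero_mem by (auto simp: u_def)
    have "inverse u \<in> L" using uV VL L.inverse_mem by blast
    with nV adj have "inverse q \<in> adjoin V (inverse u)" by (simp add: u_def)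
    then obtain f where f: "coeffs_in V f" "inverse q = poly f (inverse u)"
      by (auto simp: adjoin_def)
    define c where "c = u ^ degree f * inverse q"
    have cV: "c \<in> V" unfolding c_def f(2) using V.power_mult_poly_inverse_mem[OF f(1) uV u0] .
    have "\<exists>d\<in>V. u ^ k = 1 - q * d" for k
    proof (induction k)
      case 0
      then show ?case by (intro bexI[of _ 0]) (auto simp: V.zero_mem)
    next
      case (Suc k)
      then obtain d where d: "d \<in> V" "u ^ k = 1 - q * d" by blast
      show ?case
      proof (rule bexI)
        show "u ^ Suc k = 1 - q * (d + b - q * b * d)"
          by (simp add: d(2)) (simp add: u_def algebra_simps)
        show "d + b - q * b * d \<in> V" using V.diff_mem[OF V.add_mem[OF d(1) b] V.mult_mem[OF qbV d(1)]] .
      qed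
    qed
    then obtain d where d: "d \<in> V" "u ^ degree f = 1 - q * d" by blast
    have "q * (c + d) = 1" using d(2) q0 by (simp add: c_def field_simps)
    then have "inverse q = c + d" by (rule inverse_unique)
    then show False using cV d(1) qV V.add_mem by simp
  qed
  have False if x: "x \<noteq> 0" and f: "coeffs_in V f" "q * poly f x = 1"
      and g: "coeffs_in V g" "q * poly g (inverse x) = 1" for x f g
    using x f g
  \<comment> \<open>The situation is symmetric in \<open>x\<close> and \<open>1/x\<close>, so the
    polynomial of larger degree can always be replaced by a shorter one.\<close>
  proof (induction "degree f + degree g" arbitrary: f g x rule: less_induct)
    case less
    have qV': "q \<in> V" using q AV by blast
    show ?case
    proof (cases "degree g \<le> degree f")
      case True
      obtain h where "coeffs_in V h" "q * poly h x = 1" "degree h < degree f"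
        using V.chevalley_reduce[OF unit qV' qV less.prems(2-5) True less.prems(1)] by blast
      then show False using less.hyps[of h g x] less.prems by simp
    next
      case False
      obtain h where "coeffs_in V h" "q * poly h (inverse x) = 1" "degree h < degree g"
        using V.chevalley_reduce[OF unit qV' qV less.prems(4,5), of f] less.prems False by auto
      then show False using less.hyps[of f h x] less.prems by simp
    qed
  qed note no = this
  have "x \<in> V \<or> inverse x \<in> V" if x: "x \<in> L" for x
  proof (rule ccontr)
    assume n: "\<not> (x \<in> V \<or> inverse x \<in> V)"
    then have x0: "x \<noteq> 0" using V.zero_mem by auto
    from n x adj L.inverse_mem have "inverse q \<in> adjoin V x" "inverse q \<in> adjoin V (inverse x)"
      by blast+
    then obtain f g where "coeffs_in V f" "inverse q = poly f x" "coeffs_in V g"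
      "inverse q = poly g (inverse x)" by (auto simp: adjoin_def)
    then show False using no[of x f g] x0 q0 by (metis right_inverse)
  qed
  then show ?thesis using that V.closed_subring_axioms AV VL qV by blast
qed

text \<open>
  The properties of \<open>K = \<rat>\<^sub>p\<close> and \<open>A = \<int>\<^sub>p\<close> that are used: \<open>A\<close> is a complete discrete
  valuation ring with uniformizer \<open>p\<close> and residue field of order \<open>p\<close>.
\<close>

locale padic_field = A: closed_subring A + K: closed_subfield K
  for p :: nat and A K :: "'a::field set" +
  assumes prime_p: "prime p"
    and A_subset: "A \<subseteq> K"
    and inverse_p_notin: "inverse (of_nat p) \<notin> A"
    and K_cases: "x \<in> K \<Longrightarrow> x \<noteq> 0 \<Longrightarrow>
      \<exists>k::int. \<exists>u. u \<in> A \<and> inverse u \<in> A \<and> x = of_nat p powi k * u"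
    and A_residue: "a \<in> A \<Longrightarrow> \<exists>n::nat. \<exists>c\<in>A. a = of_nat n + of_nat p * c"
    and A_complete: "(\<And>k. b k \<in> A) \<Longrightarrow>
      \<exists>s\<in>A. \<forall>m. \<exists>c\<in>A. s - (\<Sum>k<m. of_nat p ^ k * b k) = of_nat p ^ m * c"
begin

lemma p_nz [simp]: "(of_nat p :: 'a) \<noteq> 0"
  using inverse_p_notin A.zero_mem by auto

lemma p_pos [simp]: "p > 0"
  using prime_p by (simp add: prime_gt_0_nat)

end

section \<open>The valuation of a finite extension\<close>

text \<open>The degree enters as a bound, in the form that \<open>n + 1\<close> elements of
  \<open>L\<close> are always dependent over \<open>K\<close>. It is applied to the powers of one
  element, to obtain values, and to families independent modulo \<open>p\<close>, to obtain
  generators of \<open>V\<close>.\<close>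

locale valued_extension = padic_field p A K + L: closed_subfield L + V: closed_subring V
  for p :: nat and A K L V :: "'a::field set" +
  fixes n :: nat
  assumes K_subset: "K \<subseteq> L" and AV: "A \<subseteq> V" and VL: "V \<subseteq> L"
    and inverse_p_notin_V: "inverse (of_nat p) \<notin> V"
    and val: "x \<in> L \<Longrightarrow> x \<in> V \<or> inverse x \<in> V"
    and finite_degree: "(\<And>i. i \<le> n \<Longrightarrow> f i \<in> L) \<Longrightarrow>
      \<exists>a. (\<forall>i\<le>n. a i \<in> K) \<and> (\<exists>i\<le>n. a i \<noteq> 0) \<and> (\<Sum>i\<le>n. a i * f i) = 0"
begin

definition unit :: "'a \<Rightarrow> bool" where "unit x \<longleftrightarrow> x \<noteq> 0 \<and> x \<in> V \<and> inverse x \<in> V"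

definition P :: "'a set" where "P = {x \<in> V. \<not> unit x}"

lemma unit_mult: "unit x \<Longrightarrow> unit y \<Longrightarrow> unit (x * y)"
  by (auto simp: unit_def V.mult_mem)

lemma unit_inverse: "unit x \<Longrightarrow> unit (inverse x)"
  by (auto simp: unit_def)

lemma unit_divide: "unit x \<Longrightarrow> unit y \<Longrightarrow> unit (x / y)"
  by (simp add: divide_inverse unit_mult unit_inverse)

lemma unit_1 [simp]: "unit 1"
  by (simp add: unit_def V.one_mem)

lemma unit_power: "unit x \<Longrightarrow> unit (x ^ k)"
  by (induction k) (auto intro: unit_mult)

lemma unit_V: "unit x \<Longrightarrow> x \<in> V" by (simp add: unit_def)

lemma unit_A: "u \<noteq> 0 \<Longrightarrow> u \<in> A \<Longrightarrow> inverse u \<in> A \<Longrightarrow> unit u"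
  using AV by (auto simp: unit_def)

lemma A_in_L: "x \<in> A \<Longrightarrow> x \<in> L" using AV VL by blast

lemma p_in_P: "of_nat p \<in> P"
  using inverse_p_notin_V by (auto simp: P_def unit_def V.of_nat_mem)

lemma P_V: "x \<in> P \<Longrightarrow> x \<in> V" by (simp add: P_def)

lemma zero_in_P: "0 \<in> P"
  by (simp add: P_def unit_def V.zero_mem)

lemma P_mult: assumes "x \<in> P" "y \<in> V" shows "x * y \<in> P"
proof -
  have "\<not> unit (x * y)"
  proof
    assume u: "unit (x * y)"
    then have "y * inverse (x * y) \<in> V" and nz: "x \<noteq> 0" "y \<noteq> 0"
      using assms(2) unfolding unit_def by (blast intro: V.mult_mem, auto)
    moreover have "y * inverse (x * y) = inverse x" using nz by (simp add: field_simps)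
    ultimately have "inverse x \<in> V" by metis
    then have "unit x" using assms nz by (auto simp: unit_def P_def)
    then show False using assms by (simp add: P_def)
  qed
  then show ?thesis using assms by (simp add: P_def V.mult_mem)
qed

lemma P_mult': "x \<in> V \<Longrightarrow> y \<in> P \<Longrightarrow> x * y \<in> P"
  using P_mult[of y x] by (simp add: mult.commute)

lemma L_divide_cases: "x \<in> L \<Longrightarrow> y \<in> L \<Longrightarrow> x / y \<in> V \<or> y / x \<in> V"
  using val[of "x / y"] by (auto simp: L.divide_mem)

text \<open>One of \<open>x / y\<close> and \<open>y / x\<close> lies in \<open>V\<close>, so the
  sum is a multiple of one of the summands. Hence \<open>P\<close> is an ideal and \<open>V\<close>
  is a local ring.\<close>

lemma P_add: assumes "x \<in> P" "y \<in> P" shows "x + y \<in> P"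
proof -
  have *: "x + y \<in> P" if xy: "x \<in> P" "y \<in> P" "x / y \<in> V" for x y
  proof (cases "y = 0")
    case False
    have "y * (1 + x / y) \<in> P"
      using xy by (intro P_mult V.add_mem V.one_mem)
    with False show ?thesis by (simp add: distrib_left add.commute)
  qed (use xy in auto)
  show ?thesis
    using *[OF assms] *[OF assms(2,1)] L_divide_cases[of x y] assms P_V VL
    by (auto simp: add.commute)
qed

lemma P_uminus: "x \<in> P \<Longrightarrow> - x \<in> P"
  using P_mult'[of "-1" x] V.uminus_mem[OF V.one_mem] by simp

lemma P_diff: "x \<in> P \<Longrightarrow> y \<in> P \<Longrightarrow> x - y \<in> P"
  using P_add[of x "- y"] P_uminus[of y] by simp

lemma P_sum: "(\<And>i. i \<in> I \<Longrightarrow> f i \<in> P) \<Longrightarrow> (\<Sum>i\<in>I. f i) \<in> P"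
  by (induction I rule: infinite_finite_induct) (auto intro: zero_in_P P_add)

lemma not_unit_0 [simp]: "\<not> unit 0" by (simp add: unit_def)

lemma unit_not_P: "unit x \<Longrightarrow> x \<notin> P" by (simp add: P_def)

lemma P_power_iff: "x \<in> V \<Longrightarrow> k > 0 \<Longrightarrow> x ^ k \<in> P \<longleftrightarrow> x \<in> P"
proof
  assume "x \<in> V" "k > 0" "x ^ k \<in> P"
  then show "x \<in> P" using unit_power[of x k] by (auto simp: P_def)
next
  assume "x \<in> V" "k > 0" "x \<in> P"
  then have "x * x ^ (k - 1) \<in> P" by (intro P_mult V.power_mem)
  then show "x ^ k \<in> P" using power_minus_mult[OF \<open>k > 0\<close>, of x] by (simp add: mult.commute)
qed

lemma power_in_V_iff:
  assumes "x \<in> L" "k > 0"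
  shows "x ^ k \<in> V \<longleftrightarrow> x \<in> V"
proof
  assume *: "x ^ k \<in> V"
  show "x \<in> V"
  proof (rule ccontr)
    assume n: "x \<notin> V"
    then have x0: "x \<noteq> 0" and i: "inverse x \<in> V" using val[OF assms(1)] V.zero_mem by auto
    have "x ^ k * inverse x ^ (k - 1) \<in> V" by (intro V.mult_mem * V.power_mem i)
    also have "x ^ k * inverse x ^ (k - 1) = x"
      using x0 power_minus_mult[OF assms(2), of x] by (simp add: power_inverse field_simps)
    finally show False using n by simp
  qed
qed (auto intro: V.power_mem)

text \<open>The ultrametric principle: after division by a strictly dominating term the sum is
  \<open>1\<close> plus an element of \<open>P\<close>.\<close>

lemma dominant_sum_nonzero:
  assumes "finite I" "j \<in> I" "\<And>i. i \<in> I \<Longrightarrow> t i \<in> L" "t j \<noteq> 0"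
    and "\<And>i. i \<in> I \<Longrightarrow> i \<noteq> j \<Longrightarrow> t i / t j \<in> P"
  shows "(\<Sum>i\<in>I. t i) \<noteq> 0"
proof
  assume s: "(\<Sum>i\<in>I. t i) = 0"
  have "0 = (\<Sum>i\<in>I. t i) / t j" by (simp add: s)
  also have "\<dots> = 1 + (\<Sum>i\<in>I - {j}. t i / t j)"
    unfolding sum_divide_distrib using assms(4) by (subst sum.remove[OF assms(1,2)]) simp
  finally have "(1::'a) = - (\<Sum>i\<in>I - {j}. t i / t j)" by (simp add: eq_neg_iff_add_eq_0)
  moreover have "- (\<Sum>i\<in>I - {j}. t i / t j) \<in> P"
    using assms(5) by (intro P_uminus P_sum) auto
  ultimately show False using unit_not_P[OF unit_1] by simp
qed

text \<open>Divisibility in \<open>V\<close> is a total preorder on the nonzero elements of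
  \<open>L\<close>. The term found here plays the part of a term of least value before values are
  available.\<close>

lemma exists_dominant:
  assumes "finite I" "I \<noteq> {}" "\<And>i. i \<in> I \<Longrightarrow> t i \<in> L" "\<And>i. i \<in> I \<Longrightarrow> t i \<noteq> 0"
  shows "\<exists>j\<in>I. \<forall>i\<in>I. t i / t j \<in> V"
  using assms
proof (induction rule: finite_ne_induct)
  case (singleton x)
  then show ?case by (auto simp: V.one_mem)
next
  case (insert x F)
  then obtain j where j: "j \<in> F" "\<forall>i\<in>F. t i / t j \<in> V" by auto
  show ?case
  proof (cases "t x / t j \<in> V")
    case True
    then show ?thesis using j by auto
  next
    case False
    then have jx: "t j / t x \<in> V" using L_divide_cases[of "t x" "t j"] j insert.prems by auto
    have "t i / t x \<in> V" if "i \<in> F" for i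
    proof -
      have "(t i / t j) * (t j / t x) \<in> V" using j that jx by (intro V.mult_mem) auto
      then show ?thesis using insert.prems(2)[of j] j by simp
    qed
    then show ?thesis using insert.prems by (intro bexI[of _ x]) (auto simp: V.one_mem)
  qed
qed

text \<open>A power \<open>x ^ (j - i)\<close> is comparable with a power of \<open>p\<close> for
  some \<open>i < j \<le> n\<close> that depend on \<open>x\<close>; \<open>n!\<close> is a common
  multiple of all these differences, so one exponent serves every \<open>x\<close>.\<close>

definition D :: nat where "D = fact n"

lemma D_pos [simp]: "D > 0" by (simp add: D_def)

lemma powi_p_unit: "unit (of_nat p powi k) \<longleftrightarrow> k = 0"
proof
  assume u: "unit (of_nat p powi k)"
  have *: "\<not> unit (of_nat p powi k)" if "k > 0" for k
  proof -
    have "of_nat p powi k = (of_nat p :: 'a) ^ nat k" using that by (simp add: power_int_def)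
    then show ?thesis using P_power_iff[of "of_nat p" "nat k"] p_in_P that P_def by (auto simp: V.of_nat_mem)
  qed
  have "\<not> k > 0" using * u by blast
  moreover have "\<not> - k > 0"
    using *[of "- k"] unit_inverse[OF u] by (auto simp: power_int_minus)
  ultimately show "k = 0" by simp
qed auto

text \<open>In a relation between the powers of \<open>x\<close> over \<open>K\<close> no term can
  strictly dominate all others, so two terms agree up to a unit. Their quotient expresses
  \<open>x ^ (j - i)\<close> as an element of \<open>K\<close> times a unit, and nonzero elements of
  \<open>K\<close> are powers of \<open>p\<close> times units.\<close>

lemma power_eq_powi:
  assumes x: "x \<in> L" "x \<noteq> 0"
  shows "\<exists>k. unit (x ^ D / of_nat p powi k)"
proof -
  obtain a where a: "\<And>i. i \<le> n \<Longrightarrow> a i \<in> K" "\<exists>i\<le>n. a i \<noteq> 0" "(\<Sum>i\<le>n. a i * x ^ i) = 0"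
    using finite_degree[of "\<lambda>i. x ^ i"] x by (auto simp: L.power_mem)
  define I where "I = {i. i \<le> n \<and> a i \<noteq> 0}"
  define t where "t = (\<lambda>i. a i * x ^ i)"
  have I: "finite I" "I \<noteq> {}" using a(2) by (auto simp: I_def)
  have tL: "t i \<in> L" if "i \<in> I" for i
    using that a(1) K_subset x by (auto simp: t_def I_def intro!: L.mult_mem L.power_mem)
  have t0: "t i \<noteq> 0" if "i \<in> I" for i using that x by (auto simp: t_def I_def)
  have "(\<Sum>i\<in>I. t i) = (\<Sum>i\<le>n. a i * x ^ i)"
    by (intro sum.mono_neutral_cong_left) (auto simp: I_def t_def)
  then have sum0: "(\<Sum>i\<in>I. t i) = 0" using a by simp
  have "\<exists>j\<in>I. \<forall>i\<in>I. t i / t j \<in> V" by (intro exists_dominant I tL t0)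
  then obtain j where j: "j \<in> I" "\<And>i. i \<in> I \<Longrightarrow> t i / t j \<in> V" by blast
  have "\<exists>i\<in>I. i \<noteq> j \<and> t i / t j \<notin> P"
  proof (rule ccontr)
    assume "\<not> ?thesis"
    then have "(\<Sum>i\<in>I. t i) \<noteq> 0"
      by (intro dominant_sum_nonzero[where j = j] I(1) j(1) tL t0) auto
    with sum0 show False by simp
  qed
  then obtain i where i: "i \<in> I" "i \<noteq> j" "unit (t i / t j)" using j by (auto simp: P_def)
  have "\<exists>i j. i \<in> I \<and> j \<in> I \<and> i < j \<and> unit (t i / t j)"
  proof (cases "i < j")
    case False
    moreover have "unit (t j / t i)" using unit_inverse[OF i(3)] by (simp add: inverse_eq_divide)
    ultimately show ?thesis using i j by (intro exI[of _ j] exI[of _ i]) auto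
  qed (use i j in blast)
  then obtain i j where ij: "i \<in> I" "j \<in> I" "i < j" "unit (t i / t j)" by blast
  have nz: "a i \<noteq> 0" "a j \<noteq> 0" using ij by (auto simp: I_def)
  have "a i / a j \<in> K" "a i / a j \<noteq> 0" using a(1) ij by (auto simp: I_def K.divide_mem)
  then obtain k u where ku: "u \<in> A" "inverse u \<in> A" "a i / a j = of_nat p powi k * u"
    using K_cases by blast
  have u0: "u \<noteq> 0" using ku nz by auto
  have uu: "unit u" using ku u0 by (intro unit_A)
  have "x ^ (j - i) = (a i / a j) / (t i / t j)"
    using nz x power_add[of x i "j - i"] ij by (simp add: t_def)
  then have xji: "x ^ (j - i) / of_nat p powi k = u / (t i / t j)" by (simp add: ku(3))
  then have un: "unit (x ^ (j - i) / of_nat p powi k)" unfolding xji by (intro unit_divide uu ij(4))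
  have "j - i \<le> n" "j - i > 0" using ij by (auto simp: I_def)
  then have "(j - i) dvd D" unfolding D_def by (intro dvd_fact) auto
  then obtain m where m: "D = (j - i) * m" by blast
  have "x ^ D / of_nat p powi (k * int m) = (x ^ (j - i) / of_nat p powi k) ^ m"
    unfolding m power_mult power_divide power_int_mult by simp
  also have "unit \<dots>" by (intro unit_power un)
  finally show ?thesis by blast
qed

text \<open>Up to a unit, \<open>x ^ D\<close> is a power of \<open>p\<close>; so \<open>v\<close> is the valuation with \<open>v(p) = D\<close>.\<close>

definition v :: "'a \<Rightarrow> int" where "v x = (SOME k. unit (x ^ D / of_nat p powi k))"

lemma v_unit: "x \<in> L \<Longrightarrow> x \<noteq> 0 \<Longrightarrow> unit (x ^ D / of_nat p powi v x)"
  unfolding v_def by (rule someI_ex) (rule power_eq_powi)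

lemma v_eqI: assumes "unit (x ^ D / of_nat p powi k)" "x \<in> L" "x \<noteq> 0" shows "v x = k"
proof -
  have "unit ((x ^ D / of_nat p powi v x) / (x ^ D / of_nat p powi k))"
    by (intro unit_divide v_unit assms)
  also have "(x ^ D / of_nat p powi v x) / (x ^ D / of_nat p powi k) = of_nat p powi (k - v x)"
    using assms(3) by (simp add: power_int_diff)
  finally show ?thesis by (simp add: powi_p_unit)
qed

lemma v_mult: assumes "x \<in> L" "x \<noteq> 0" "y \<in> L" "y \<noteq> 0" shows "v (x * y) = v x + v y"
proof (rule v_eqI)
  have "unit ((x ^ D / of_nat p powi v x) * (y ^ D / of_nat p powi v y))"
    by (intro unit_mult v_unit assms)
  then show "unit ((x * y) ^ D / of_nat p powi (v x + v y))"
    by (simp add: power_int_add power_mult_distrib)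
qed (use assms in \<open>auto intro: L.mult_mem\<close>)

lemma v_1 [simp]: "v 1 = 0"
  by (rule v_eqI) (auto simp: L.one_mem)

lemma v_inverse: assumes "x \<in> L" "x \<noteq> 0" shows "v (inverse x) = - v x"
proof -
  have "v (x * inverse x) = v x + v (inverse x)"
    using assms by (intro v_mult) (auto intro: L.inverse_mem)
  then show ?thesis using assms by simp
qed

lemma v_divide: "x \<in> L \<Longrightarrow> x \<noteq> 0 \<Longrightarrow> y \<in> L \<Longrightarrow> y \<noteq> 0 \<Longrightarrow> v (x / y) = v x - v y"
  by (simp add: divide_inverse v_mult v_inverse L.inverse_mem)

lemma v_power: "x \<in> L \<Longrightarrow> x \<noteq> 0 \<Longrightarrow> v (x ^ k) = int k * v x"
  by (induction k) (auto simp: v_mult L.power_mem algebra_simps)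

lemma v_powi: "x \<in> L \<Longrightarrow> x \<noteq> 0 \<Longrightarrow> v (x powi k) = k * v x"
  by (simp add: power_int_def v_power v_inverse L.inverse_mem)

lemma v_p: "v (of_nat p) = int D"
  by (rule v_eqI) (auto simp: L.of_nat_mem)

lemma V_iff: assumes "x \<in> L" "x \<noteq> 0" shows "x \<in> V \<longleftrightarrow> v x \<ge> 0"
proof
  assume "v x \<ge> 0"
  then have "(x ^ D / of_nat p powi v x) * of_nat p ^ nat (v x) \<in> V"
    using v_unit[OF assms] by (intro V.mult_mem V.power_mem V.of_nat_mem unit_V) auto
  also have "(x ^ D / of_nat p powi v x) * of_nat p ^ nat (v x) = x ^ D"
    using \<open>v x \<ge> 0\<close> by (simp add: power_int_def)
  finally show "x \<in> V" using power_in_V_iff[OF assms(1)] by simp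
next
  assume x: "x \<in> V"
  show "v x \<ge> 0"
  proof (rule ccontr)
    assume n: "\<not> v x \<ge> 0"
    have "inverse (x ^ D / of_nat p powi v x) * x ^ D \<in> V"
      using v_unit[OF assms] x by (intro V.mult_mem V.power_mem) (auto simp: unit_def)
    also have "inverse (x ^ D / of_nat p powi v x) * x ^ D = of_nat p powi v x"
      using assms by simp
    finally have "of_nat p powi v x \<in> V" .
    \<comment> \<open>The exponent \<open>- v x - 1\<close> is nonnegative and moves the power of
      \<open>p\<close> to exactly \<open>1/p\<close>, which \<open>V\<close> omits.\<close>
    then have "of_nat p powi v x * of_nat p ^ nat (- v x - 1) \<in> V"
      by (intro V.mult_mem V.power_mem V.of_nat_mem)
    also have "of_nat p powi v x * of_nat p ^ nat (- v x - 1) = (of_nat p :: 'a) powi (v x + (- v x - 1))"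
      using n by (subst power_int_add) (auto simp: power_int_def)
    finally show False using inverse_p_notin_V by (simp add: power_int_minus)
  qed
qed

lemma unit_iff: "x \<in> L \<Longrightarrow> x \<noteq> 0 \<Longrightarrow> unit x \<longleftrightarrow> v x = 0"
  using V_iff[of x] V_iff[of "inverse x"] by (auto simp: unit_def v_inverse L.inverse_mem)

lemma P_iff: "x \<in> L \<Longrightarrow> x \<noteq> 0 \<Longrightarrow> x \<in> P \<longleftrightarrow> v x > 0"
  using V_iff[of x] unit_iff[of x] by (auto simp: P_def)

lemma divide_in_V_iff: "x \<in> L \<Longrightarrow> x \<noteq> 0 \<Longrightarrow> y \<in> L \<Longrightarrow> y \<noteq> 0 \<Longrightarrow> x / y \<in> V \<longleftrightarrow> v y \<le> v x"
  using V_iff[of "x / y"] by (auto simp: v_divide L.divide_mem)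

text \<open>Terms of distinct values cannot cancel. The conclusion is phrased through a unit
  quotient, so that it contains both that the sum is nonzero and that its value is the least
  one.\<close>

lemma distinct_values:
  assumes "finite I" "\<And>i. i \<in> I \<Longrightarrow> t i \<in> L"
    and "\<And>i j. i \<in> I \<Longrightarrow> j \<in> I \<Longrightarrow> t i \<noteq> 0 \<Longrightarrow> t j \<noteq> 0 \<Longrightarrow> v (t i) = v (t j) \<Longrightarrow> i = j"
  shows "(\<forall>i\<in>I. t i = 0) \<or>
    (\<exists>j\<in>I. t j \<noteq> 0 \<and> unit ((\<Sum>i\<in>I. t i) / t j) \<and> (\<forall>i\<in>I. t i \<noteq> 0 \<longrightarrow> v (t j) \<le> v (t i)))"
proof (cases "\<forall>i\<in>I. t i = 0")
  case False
  define J where "J = {i\<in>I. t i \<noteq> 0}"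
  have J: "finite J" "J \<noteq> {}" using assms(1) False by (auto simp: J_def)
  have "\<exists>j\<in>J. \<forall>i\<in>J. t i / t j \<in> V"
    by (intro exists_dominant J) (auto simp: J_def assms(2))
  then obtain j where j: "j \<in> J" "\<And>i. i \<in> J \<Longrightarrow> t i / t j \<in> V" by blast
  have le: "v (t j) \<le> v (t i)" if "i \<in> I" "t i \<noteq> 0" for i
    using divide_in_V_iff[THEN iffD1, OF _ _ _ _ j(2)[of i]] that j(1) assms(2) by (simp add: J_def)
  have "t i / t j \<in> P" if i: "i \<in> J" "i \<noteq> j" for i
  proof -
    have "v (t i) \<noteq> v (t j)" using assms(3) i j by (auto simp: J_def)
    then have "v (t j) < v (t i)" using le[of i] i by (auto simp: J_def)
    then show ?thesis using P_iff[of "t i / t j"] i j assms(2) by (auto simp: J_def v_divide L.divide_mem)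
  qed
  then have PP: "(\<Sum>i\<in>J - {j}. t i / t j) \<in> P" by (intro P_sum) auto
  have "(\<Sum>i\<in>I. t i) = (\<Sum>i\<in>J. t i)"
    using assms(1) by (intro sum.mono_neutral_right) (auto simp: J_def)
  then have "(\<Sum>i\<in>I. t i) / t j = 1 + (\<Sum>i\<in>J - {j}. t i / t j)"
    using sum.remove[OF J(1) j(1), of "\<lambda>i. t i / t j"] j(1) by (simp add: sum_divide_distrib J_def)
  moreover have "1 + (\<Sum>i\<in>J - {j}. t i / t j) \<notin> P"
    using P_diff[OF _ PP] unit_not_P[OF unit_1] by fastforce
  moreover have "1 + (\<Sum>i\<in>J - {j}. t i / t j) \<in> V"
    using PP by (intro V.add_mem V.one_mem P_V)
  ultimately have "unit ((\<Sum>i\<in>I. t i) / t j)" by (simp add: P_def)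
  then show ?thesis using j le by (auto simp: J_def)
qed auto

text \<open>A nonzero element of \<open>K\<close> is \<open>p powi k\<close> times a unit, of value
  \<open>k * int D\<close>, so lying in \<open>V\<close> means \<open>k \<ge> 0\<close>.
  Coefficients from \<open>K\<close> that are integral in \<open>L\<close> thereby descend to
  \<open>A\<close>.\<close>

lemma A_eq: "A = V \<inter> K"
proof
  show "V \<inter> K \<subseteq> A"
  proof
    fix x assume x: "x \<in> V \<inter> K"
    show "x \<in> A"
    proof (cases "x = 0")
      case False
      then obtain k u where ku: "u \<in> A" "inverse u \<in> A" "x = of_nat p powi k * u"
        using K_cases x by blast
      have u0: "u \<noteq> 0" using ku False by auto
      then have uu: "unit u" using ku by (intro unit_A)
      have "v x = v (of_nat p powi k) + v u"
        unfolding ku(3) using u0 ku A_in_L by (intro v_mult) (auto intro: L.powi_mem L.of_nat_mem)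
      also have "v u = 0" using uu u0 ku A_in_L unit_iff by blast
      finally have "v x = k * int D" by (simp add: v_powi v_p L.of_nat_mem)
      moreover have "v x \<ge> 0" using V_iff[of x] x False VL by auto
      ultimately have "k \<ge> 0" using D_pos by (simp add: zero_le_mult_iff del: D_pos)
      then have "x = of_nat p ^ nat k * u" unfolding ku(3) by (simp add: power_int_def)
      then show ?thesis using ku(1) by (simp only: A.mult_mem A.power_mem A.of_nat_mem)
    qed (auto simp: A.zero_mem)
  qed
qed (use AV A_subset in auto)

lemma v_K: assumes "x \<in> K" "x \<noteq> 0" shows "int D dvd v x"
proof -
  obtain k u where ku: "u \<in> A" "inverse u \<in> A" "x = of_nat p powi k * u"
    using K_cases assms by blast
  have u0: "u \<noteq> 0" using ku assms by auto
  have "v x = v (of_nat p powi k) + v u"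
    unfolding ku(3) using u0 ku A_in_L by (intro v_mult) (auto intro: L.powi_mem L.of_nat_mem)
  also have "v u = 0" using unit_A[OF u0] u0 ku A_in_L unit_iff by blast
  finally show ?thesis by (simp add: v_powi v_p L.of_nat_mem)
qed

text \<open>A nonzero \<open>x\<close> has a finite value, while multiples of \<open>p ^ N\<close>
  in \<open>V\<close> have value at least \<open>N\<close>. This is the uniqueness of limits, and it
  turns congruences modulo all \<open>p ^ N\<close> into equations.\<close>

lemma p_powers_separated:
  assumes "x \<in> L" "\<And>N. \<exists>y\<in>V. x = of_nat p ^ N * y"
  shows "x = 0"
proof (rule ccontr)
  assume x: "x \<noteq> 0"
  define N where "N = nat (v x) + 1"
  obtain y where y: "y \<in> V" "x = of_nat p ^ N * y" using assms(2) by blast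
  have y0: "y \<noteq> 0" using x y by auto
  have "v x = int N * int D + v y"
    by (subst (1) y(2), subst v_mult)
      (use y(1) y0 VL in \<open>auto simp: v_power v_p L.of_nat_mem L.power_mem simp del: of_nat_add power_Suc power_add\<close>)
  moreover have "v y \<ge> 0" using V_iff[of y] y y0 VL by auto
  moreover have "int N * 1 \<le> int N * int D"
    using D_pos by (intro mult_left_mono) linarith+
  moreover have "v x < int N" unfolding N_def by linarith
  ultimately show False by linarith
qed

section \<open>Finite generation and completeness of the valuation ring over the p-adic
  integers\<close>

lemma A_unit: assumes "a \<in> A" "\<And>c. c \<in> A \<Longrightarrow> a \<noteq> of_nat p * c" shows "inverse a \<in> A"
proof -
  have a0: "a \<noteq> 0" using assms(2)[of 0] A.zero_mem by auto
  obtain k u where ku: "u \<in> A" "inverse u \<in> A" "a = of_nat p powi k * u"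
    using K_cases assms a0 A_subset by blast
  have "k \<le> 0"
  proof (rule ccontr)
    assume k: "\<not> k \<le> 0"
    then have "a = of_nat p ^ nat k * u" using ku by (simp add: power_int_def)
    also have "nat k = Suc (nat (k - 1))" using k by simp
    finally have "a = of_nat p * (of_nat p ^ nat (k - 1) * u)" by (simp add: mult.assoc)
    then show False using assms(2) ku by (metis A.mult_mem A.power_mem A.of_nat_mem)
  qed
  then have "inverse a = of_nat p ^ nat (- k) * inverse u"
    unfolding ku(3) by (auto simp: power_int_def power_inverse)
  then show ?thesis using ku(2) by (simp only: A.mult_mem A.power_mem A.of_nat_mem)
qed

text \<open>Division by a coefficient of least value makes a relation over \<open>K\<close> integral
  and, as one coefficient becomes \<open>1\<close>, nontrivial modulo \<open>p\<close>.\<close>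

lemma scale_relation:
  fixes m :: nat
  assumes "\<And>i. i \<le> m \<Longrightarrow> a i \<in> K" "\<exists>i\<le>m. a i \<noteq> 0"
  shows "\<exists>q. q \<in> K \<and> (\<forall>i\<le>m. q * a i \<in> A) \<and> (\<exists>i\<le>m. q * a i = 1)"
proof -
  define I where "I = {i. i \<le> m \<and> a i \<noteq> 0}"
  have "\<exists>j\<in>I. \<forall>i\<in>I. a i / a j \<in> V"
    using assms K_subset by (intro exists_dominant) (auto simp: I_def)
  then obtain j where j: "j \<in> I" "\<And>i. i \<in> I \<Longrightarrow> a i / a j \<in> V" by blast
  have "inverse (a j) * a i \<in> A" if i: "i \<le> m" for i
  proof (cases "a i = 0")
    case False
    then have "a i / a j \<in> V \<inter> K" using j i assms(1) by (auto simp: I_def intro!: K.divide_mem)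
    then show ?thesis using A_eq by (simp add: divide_inverse mult.commute)
  qed (auto simp: A.zero_mem)
  then show ?thesis using j assms(1) by (intro exI[of _ "inverse (a j)"]) (auto simp: I_def K.inverse_mem)
qed

text \<open>Linear independence over \<open>A/pA\<close> of the classes of
  \<open>x 0, ..., x (m - 1)\<close> in \<open>V/pV\<close>, expressed with representatives.\<close>

definition indep_mod_p :: "nat \<Rightarrow> (nat \<Rightarrow> 'a) \<Rightarrow> bool" where
  "indep_mod_p m x \<longleftrightarrow> (\<forall>i<m. x i \<in> V) \<and>
     (\<forall>c z. (\<forall>i<m. c i \<in> A) \<longrightarrow> z \<in> V \<longrightarrow> (\<Sum>i<m. c i * x i) = of_nat p * z \<longrightarrow>
        (\<forall>i<m. \<exists>d\<in>A. c i = of_nat p * d))"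

text \<open>Otherwise \<open>n + 1\<close> of the \<open>x i\<close> satisfy a relation over
  \<open>K\<close>, which can be scaled to coefficients in \<open>A\<close> one of which is
  \<open>1\<close>; independence would make \<open>p\<close> divide \<open>1\<close> in
  \<open>A\<close>.\<close>

lemma indep_mod_p_le: assumes "indep_mod_p m x" shows "m \<le> n"
proof (rule ccontr)
  assume m: "\<not> m \<le> n"
  then have "x i \<in> L" if "i \<le> n" for i using assms that VL by (auto simp: indep_mod_p_def)
  then obtain a where a: "\<And>i. i \<le> n \<Longrightarrow> a i \<in> K" "\<exists>i\<le>n. a i \<noteq> 0" "(\<Sum>i\<le>n. a i * x i) = 0"
    using finite_degree[of x] by blast
  obtain q where q: "q \<in> K" "\<And>i. i \<le> n \<Longrightarrow> q * a i \<in> A" "\<exists>i\<le>n. q * a i = 1"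
    using scale_relation[of n a] a by blast
  define c where "c i = (if i \<le> n then q * a i else 0)" for i
  have "(\<Sum>i<m. c i * x i) = (\<Sum>i\<le>n. q * (a i * x i))"
    using m by (intro sum.mono_neutral_cong_right) (auto simp: c_def mult.assoc)
  also have "\<dots> = 0" unfolding sum_distrib_left[symmetric] using a by simp
  finally have "(\<Sum>i<m. c i * x i) = of_nat p * 0" by simp
  moreover have "\<forall>i<m. c i \<in> A" using q by (auto simp: c_def A.zero_mem)
  ultimately have *: "\<forall>i<m. \<exists>d\<in>A. c i = of_nat p * d"
    using assms V.zero_mem unfolding indep_mod_p_def by blast
  obtain i where "i \<le> n" "q * a i = 1" using q by blast
  then obtain d where d: "d \<in> A" "1 = of_nat p * d" using *[rule_format, of i] m by (auto simp: c_def)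
  have "inverse (of_nat p) = d" using inverse_unique[OF d(2)[symmetric]] .
  then show False using d inverse_p_notin by simp
qed

text \<open>A longest family independent modulo \<open>p\<close> exists by the bound
  \<open>n\<close>, and it spans \<open>V/pV\<close>: adding \<open>y\<close> creates a relation
  modulo \<open>p\<close> in which the coefficient of \<open>y\<close> is a unit of
  \<open>A\<close>.\<close>

lemma exists_generators_mod_p:
  "\<exists>(m::nat) x. (\<forall>i<m. x i \<in> V) \<and>
     (\<forall>y\<in>V. \<exists>a z. (\<forall>i<m. a i \<in> A) \<and> z \<in> V \<and> y = (\<Sum>i<m. a i * x i) + of_nat p * z)"
proof -
  have "indep_mod_p 0 x" for x by (simp add: indep_mod_p_def)
  then have ex: "\<exists>x. indep_mod_p 0 x" by blast
  define m where "m = (GREATEST m. \<exists>x. indep_mod_p m x)"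
  have bd: "\<forall>y. (\<exists>x. indep_mod_p y x) \<longrightarrow> y \<le> n" using indep_mod_p_le by blast
  have "\<exists>x. indep_mod_p m x" unfolding m_def by (rule GreatestI_nat[where P="\<lambda>m. \<exists>x. indep_mod_p m x", OF ex bd[rule_format]]) blast
  then obtain x where x: "indep_mod_p m x" by blast
  have max: "\<not> indep_mod_p (Suc m) y" for y
    using Greatest_le_nat[where P="\<lambda>m. \<exists>x. indep_mod_p m x" and k="Suc m", OF _ bd[rule_format]] m_def
    by fastforce
  have xV: "\<forall>i<m. x i \<in> V" using x by (simp add: indep_mod_p_def)
  have "\<exists>a z. (\<forall>i<m. a i \<in> A) \<and> z \<in> V \<and> y = (\<Sum>i<m. a i * x i) + of_nat p * z" if y: "y \<in> V" for y
  proof -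
    have "\<not> indep_mod_p (Suc m) (x(m := y))" by (rule max)
    then obtain c z where c: "\<And>i. i < Suc m \<Longrightarrow> c i \<in> A" and z: "z \<in> V"
      and s: "(\<Sum>i<Suc m. c i * (x(m := y)) i) = of_nat p * z"
      and nd: "\<exists>i<Suc m. \<forall>d\<in>A. c i \<noteq> of_nat p * d"
      using y xV unfolding indep_mod_p_def by (auto simp: less_Suc_eq)
    have s': "(\<Sum>i<m. c i * x i) + c m * y = of_nat p * z" using s by simp
    \<comment> \<open>If \<open>p\<close> divided \<open>c m\<close>, the term of \<open>y\<close>
      could be absorbed in \<open>of_nat p * z\<close>, and the independence of \<open>x\<close>
      would make all coefficients divisible by \<open>p\<close>.\<close>
    have "\<forall>d\<in>A. c m \<noteq> of_nat p * d"
    proof (rule ccontr)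
      assume "\<not> (\<forall>d\<in>A. c m \<noteq> of_nat p * d)"
      then obtain d where d: "d \<in> A" "c m = of_nat p * d" by blast
      have "(\<Sum>i<m. c i * x i) = of_nat p * (z - d * y)"
        using s' d by (simp add: algebra_simps)
      moreover have "z - d * y \<in> V" using d y z AV by (intro V.diff_mem V.mult_mem) auto
      ultimately have "\<forall>i<m. \<exists>d\<in>A. c i = of_nat p * d" using x c unfolding indep_mod_p_def by auto
      with d nd show False by (metis less_Suc_eq)
    qed
    then have u: "inverse (c m) \<in> A" using A_unit[of "c m"] c by blast
    have "c m \<noteq> 0" using \<open>\<forall>d\<in>A. c m \<noteq> of_nat p * d\<close> A.zero_mem by auto
    then have "y = inverse (c m) * (c m * y)" by simp
    also have "c m * y = of_nat p * z - (\<Sum>i<m. c i * x i)" using s' by (simp add: algebra_simps)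
    also have "inverse (c m) * \<dots> = (\<Sum>i<m. (- inverse (c m) * c i) * x i) + of_nat p * (inverse (c m) * z)"
      by (simp add: right_diff_distrib sum_distrib_left sum_negf mult_ac)
    finally have "y = (\<Sum>i<m. (- inverse (c m) * c i) * x i) + of_nat p * (inverse (c m) * z)" .
    moreover have "inverse (c m) * z \<in> V" using u z AV by (intro V.mult_mem) auto
    moreover have "\<forall>i<m. - inverse (c m) * c i \<in> A" using u c by (auto intro!: A.mult_mem A.uminus_mem)
    ultimately show ?thesis
      by (intro exI[of _ "\<lambda>i. - inverse (c m) * c i"] exI[of _ "inverse (c m) * z"]) simp
  qed
  with xV have gx: "(\<forall>i<m. x i \<in> V) \<and>
     (\<forall>y\<in>V. \<exists>a z. (\<forall>i<m. a i \<in> A) \<and> z \<in> V \<and> y = (\<Sum>i<m. a i * x i) + of_nat p * z)"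
    by simp
  show ?thesis by (rule exI[of _ m], rule exI[of _ x], rule gx)
qed

text \<open>Nakayama's lemma over the complete ring \<open>A\<close>: the representation modulo
  \<open>p\<close> is applied again to each remainder, and the coefficients of each generator add up
  to a convergent series in powers of \<open>p\<close>.\<close>

lemma generators:
  assumes x: "\<And>i. i < m \<Longrightarrow> x i \<in> V"
    and gen: "\<And>y. y \<in> V \<Longrightarrow> \<exists>a z. (\<forall>i<m. a i \<in> A) \<and> z \<in> V \<and> y = (\<Sum>i<m. a i * x i) + of_nat p * z"
    and y: "y \<in> V"
  shows "\<exists>a. (\<forall>i<m. a i \<in> A) \<and> y = (\<Sum>i<m. a i * x i)"
proof -
  have "\<forall>y. \<exists>a z. y \<in> V \<longrightarrow> (\<forall>i<m. a i \<in> A) \<and> z \<in> V \<and> y = (\<Sum>i<m. a i * x i) + of_nat p * z"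
    using gen by blast
  then obtain a z where az: "\<And>y i. y \<in> V \<Longrightarrow> i < m \<Longrightarrow> a y i \<in> A" "\<And>y. y \<in> V \<Longrightarrow> z y \<in> V"
    "\<And>y. y \<in> V \<Longrightarrow> y = (\<Sum>i<m. a y i * x i) + of_nat p * z y" by metis
  define Y where "Y k = (z ^^ k) y" for k
  have Y: "Y k \<in> V" for k by (induction k) (auto simp: Y_def y az(2))
  have Yeq: "Y k = (\<Sum>i<m. a (Y k) i * x i) + of_nat p * Y (Suc k)" for k
    using az(3)[OF Y[of k]] by (simp add: Y_def)
  have expand: "y = (\<Sum>i<m. (\<Sum>k<N. of_nat p ^ k * a (Y k) i) * x i) + of_nat p ^ N * Y N" for N
  proof (induction N)
    case 0
    then show ?case by (simp add: Y_def)
  next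
    case (Suc N)
    have "y = (\<Sum>i<m. (\<Sum>k<N. of_nat p ^ k * a (Y k) i) * x i) +
        of_nat p ^ N * ((\<Sum>i<m. a (Y N) i * x i) + of_nat p * Y (Suc N))"
      using Suc Yeq[of N] by simp
    also have "\<dots> = (\<Sum>i<m. (\<Sum>k<Suc N. of_nat p ^ k * a (Y k) i) * x i) + of_nat p ^ Suc N * Y (Suc N)"
      by (simp add: distrib_left distrib_right sum.distrib sum_distrib_left mult_ac)
    finally show ?case .
  qed
  have "\<forall>i. \<exists>s. i < m \<longrightarrow> s \<in> A \<and> (\<forall>N. \<exists>c\<in>A. s - (\<Sum>k<N. of_nat p ^ k * a (Y k) i) = of_nat p ^ N * c)"
    using A_complete[of "\<lambda>k. a (Y k) i" for i] az(1)[OF Y] by metis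
  then obtain s where s: "\<And>i. i < m \<Longrightarrow> s i \<in> A"
    "\<And>i N. i < m \<Longrightarrow> \<exists>c\<in>A. s i - (\<Sum>k<N. of_nat p ^ k * a (Y k) i) = of_nat p ^ N * c" by metis
  have sx: "(\<Sum>i<m. s i * x i) \<in> V" using s(1) x AV by (intro V.sum_mem V.mult_mem) auto
  have "y - (\<Sum>i<m. s i * x i) = 0"
  proof (rule p_powers_separated)
    show "y - (\<Sum>i<m. s i * x i) \<in> L" using V.diff_mem[OF y sx] VL by blast
    fix N
    obtain c where c: "\<And>i. i < m \<Longrightarrow> c i \<in> A"
      "\<And>i. i < m \<Longrightarrow> s i - (\<Sum>k<N. of_nat p ^ k * a (Y k) i) = of_nat p ^ N * c i"
      using s(2)[of _ N] by metis
    have "y - (\<Sum>i<m. s i * x i) = of_nat p ^ N * Y N -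
        (\<Sum>i<m. (s i - (\<Sum>k<N. of_nat p ^ k * a (Y k) i)) * x i)"
      by (subst expand[of N]) (simp add: left_diff_distrib sum_subtractf)
    also have "\<dots> = of_nat p ^ N * (Y N - (\<Sum>i<m. c i * x i))"
      using c by (simp add: right_diff_distrib sum_distrib_left mult.assoc)
    finally show "\<exists>w\<in>V. y - (\<Sum>i<m. s i * x i) = of_nat p ^ N * w"
      using Y c x AV by (intro bexI[of _ "Y N - (\<Sum>i<m. c i * x i)"] V.diff_mem V.sum_mem V.mult_mem) auto
  qed
  then show ?thesis using s(1) by (intro exI[of _ s]) auto
qed

text \<open>The limit is taken in \<open>A\<close>, separately for each coordinate with respect to
  finitely many generators of \<open>V\<close>; any choice of coordinates does.\<close>

lemma V_complete:
  assumes y: "\<And>k. y k \<in> V"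
  shows "\<exists>s\<in>V. \<forall>N. \<exists>c\<in>V. s - (\<Sum>k<N. of_nat p ^ k * y k) = of_nat p ^ N * c"
proof -
  obtain m :: nat and x where "(\<forall>i<m. x i \<in> V) \<and>
     (\<forall>y\<in>V. \<exists>a z. (\<forall>i<m. a i \<in> A) \<and> z \<in> V \<and> y = (\<Sum>i<m. a i * x i) + of_nat p * z)"
    using exists_generators_mod_p by (elim exE)
  then have x: "\<And>i. i < m \<Longrightarrow> x i \<in> V"
    and "\<And>y. y \<in> V \<Longrightarrow> \<exists>a z. (\<forall>i<m. a i \<in> A) \<and> z \<in> V \<and> y = (\<Sum>i<m. a i * x i) + of_nat p * z"
    by simp_all
  note gen = generators[of m x, OF this]
  have "\<forall>k. \<exists>a. (\<forall>i<m. a i \<in> A) \<and> y k = (\<Sum>i<m. a i * x i)" using gen y by blast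
  then obtain a where a: "\<And>k i. i < m \<Longrightarrow> a k i \<in> A" "\<And>k. y k = (\<Sum>i<m. a k i * x i)" by metis
  have "\<forall>i. \<exists>s. i < m \<longrightarrow> s \<in> A \<and> (\<forall>N. \<exists>c\<in>A. s - (\<Sum>k<N. of_nat p ^ k * a k i) = of_nat p ^ N * c)"
    using A_complete[of "\<lambda>k. a k i" for i] a(1) by metis
  then obtain s where s: "\<And>i. i < m \<Longrightarrow> s i \<in> A"
    "\<And>i N. i < m \<Longrightarrow> \<exists>c\<in>A. s i - (\<Sum>k<N. of_nat p ^ k * a k i) = of_nat p ^ N * c" by metis
  have "(\<Sum>i<m. s i * x i) \<in> V" using s(1) x AV by (intro V.sum_mem V.mult_mem) auto
  moreover have "\<exists>c\<in>V. (\<Sum>i<m. s i * x i) - (\<Sum>k<N. of_nat p ^ k * y k) = of_nat p ^ N * c" for N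
  proof -
    obtain c where c: "\<And>i. i < m \<Longrightarrow> c i \<in> A"
      "\<And>i. i < m \<Longrightarrow> s i - (\<Sum>k<N. of_nat p ^ k * a k i) = of_nat p ^ N * c i"
      using s(2)[of _ N] by metis
    have "(\<Sum>k<N. of_nat p ^ k * y k) = (\<Sum>k<N. \<Sum>i<m. of_nat p ^ k * a k i * x i)"
      by (simp add: a(2) sum_distrib_left mult.assoc)
    also have "\<dots> = (\<Sum>i<m. (\<Sum>k<N. of_nat p ^ k * a k i) * x i)"
      by (subst sum.swap) (simp add: sum_distrib_right)
    finally have "(\<Sum>i<m. s i * x i) - (\<Sum>k<N. of_nat p ^ k * y k) =
        (\<Sum>i<m. (s i - (\<Sum>k<N. of_nat p ^ k * a k i)) * x i)"
      by (simp add: left_diff_distrib sum_subtractf)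
    also have "\<dots> = of_nat p ^ N * (\<Sum>i<m. c i * x i)"
      using c by (simp add: sum_distrib_left mult.assoc)
    finally have "(\<Sum>i<m. s i * x i) - (\<Sum>k<N. of_nat p ^ k * y k) = of_nat p ^ N * (\<Sum>i<m. c i * x i)" .
    moreover have "(\<Sum>i<m. c i * x i) \<in> V"
      using c x AV by (intro V.sum_mem V.mult_mem) auto
    ultimately show ?thesis by blast
  qed
  ultimately show ?thesis by blast
qed

end

section \<open>Teichmueller representatives and the residue field\<close>

context valued_extension
begin

text \<open>Congruences are kept modulo \<open>p\<close> and not just modulo \<open>P\<close>,
  because each \<open>p\<close>-th power gains a factor \<open>p\<close> when the start has the form
  \<open>1 + p * z\<close>.\<close>

definition pV :: "'a set" where "pV = {of_nat p * y | y. y \<in> V}"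

lemma pV_P: "x \<in> pV \<Longrightarrow> x \<in> P"
  by (auto simp: pV_def intro: P_mult p_in_P)

lemma pV_diff: "x \<in> pV \<Longrightarrow> y \<in> pV \<Longrightarrow> x - y \<in> pV"
  by (auto simp: pV_def intro: V.diff_mem simp flip: right_diff_distrib)

lemma pV_mult: assumes "x \<in> pV" "y \<in> V" shows "x * y \<in> pV"
proof -
  obtain z where "z \<in> V" "x = of_nat p * z" using assms by (auto simp: pV_def)
  then show ?thesis using assms by (auto simp: pV_def mult.assoc intro!: exI[of _ "z * y"] V.mult_mem)
qed

lemma power_one_plus_p:
  assumes "z \<in> V"
  shows "\<exists>w\<in>V. (1 + of_nat p ^ Suc j * z) ^ k = 1 + of_nat p ^ Suc j * w"
proof (induction k)
  case (Suc k)
  then obtain w where w: "w \<in> V" "(1 + of_nat p ^ Suc j * z) ^ k = 1 + of_nat p ^ Suc j * w" by blast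
  have "(1 + of_nat p ^ Suc j * z) ^ Suc k = 1 + of_nat p ^ Suc j * (z + w + of_nat p ^ Suc j * z * w)"
    unfolding power_Suc[of "1 + of_nat p ^ Suc j * z"] w(2) by (simp only: algebra_simps mult_1_left mult_1_right)
  then show ?case using w(1) assms
    by (intro bexI[of _ "z + w + of_nat p ^ Suc j * z * w"] V.add_mem V.mult_mem V.power_mem V.of_nat_mem) auto
qed (auto intro: V.zero_mem)

text \<open>To second order the power is \<open>1 + p * y + y ^ 2 * w\<close> with
  \<open>y = p ^ Suc j * z\<close>, and \<open>y ^ 2\<close> is divisible by
  \<open>p ^ (2 * j + 2)\<close>, hence by \<open>p ^ (j + 2)\<close>.\<close>

lemma one_plus_pth_power:
  assumes z: "z \<in> V"
  shows "\<exists>w\<in>V. (1 + of_nat p ^ Suc j * z) ^ p = 1 + of_nat p ^ Suc (Suc j) * w"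
proof -
  define y where "y = of_nat p ^ Suc j * z"
  have yV: "y \<in> V" using z by (auto simp: y_def intro!: V.mult_mem V.power_mem V.of_nat_mem)
  have *: "\<exists>w\<in>V. (1 + y) ^ k = 1 + of_nat k * y + y ^ 2 * w" for k
  proof (induction k)
    case (Suc k)
    then obtain w where w: "w \<in> V" "(1 + y) ^ k = 1 + of_nat k * y + y ^ 2 * w" by blast
    have "(1 + y) ^ Suc k = 1 + of_nat (Suc k) * y + y ^ 2 * (w + of_nat k + y * w)"
      unfolding power_Suc w(2) by (simp add: algebra_simps power2_eq_square)
    then show ?case using w(1) yV by (intro bexI[of _ "w + of_nat k + y * w"] V.add_mem V.mult_mem V.of_nat_mem)
  qed (auto intro: V.zero_mem)
  obtain w where w: "w \<in> V" "(1 + y) ^ p = 1 + of_nat p * y + y ^ 2 * w" using * by blast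
  have "(1 + y) ^ p = 1 + of_nat p ^ Suc (Suc j) * (z + of_nat p ^ j * z * z * w)"
    unfolding w(2) by (simp add: y_def algebra_simps power2_eq_square)
  then show ?thesis unfolding y_def using w(1) z
    by (intro bexI[of _ "z + of_nat p ^ j * z * z * w"] V.add_mem V.mult_mem V.power_mem V.of_nat_mem)
qed

lemma one_plus_p_power_power:
  assumes z: "z \<in> V"
  shows "\<exists>w\<in>V. (1 + of_nat p * z) ^ (p ^ j) = 1 + of_nat p ^ Suc j * w"
proof (induction j)
  case 0
  then show ?case using z by auto
next
  case (Suc j)
  then obtain w where w: "w \<in> V" "(1 + of_nat p * z) ^ (p ^ j) = 1 + of_nat p ^ Suc j * w" by blast
  have "(1 + of_nat p * z) ^ (p ^ Suc j) = (1 + of_nat p ^ Suc j * w) ^ p"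
    unfolding w(2)[symmetric] by (simp add: mult.commute[of p] flip: power_mult)
  then show ?case using one_plus_pth_power[OF w(1), of j] by simp
qed

text \<open>The Teichmueller representative \<open>\<omega>\<close> of \<open>y = x ^ (p ^ a)\<close> is the limit of the powers \<open>y ^ (p ^ (c * k))\<close>.\<close>

lemma root_of_unity_lift:
  assumes u: "unit x"
  obtains a M \<omega> where "\<omega> \<in> V" "M > 0" "coprime p M" "\<omega> ^ M = 1" "x ^ (p ^ a) - \<omega> \<in> pV"
proof -
  obtain m :: nat and e where "(\<forall>i<m. e i \<in> V) \<and>
     (\<forall>y\<in>V. \<exists>a z. (\<forall>i<m. a i \<in> A) \<and> z \<in> V \<and> y = (\<Sum>i<m. a i * e i) + of_nat p * z)"
    using exists_generators_mod_p by (elim exE)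
  then have e: "\<And>i. i < m \<Longrightarrow> e i \<in> V"
    and gen: "\<And>y. y \<in> V \<Longrightarrow> \<exists>a z. (\<forall>i<m. a i \<in> A) \<and> z \<in> V \<and> y = (\<Sum>i<m. a i * e i) + of_nat p * z"
    by simp_all
  \<comment> \<open>Finitely many representatives of \<open>V/pV\<close>: combinations of the
    generators with coefficients among \<open>0, ..., p - 1\<close>.\<close>
  define R where "R = (\<lambda>g. \<Sum>i<m. of_nat (g i) * e i) ` ({..<m} \<rightarrow>\<^sub>E {..<p})"
  have finR: "finite R" unfolding R_def by (intro finite_imageI finite_PiE) auto
  have R: "\<exists>r\<in>R. y - r \<in> pV" if y: "y \<in> V" for y
  proof -
    obtain a z where az: "\<And>i. i < m \<Longrightarrow> a i \<in> A" "z \<in> V" "y = (\<Sum>i<m. a i * e i) + of_nat p * z"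
      using gen[OF y] by blast
    have "\<exists>n<p. \<exists>c\<in>A. a i = of_nat n + of_nat p * c" if i: "i < m" for i
    proof -
      obtain k c where kc: "c \<in> A" "a i = of_nat k + of_nat p * c" using A_residue[OF az(1)[OF i]] by blast
      have "(of_nat k :: 'a) = of_nat (k mod p + p * (k div p))" by simp
      then have "a i = of_nat (k mod p) + of_nat p * (of_nat (k div p) + c)"
        unfolding kc(2) by (simp only: of_nat_add of_nat_mult) (simp add: algebra_simps)
      moreover have "of_nat (k div p) + c \<in> A" using kc by (intro A.add_mem A.of_nat_mem)
      ultimately show ?thesis by (intro exI[of _ "k mod p"]) auto
    qed
    then obtain g c where gc: "\<And>i. i < m \<Longrightarrow> g i < p \<and> c i \<in> A \<and> a i = of_nat (g i) + of_nat p * c i" by metis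
    have "y - (\<Sum>i<m. of_nat (g i) * e i) = of_nat p * ((\<Sum>i<m. c i * e i) + z)"
      using gc by (simp add: az(3) algebra_simps sum.distrib sum_distrib_left)
    moreover have "(\<Sum>i<m. c i * e i) + z \<in> V" using gc e az(2) AV
      by (intro V.add_mem V.sum_mem V.mult_mem) auto
    ultimately have "y - (\<Sum>i<m. of_nat (g i) * e i) \<in> pV" by (auto simp: pV_def)
    then have "y - (\<Sum>i<m. of_nat (restrict g {..<m} i) * e i) \<in> pV" by simp
    moreover have "restrict g {..<m} \<in> {..<m} \<rightarrow>\<^sub>E {..<p}" using gc by (auto simp: PiE_iff)
    then have "(\<Sum>i<m. of_nat (restrict g {..<m} i) * e i) \<in> R" unfolding R_def by (rule imageI)
    ultimately show ?thesis by (rule bexI)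
  qed
  have xV: "x \<in> V" and ixV: "inverse x \<in> V" and x0: "x \<noteq> 0" using u by (auto simp: unit_def)
  obtain f where f: "\<And>i. f i \<in> R" "\<And>i. x ^ i - f i \<in> pV" using R[OF V.power_mem[OF xV]] by metis
  \<comment> \<open>Two powers of \<open>x\<close> share a representative, and since
    \<open>x\<close> is a unit this makes \<open>x ^ (j - i)\<close> congruent to \<open>1\<close>
    modulo \<open>p\<close>.\<close>
  have "\<not> inj (f :: nat \<Rightarrow> 'a)"
    using finR f(1) by (metis finite_subset image_subsetI infinite_UNIV_nat finite_imageD)
  then obtain i j where ij: "i < j" "f i = f j" by (metis injI linorder_neqE_nat)
  have "x ^ j - x ^ i \<in> pV" using pV_diff[OF f(2)[of j] f(2)[of i]] ij by simp
  then have "(x ^ j - x ^ i) * inverse x ^ i \<in> pV" by (intro pV_mult V.power_mem ixV)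
  also have "(x ^ j - x ^ i) * inverse x ^ i = x ^ (j - i) - 1"
    using x0 ij power_add[of x i "j - i"] by (simp add: power_inverse field_simps)
  finally have pw: "x ^ (j - i) - 1 \<in> pV" .
  \<comment> \<open>Splitting off the \<open>p\<close>-part of \<open>j - i\<close> leaves an
    exponent \<open>M\<close> prime to \<open>p\<close> such that \<open>y ^ M\<close> is congruent
    to \<open>1\<close> modulo \<open>p\<close>.\<close>
  define a where "a = multiplicity p (j - i)"
  obtain M where M: "j - i = p ^ a * M" "\<not> p dvd M"
    using multiplicity_decompose'[of "j - i" p] ij prime_gt_1_nat[OF prime_p] by (auto simp: a_def)
  have M0: "M > 0" using M(2) by (intro Nat.gr0I) auto
  have cop: "coprime p M" using M(2) prime_p by (simp add: prime_imp_coprime)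
  define y where "y = x ^ (p ^ a)"
  have yV: "y \<in> V" unfolding y_def by (intro V.power_mem xV)
  have "y ^ M - 1 \<in> pV" using pw by (simp add: y_def M(1) power_mult)
  then obtain z where z: "z \<in> V" "y ^ M = 1 + of_nat p * z" by (auto simp: pV_def algebra_simps)
  \<comment> \<open>\<open>M\<close> divides \<open>p ^ c - 1\<close>, so \<open>w (Suc k)\<close>
    is \<open>w k\<close> times the \<open>p ^ (c * k) * t\<close>-th power of \<open>y ^ M\<close>.
    This factor is \<open>1\<close> modulo \<open>p ^ Suc k\<close>, and therefore the sequence
    \<open>w\<close> converges.\<close>
  define c where "c = totient M"
  have c0: "c > 0" using M0 by (simp add: c_def)
  have "[p ^ c = 1] (mod M)" unfolding c_def by (intro euler_theorem) (use cop in auto)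
  then have "M dvd p ^ c - 1" using p_pos by (metis cong_to_1_nat)
  then obtain t where t: "p ^ c - 1 = M * t" by blast
  have q: "p ^ c = 1 + M * t" using t p_pos by (metis Suc_diff_1 plus_1_eq_Suc zero_less_power)
  define w where "w k = y ^ (p ^ (c * k))" for k
  have wV: "w k \<in> V" for k unfolding w_def by (intro V.power_mem yV)
  have ymk: "\<exists>d\<in>V. (y ^ M) ^ (p ^ (c * k) * t') = 1 + of_nat p ^ Suc k * d" for k t'
  proof -
    obtain d where d: "d \<in> V" "(1 + of_nat p * z) ^ (p ^ (c * k)) = 1 + of_nat p ^ Suc (c * k) * d"
      using one_plus_p_power_power[OF z(1)] by blast
    have ck: "c * k = k + (c * k - k)" using c0 by simp
    have "(1 + of_nat p * z) ^ (p ^ (c * k)) = 1 + of_nat p ^ Suc k * (of_nat p ^ (c * k - k) * d)"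
      unfolding d(2) by (subst ck) (simp add: power_add mult_ac)
    moreover have "of_nat p ^ (c * k - k) * d \<in> V" using d by (intro V.mult_mem V.power_mem V.of_nat_mem)
    ultimately show ?thesis unfolding z(2) power_mult using power_one_plus_p by simp
  qed
  have "\<exists>d\<in>V. w (Suc k) - w k = of_nat p ^ k * (of_nat p * d)" for k
  proof -
    obtain d where d: "d \<in> V" "(y ^ M) ^ (p ^ (c * k) * t) = 1 + of_nat p ^ Suc k * d" using ymk by blast
    have "p ^ (c * Suc k) = p ^ (c * k) + M * (p ^ (c * k) * t)"
      by (simp add: power_add q algebra_simps)
    then have "w (Suc k) = w k * (y ^ M) ^ (p ^ (c * k) * t)"
      by (simp add: w_def power_add power_mult)
    then have "w (Suc k) - w k = of_nat p ^ k * (of_nat p * (w k * d))"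
      unfolding d(2) by (simp add: algebra_simps)
    then show ?thesis using wV[of k] d(1) by (meson V.mult_mem)
  qed
  then obtain d where d: "\<And>k. d k \<in> V" "\<And>k. w (Suc k) - w k = of_nat p ^ k * (of_nat p * d k)" by metis
  \<comment> \<open>Completeness of \<open>V\<close> is stated for series, so the limit of
    \<open>w\<close> is reached as \<open>y\<close> plus the sum of the successive
    differences.\<close>
  obtain s where s: "s \<in> V" "\<And>N. \<exists>c\<in>V. s - (\<Sum>k<N. of_nat p ^ k * (of_nat p * d k)) = of_nat p ^ N * c"
    using V_complete[of "\<lambda>k. of_nat p * d k"] d(1) by (auto intro: V.mult_mem V.of_nat_mem)
  have tel: "(\<Sum>k<N. of_nat p ^ k * (of_nat p * d k)) = w N - y" for N
  proof -
    have "(\<Sum>k<N. of_nat p ^ k * (of_nat p * d k)) = (\<Sum>k<N. w (Suc k) - w k)" by (simp add: d(2))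
    also have "\<dots> = w N - w 0" by (rule sum_lessThan_telescope)
    finally show ?thesis by (simp add: w_def)
  qed
  define \<omega> where "\<omega> = y + s"
  have \<omega>V: "\<omega> \<in> V" using yV s(1) by (simp add: \<omega>_def V.add_mem)
  have conv: "\<exists>c\<in>V. \<omega> - w N = of_nat p ^ N * c" for N
    using s(2)[of N] unfolding tel by (simp add: \<omega>_def algebra_simps)
  have "\<omega> ^ M - 1 = 0"
  proof (rule p_powers_separated)
    show "\<omega> ^ M - 1 \<in> L" using \<omega>V VL V.diff_mem[OF V.power_mem[OF \<omega>V] V.one_mem] by blast
    fix N
    obtain c1 where c1: "c1 \<in> V" "\<omega> - w N = of_nat p ^ N * c1" using conv by blast
    obtain c2 where c2: "c2 \<in> V" "(y ^ M) ^ (p ^ (c * N) * 1) = 1 + of_nat p ^ Suc N * c2" using ymk by blast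
    have w2: "w N ^ M = 1 + of_nat p ^ N * (of_nat p * c2)"
      using c2(2) by (simp add: w_def mult_ac flip: power_mult)
    define c3 where "c3 = (\<Sum>i<M. w N ^ (M - Suc i) * \<omega> ^ i)"
    have c3: "c3 \<in> V" unfolding c3_def by (intro V.sum_mem V.mult_mem V.power_mem wV \<omega>V)
    have "\<omega> ^ M - w N ^ M = (\<omega> - w N) * c3"
      unfolding c3_def by (rule power_diff_sumr2)
    then have "\<omega> ^ M - 1 = of_nat p ^ N * (c1 * c3 + of_nat p * c2)"
      unfolding w2 c1(2) by (simp add: algebra_simps)
    moreover have "c1 * c3 + of_nat p * c2 \<in> V" using c1 c2 c3 by (intro V.add_mem V.mult_mem V.of_nat_mem)
    ultimately show "\<exists>y\<in>V. \<omega> ^ M - 1 = of_nat p ^ N * y" by blast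
  qed
  moreover have "y - \<omega> \<in> pV"
  proof -
    obtain c where c: "c \<in> V" "\<omega> - w 1 = of_nat p * c" using conv[of 1] by auto
    have "w 1 - y = of_nat p * d 0" using d(2)[of 0] by (simp add: w_def)
    then have "y - \<omega> = of_nat p * (- (c + d 0))" using c(2) by (simp add: algebra_simps)
    then show ?thesis using c d(1) by (auto simp: pV_def intro!: exI[of _ "- c - d 0"] V.uminus_mem V.diff_mem)
  qed
  ultimately show ?thesis using that[of \<omega> M a] \<omega>V M0 cop by (simp add: y_def)
qed

lemma frobenius_mod_p:
  assumes "x \<in> V" "y \<in> V"
  shows "(x + y) ^ p - (x ^ p + y ^ p) \<in> pV"
proof -
  have "(x + y) ^ p = (\<Sum>k\<le>p. of_nat (p choose k) * x ^ k * y ^ (p - k))" by (rule binomial_ring)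
  also have "{..p} = insert 0 (insert p {1..<p})" using p_pos by auto
  also have "(\<Sum>k\<in>insert 0 (insert p {1..<p}). of_nat (p choose k) * x ^ k * y ^ (p - k)) =
      y ^ p + (x ^ p + (\<Sum>k\<in>{1..<p}. of_nat (p choose k) * x ^ k * y ^ (p - k)))"
    using p_pos by simp
  also have "(\<Sum>k\<in>{1..<p}. of_nat (p choose k) * x ^ k * y ^ (p - k)) =
      of_nat p * (\<Sum>k\<in>{1..<p}. of_nat ((p choose k) div p) * x ^ k * y ^ (p - k))"
    unfolding sum_distrib_left
  proof (intro sum.cong refl)
    fix k assume "k \<in> {1..<p}"
    then have "p dvd (p choose k)" using prime_p by (intro dvd_choose_prime) auto
    then have "p choose k = p * ((p choose k) div p)" by simp
    then have "of_nat (p choose k) = (of_nat p * of_nat ((p choose k) div p) :: 'a)"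
      by (metis of_nat_mult)
    then show "of_nat (p choose k) * x ^ k * y ^ (p - k) = of_nat p * (of_nat ((p choose k) div p) * x ^ k * y ^ (p - k))"
      by (simp only: mult.assoc)
  qed
  finally have "(x + y) ^ p - (x ^ p + y ^ p) = of_nat p * (\<Sum>k\<in>{1..<p}. of_nat ((p choose k) div p) * x ^ k * y ^ (p - k))"
    by simp
  moreover have "(\<Sum>k\<in>{1..<p}. of_nat ((p choose k) div p) * x ^ k * y ^ (p - k)) \<in> V"
    using assms by (intro V.sum_mem V.mult_mem V.power_mem V.of_nat_mem)
  ultimately show ?thesis by (auto simp: pV_def)
qed

text \<open>Modulo \<open>P\<close> the \<open>p\<close>-th power is additive and, by Fermat, fixes
  the classes of integers, so \<open>(x - of_nat k) ^ p\<close> lies in \<open>P\<close>. This leads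
  back from \<open>x ^ (p ^ a)\<close>, whose class is lifted to a root of unity, to
  \<open>x\<close> itself.\<close>

lemma power_p_cong_P:
  assumes "x \<in> V" "x ^ p - of_nat k \<in> P"
  shows "x - of_nat k \<in> P"
proof -
  have "(x - of_nat k) ^ p \<in> P"
  proof -
    have "((x - of_nat k) + of_nat k) ^ p - ((x - of_nat k) ^ p + of_nat k ^ p) \<in> P"
      using assms by (intro pV_P frobenius_mod_p V.diff_mem V.of_nat_mem)
    then have 1: "x ^ p - ((x - of_nat k) ^ p + of_nat k ^ p) \<in> P" by simp
    have "[k ^ p = k] (mod p)"
    proof (cases "p dvd k")
      case True
      then have "p dvd k ^ p" using p_pos by (meson dvd_power dvd_trans)
      with True show ?thesis by (simp add: cong_def mod_eq_0_iff_dvd)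
    next
      case False
      then have "coprime k p" using prime_p prime_imp_coprime[of p k] by (simp add: coprime_commute)
      then have "[k ^ (p - 1) * k = 1 * k] (mod p)"
        using euler_theorem[of k p] prime_p by (intro cong_mult cong_refl) (simp add: totient_prime)
      then show ?thesis using power_minus_mult[OF p_pos, of k] by simp
    qed
    then have "int p dvd int k ^ p - int k"
      by (metis cong_iff_dvd_diff cong_int_iff of_nat_power)
    then obtain l where l: "int k ^ p - int k = int p * l" by blast
    have "(of_nat k ^ p - of_nat k :: 'a) = of_int (int k ^ p - int k)" by simp
    also have "\<dots> = of_nat p * of_int l" by (simp add: l)
    finally have "(of_nat k ^ p - of_nat k :: 'a) \<in> P"
      using P_mult[OF p_in_P V.of_int_mem] by simp
    then have "x ^ p - of_nat k - (of_nat k ^ p - of_nat k) - (x ^ p - ((x - of_nat k) ^ p + of_nat k ^ p)) \<in> P"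
      using P_diff[OF P_diff[OF assms(2)] 1] by blast
    also have "x ^ p - of_nat k - (of_nat k ^ p - of_nat k) - (x ^ p - ((x - of_nat k) ^ p + of_nat k ^ p)) = (x - of_nat k) ^ p"
      by simp
    finally show ?thesis .
  qed
  then show ?thesis using P_power_iff[of "x - of_nat k" p] assms(1) p_pos V.diff_mem V.of_nat_mem by blast
qed

lemma power_p_power_cong_P:
  assumes "x \<in> V" "x ^ (p ^ a) - of_nat k \<in> P"
  shows "x - of_nat k \<in> P"
  using assms(2)
proof (induction a)
  case (Suc a)
  have "(x ^ (p ^ a)) ^ p - of_nat k \<in> P" using Suc.prems by (simp add: mult.commute flip: power_mult)
  then have "x ^ (p ^ a) - of_nat k \<in> P" by (intro power_p_cong_P[OF V.power_mem[OF assms(1)]])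
  then show ?case by (rule Suc.IH)
qed simp

text \<open>The residue field \<open>V/P\<close> is the prime field, stated with natural numbers as
  representatives so that no quotient is formed.\<close>

definition residue_trivial :: bool where
  "residue_trivial \<longleftrightarrow> (\<forall>x\<in>V. \<exists>k::nat. x - of_nat k \<in> P)"

text \<open>Every unit has a power \<open>x ^ (p ^ a)\<close> congruent to a root of unity of order
  prime to \<open>p\<close>, and Frobenius is injective on the residue field.\<close>

lemma residue_trivialI:
  assumes "\<And>\<omega> M. \<omega> \<in> V \<Longrightarrow> M > 0 \<Longrightarrow> coprime p M \<Longrightarrow> \<omega> ^ M = 1 \<Longrightarrow> \<exists>k::nat. \<omega> - of_nat k \<in> P"
  shows residue_trivial
  unfolding residue_trivial_def
proof
  fix x assume x: "x \<in> V"
  show "\<exists>k::nat. x - of_nat k \<in> P"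
  proof (cases "x \<in> P")
    case True
    then show ?thesis by (intro exI[of _ 0]) simp
  next
    case False
    then have "unit x" using x by (simp add: P_def)
    then obtain a M \<omega> where w: "\<omega> \<in> V" "M > 0" "coprime p M" "\<omega> ^ M = 1" "x ^ (p ^ a) - \<omega> \<in> pV"
      by (rule root_of_unity_lift)
    obtain k :: nat where "\<omega> - of_nat k \<in> P" using assms w by blast
    then have "x ^ (p ^ a) - \<omega> + (\<omega> - of_nat k) \<in> P" by (rule P_add[OF pV_P[OF w(5)]])
    then have "x ^ (p ^ a) - of_nat k \<in> P" by simp
    then show ?thesis using power_p_power_cong_P[OF x] by blast
  qed
qed

text \<open>The least positive value divides all others by division with remainder. As
  \<open>p\<close> has the value \<open>D\<close>, the quotient \<open>e\<close> of \<open>D\<close>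
  by \<open>v \<pi>\<close> is the ramification index.\<close>

lemma exists_uniformizer:
  obtains \<pi> e where "\<pi> \<in> L" "\<pi> \<noteq> 0" "v \<pi> > 0" "\<And>x. x \<in> L \<Longrightarrow> x \<noteq> 0 \<Longrightarrow> v \<pi> dvd v x"
    "int D = int e * v \<pi>" "e > 0"
proof -
  define Q where "Q k \<longleftrightarrow> k > 0 \<and> (\<exists>x\<in>L. x \<noteq> 0 \<and> v x = int k)" for k
  have "Q D" unfolding Q_def using v_p by (intro conjI D_pos bexI[of _ "of_nat p"]) (auto simp: L.of_nat_mem)
  then have QL: "Q (LEAST k. Q k)" by (rule LeastI)
  then obtain \<pi> where pi: "\<pi> \<in> L" "\<pi> \<noteq> 0" "v \<pi> = int (LEAST k. Q k)" by (auto simp: Q_def)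
  have pos: "v \<pi> > 0" using QL pi by (simp add: Q_def)
  have dv: "v \<pi> dvd v x" if x: "x \<in> L" "x \<noteq> 0" for x
  proof (rule ccontr)
    assume nd: "\<not> v \<pi> dvd v x"
    define r where "r = v x mod v \<pi>"
    have r: "r > 0" "r < v \<pi>" using nd pos pos_mod_sign[OF pos, of "v x"] pos_mod_bound[OF pos, of "v x"]
      unfolding r_def dvd_eq_mod_eq_0 by linarith+
    have "v (x / \<pi> powi (v x div v \<pi>)) = v x - (v x div v \<pi>) * v \<pi>"
      using x pi by (subst v_divide) (auto simp: v_powi L.powi_mem)
    also have "\<dots> = r" by (simp add: r_def minus_div_mult_eq_mod)
    finally have "Q (nat r)" unfolding Q_def using r x pi
      by (intro conjI bexI[of _ "x / \<pi> powi (v x div v \<pi>)"]) (auto intro: L.divide_mem L.powi_mem)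
    then have "(LEAST k. Q k) \<le> nat r" by (rule Least_le)
    then show False using r pi(3) by linarith
  qed
  have "v \<pi> dvd int D" using dv[of "of_nat p"] v_p by (simp add: L.of_nat_mem)
  then obtain e where e: "int D = v \<pi> * e" by blast
  have "e > 0" using e pos D_pos by (metis of_nat_0_less_iff zero_less_mult_pos)
  then have "int D = int (nat e) * v \<pi>" "nat e > 0" using e by auto
  then show ?thesis using that[OF pi(1,2) pos dv] by blast
qed

text \<open>The powers of an element of value \<open>1/N\<close> below the \<open>N\<close>-th have distinct values modulo \<open>v(p)\<close>.\<close>

lemma poly_distinct_values:
  assumes x: "x \<in> L" "x \<noteq> 0" "v x > 0" "v x * int N = int D"
    and f: "coeffs_in K f" "degree f < N" "f \<noteq> 0"
  shows "poly f x \<noteq> 0" "poly f x \<in> V \<Longrightarrow> \<exists>k::nat. poly f x - of_nat k \<in> P"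
proof -
  define t where "t i = coeff f i * x ^ i" for i
  have sum: "poly f x = (\<Sum>i\<in>{..degree f}. t i)" by (simp add: poly_altdef t_def)
  have cK: "coeff f i \<in> K" and cL: "coeff f i \<in> L" for i using f(1) K_subset by (auto simp: coeffs_in_def)
  have tL: "t i \<in> L" for i unfolding t_def using x by (intro L.mult_mem L.power_mem cL)
  have vt: "v (t i) = v (coeff f i) + int i * v x" if "t i \<noteq> 0" for i
    using that cL x unfolding t_def by (subst v_mult) (auto simp: v_power L.power_mem)
  have inj: "i = j" if "i \<in> {..degree f}" "j \<in> {..degree f}" "t i \<noteq> 0" "t j \<noteq> 0" "v (t i) = v (t j)" for i j
  proof -
    have "int D dvd v (coeff f i)" "int D dvd v (coeff f j)" using that cK by (auto simp: t_def intro!: v_K)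
    then have "int D dvd v (coeff f j) - v (coeff f i)" by (intro dvd_diff)
    also have "v (coeff f j) - v (coeff f i) = (int i - int j) * v x"
      using that vt by (simp add: algebra_simps)
    finally have "int N * v x dvd (int i - int j) * v x" using x(4) by (simp add: mult.commute)
    then have "int N dvd int i - int j" using x(3) by simp
    moreover have "\<bar>int i - int j\<bar> < \<bar>int N\<bar>" using that f(2) by auto
    ultimately show "i = j" using dvd_imp_le_int[of "int i - int j" "int N"] by fastforce
  qed
  have nz: "t (degree f) \<noteq> 0" using f(3) x by (simp add: t_def)
  have "(\<forall>i\<in>{..degree f}. t i = 0) \<or>
    (\<exists>j\<in>{..degree f}. t j \<noteq> 0 \<and> unit ((\<Sum>i\<in>{..degree f}. t i) / t j) \<and>
      (\<forall>i\<in>{..degree f}. t i \<noteq> 0 \<longrightarrow> v (t j) \<le> v (t i)))"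
    by (rule distinct_values) (use inj tL in auto)
  then obtain j where j: "j \<le> degree f" "t j \<noteq> 0" "unit (poly f x / t j)"
    "\<And>i. i \<le> degree f \<Longrightarrow> t i \<noteq> 0 \<Longrightarrow> v (t j) \<le> v (t i)"
    using nz unfolding sum by auto
  show p0: "poly f x \<noteq> 0" using j(3) by (auto simp: unit_def)
  assume pV: "poly f x \<in> V"
  have pL: "poly f x \<in> L" using pV VL by blast
  have "v (poly f x / t j) = 0" using unit_iff[of "poly f x / t j"] j(2,3) p0 pL tL by (simp add: L.divide_mem)
  then have "v (t j) \<ge> 0" using V_iff[OF pL p0] pV j(2) p0 pL tL by (simp add: v_divide)
  then have ti: "v (t i) \<ge> 0" if "t i \<noteq> 0" "i \<le> degree f" for i using j(4) that by force
  \<comment> \<open>The term \<open>t i\<close> has a value at least \<open>0\<close> and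
    \<open>x ^ i\<close> a value below \<open>D\<close>, so a nonzero coefficient has a value above
    \<open>- D\<close>. Values on \<open>K\<close> are multiples of \<open>D\<close>, hence it is at
    least \<open>0\<close>.\<close>
  have cA: "coeff f i \<in> A" for i
  proof (cases "coeff f i = 0")
    case False
    then have t0: "t i \<noteq> 0" and i: "i \<le> degree f" using x by (auto simp: t_def intro: le_degree)
    have "int i * v x < int N * v x" using i f(2) x(3) by (intro mult_strict_right_mono) auto
    then have "int i * v x < int D" using x(4) by (simp add: mult.commute)
    then have "v (coeff f i) > - int D" using ti[OF t0 i] vt[OF t0] by linarith
    moreover obtain m where m: "v (coeff f i) = int D * m" using v_K[OF cK False] by blast
    ultimately have "int D * (- 1) < int D * m" by simp
    then have "m \<ge> 0" using D_pos by (simp only: mult_less_cancel_left) linarith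
    then have "coeff f i \<in> V" using V_iff[OF cL False] m by simp
    then show ?thesis using A_eq cK by blast
  qed (simp add: A.zero_mem)
  \<comment> \<open>All coefficients are integral and \<open>x\<close> lies in \<open>P\<close>, so
    modulo \<open>P\<close> only the constant coefficient remains, and its class is that of an
    integer.\<close>
  obtain k c where kc: "c \<in> A" "coeff f 0 = of_nat k + of_nat p * c" using A_residue[OF cA] by blast
  have xP: "x \<in> P" using P_iff x by simp
  obtain a g where ag: "f = pCons a g" by (cases f)
  have "coeff g i \<in> V" for i using cA[of "Suc i"] AV by (auto simp: ag)
  then have "poly g x \<in> V" using P_V[OF xP] by (intro V.poly_mem) (auto simp: coeffs_in_def)
  then have "x * poly g x \<in> P" by (intro P_mult xP)
  moreover have "of_nat p * c \<in> P" using kc AV by (intro P_mult p_in_P) auto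
  ultimately have "of_nat p * c + x * poly g x \<in> P" by (rule P_add[rotated])
  moreover have "poly f x - of_nat k = of_nat p * c + x * poly g x" using kc(2) by (simp add: ag)
  ultimately show "\<exists>k::nat. poly f x - of_nat k \<in> P" by (intro exI[of _ k]) simp
qed

text \<open>As the residue field is prime, integers serve as digits of a \<open>\<pi>\<close>-adic
  expansion, and after \<open>e\<close> digits the remainder lies in
  \<open>\<pi> ^ e * V = p * V\<close>. Independence holds because the values of
  \<open>1, \<pi>, ..., \<pi> ^ (e - 1)\<close> differ modulo \<open>v(p)\<close>. Thus the same
  \<open>e\<close> counts the basis and measures ramification.\<close>

theorem totally_ramified_basis:
  assumes rt: residue_trivial
  obtains \<pi> e where "e > 0" "\<pi> \<in> P" "\<And>x. x \<in> P \<Longrightarrow> \<exists>y\<in>V. x = \<pi> * y" "unit (\<pi> ^ e / of_nat p)"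
    "\<And>y. y \<in> V \<Longrightarrow> \<exists>a. (\<forall>i<e. a i \<in> A) \<and> y = (\<Sum>i<e. a i * \<pi> ^ i)"
    "\<And>a i. (\<And>i. i < e \<Longrightarrow> a i \<in> K) \<Longrightarrow> (\<Sum>i<e. a i * \<pi> ^ i) = 0 \<Longrightarrow> i < e \<Longrightarrow> a i = 0"
proof -
  obtain \<pi> e where pi: "\<pi> \<in> L" "\<pi> \<noteq> 0" "v \<pi> > 0" "\<And>x. x \<in> L \<Longrightarrow> x \<noteq> 0 \<Longrightarrow> v \<pi> dvd v x"
    "int D = int e * v \<pi>" "e > 0" using exists_uniformizer by blast
  have piV: "\<pi> \<in> V" using pi V_iff by simp
  have piP: "\<pi> \<in> P" using pi P_iff by simp
  have Ppi: "\<exists>y\<in>V. x = \<pi> * y" if x: "x \<in> P" for x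
  proof (cases "x = 0")
    case False
    have xL: "x \<in> L" using x P_V VL by blast
    have "v x > 0" using P_iff[of x] x xL False by simp
    then have "v \<pi> \<le> v x" using pi(4)[OF xL False] by (intro zdvd_imp_le)
    then have "x / \<pi> \<in> V" using divide_in_V_iff xL False pi by simp
    then show ?thesis using pi by (intro bexI[of _ "x / \<pi>"]) auto
  qed (auto intro: V.zero_mem)
  have un: "unit (\<pi> ^ e / of_nat p)"
    using pi by (subst unit_iff) (auto simp: v_divide v_power v_p L.power_mem L.of_nat_mem L.divide_mem)
  have stepk: "\<exists>c y. y \<in> V \<and> x = (\<Sum>i<k. of_nat (c i) * \<pi> ^ i) + \<pi> ^ k * y" if x: "x \<in> V" for x k
  proof (induction k)
    case 0
    then show ?case using x by auto
  next
    case (Suc k)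
    then obtain c y where cy: "y \<in> V" "x = (\<Sum>i<k. of_nat (c i) * \<pi> ^ i) + \<pi> ^ k * y" by blast
    obtain l :: nat where "y - of_nat l \<in> P" using rt cy(1) by (auto simp: residue_trivial_def)
    then obtain z where z: "z \<in> V" "y - of_nat l = \<pi> * z" using Ppi by blast
    have "x = (\<Sum>i<Suc k. of_nat ((c(k := l)) i) * \<pi> ^ i) + \<pi> ^ Suc k * z"
    proof -
      have "y = of_nat l + \<pi> * z" using z(2) by (simp add: algebra_simps)
      then show ?thesis unfolding cy(2) by (simp add: algebra_simps)
    qed
    then show ?case using z(1) by blast
  qed
  have gen: "\<exists>a z. (\<forall>i<e. a i \<in> A) \<and> z \<in> V \<and> y = (\<Sum>i<e. a i * \<pi> ^ i) + of_nat p * z" if y: "y \<in> V" for y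
  proof -
    obtain c z where cz: "z \<in> V" "y = (\<Sum>i<e. of_nat (c i) * \<pi> ^ i) + \<pi> ^ e * z" using stepk[OF y] by blast
    have "\<pi> ^ e * z = of_nat p * ((\<pi> ^ e / of_nat p) * z)" by simp
    moreover have "(\<pi> ^ e / of_nat p) * z \<in> V" using unit_V[OF un] cz by (intro V.mult_mem)
    ultimately show ?thesis using cz(2)
      by (intro exI[of _ "\<lambda>i. of_nat (c i)"] exI[of _ "(\<pi> ^ e / of_nat p) * z"]) (auto simp: A.of_nat_mem)
  qed
  have basis: "\<exists>a. (\<forall>i<e. a i \<in> A) \<and> y = (\<Sum>i<e. a i * \<pi> ^ i)" if "y \<in> V" for y
    by (rule generators[OF _ gen that]) (auto intro: V.power_mem piV)
  have indep: "a i = 0" if a: "\<And>i. i < e \<Longrightarrow> a i \<in> K" "(\<Sum>i<e. a i * \<pi> ^ i) = 0" "i < e" for a i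
  proof (rule ccontr)
    assume nz: "a i \<noteq> 0"
    define f where "f = (\<Sum>i<e. monom (a i) i)"
    have cf: "coeff f j = (if j < e then a j else 0)" for j by (simp add: f_def coeff_sum)
    have "coeffs_in K f" using a(1) by (simp add: coeffs_in_def cf K.zero_mem)
    moreover have "degree f < e" unfolding f_def
      using pi(6) by (intro degree_sum_less) (auto intro: le_less_trans[OF degree_monom_le])
    moreover have "f \<noteq> 0" using cf[of i] nz a(3) by auto
    ultimately have "poly f \<pi> \<noteq> 0"
      using pi by (intro poly_distinct_values(1)[of \<pi> e]) (simp_all add: mult.commute)
    then show False using a(2) by (simp add: f_def poly_sum poly_monom)
  qed
  show ?thesis
  proof (rule that[of e \<pi>])
    show "0 < e" "\<pi> \<in> P" "unit (\<pi> ^ e / of_nat p)" by fact+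
    show "\<exists>y\<in>V. x = \<pi> * y" if "x \<in> P" for x using Ppi[OF that] .
    show "\<exists>a. (\<forall>i<e. a i \<in> A) \<and> y = (\<Sum>i<e. a i * \<pi> ^ i)" if "y \<in> V" for y using basis[OF that] .
    show "a i = 0" if "\<And>i. i < e \<Longrightarrow> a i \<in> K" "(\<Sum>i<e. a i * \<pi> ^ i) = 0" "i < e" for a i
      using indep[OF that] .
  qed
qed

end

section \<open>The field of \<open>p\<close>-adic numbers\<close>

definition pval :: "nat \<Rightarrow> rat \<Rightarrow> int" where
  "pval p q = int (multiplicity (int p) (fst (quotient_of q))) - int (multiplicity (int p) (snd (quotient_of q)))"

lemma padic_norm_pval: "q \<noteq> 0 \<Longrightarrow> padic_norm p q = real p powi (- pval p q)"
  by (simp add: padic_norm_def pval_def)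

locale padic_prime =
  fixes p :: nat
  assumes prime_p: "prime p"
begin

lemma p_gt_1: "real p > 1"
  using prime_gt_1_nat[OF prime_p] by simp

text \<open>\<open>quotient_of\<close> yields a reduced fraction; cross-multiplication shows that
  the valuation can be read off from any fraction, as is needed for products.\<close>

lemma pval_divide:
  assumes "a \<noteq> 0" "b \<noteq> 0"
  shows "pval p (of_int a / of_int b) = int (multiplicity (int p) a) - int (multiplicity (int p) b)"
proof -
  let ?q = "of_int a / of_int b :: rat"
  obtain c d where cd: "quotient_of ?q = (c, d)" by fastforce
  have d: "d > 0" and q: "?q = of_int c / of_int d"
    using quotient_of_denom_pos[OF cd] quotient_of_div[OF cd] by auto
  have "of_int (a * d) = (of_int (c * b) :: rat)" using q assms d by (simp add: field_simps)
  then have eq: "a * d = c * b" by (simp only: of_int_eq_iff)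
  then have c: "c \<noteq> 0" using assms d by auto
  have pe: "prime_elem (int p)" using prime_p by simp
  have "multiplicity (int p) (a * d) = multiplicity (int p) (c * b)" using eq by simp
  then have "multiplicity (int p) a + multiplicity (int p) d = multiplicity (int p) c + multiplicity (int p) b"
    using pe assms c d by (simp add: prime_elem_multiplicity_mult_distrib)
  then show ?thesis by (simp add: pval_def cd)
qed

lemma pval_mult: assumes "x \<noteq> 0" "y \<noteq> 0" shows "pval p (x * y) = pval p x + pval p y"
proof -
  obtain a b where ab: "x = of_int a / of_int b" "a \<noteq> 0" "b \<noteq> 0"
    using assms(1) by (metis Fract_of_int_quotient Rat_cases div_0 less_irrefl of_int_0)
  obtain c d where cd: "y = of_int c / of_int d" "c \<noteq> 0" "d \<noteq> 0"
    using assms(2) by (metis Fract_of_int_quotient Rat_cases div_0 less_irrefl of_int_0)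
  have "x * y = of_int (a * c) / of_int (b * d)" by (simp add: ab cd)
  then have "pval p (x * y) = int (multiplicity (int p) (a * c)) - int (multiplicity (int p) (b * d))"
    using pval_divide[of "a * c" "b * d"] ab cd by simp
  then show ?thesis using ab cd pval_divide[of a b] pval_divide[of c d] prime_p
    by (simp add: prime_elem_multiplicity_mult_distrib)
qed

lemma padic_norm_0 [simp]: "padic_norm p 0 = 0"
  by (simp add: padic_norm_def)

lemma padic_norm_nonneg: "padic_norm p x \<ge> 0"
  by (simp add: padic_norm_def)

lemma padic_norm_pos: "x \<noteq> 0 \<Longrightarrow> padic_norm p x > 0"
  using p_gt_1 by (simp add: padic_norm_def)

lemma padic_norm_eq_0_iff [simp]: "padic_norm p x = 0 \<longleftrightarrow> x = 0"
  using padic_norm_pos[of x] by (cases "x = 0") auto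

lemma padic_norm_mult: "padic_norm p (x * y) = padic_norm p x * padic_norm p y"
  using p_gt_1 by (cases "x = 0 \<or> y = 0") (auto simp: padic_norm_pval pval_mult power_int_add[symmetric] add.commute)

lemma padic_norm_1 [simp]: "padic_norm p 1 = 1"
  by (simp add: padic_norm_def)

lemma padic_norm_inverse: "padic_norm p (inverse x) = inverse (padic_norm p x)"
proof (cases "x = 0")
  case False
  then have "padic_norm p x * padic_norm p (inverse x) = 1" by (simp flip: padic_norm_mult)
  then show ?thesis by (metis inverse_unique)
qed auto

lemma padic_norm_le_1_of_int: "padic_norm p (of_int a) \<le> 1"
proof (cases "a = 0")
  case False
  then show ?thesis using p_gt_1 by (simp add: padic_norm_def power_int_minus power_int_of_nat field_simps)
qed auto

lemma padic_norm_uminus [simp]: "padic_norm p (- x) = padic_norm p x"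
proof -
  have "padic_norm p (-1) * padic_norm p (-1) = 1" by (simp flip: padic_norm_mult)
  then have "padic_norm p (-1) = 1" using padic_norm_nonneg[of "-1"]
    by (metis abs_of_nonneg real_sqrt_abs2 real_sqrt_one)
  then show ?thesis using padic_norm_mult[of "-1" x] by simp
qed

lemma padic_norm_p: "padic_norm p (of_nat p) = inverse (real p)"
proof -
  have "of_nat p = (of_int (int p) :: rat)" by simp
  moreover have "multiplicity (int p) (int p) = 1" using prime_p by (simp add: multiplicity_self prime_gt_0_nat not_prime_unit)
  ultimately show ?thesis using prime_gt_0_nat[OF prime_p] by (simp add: padic_norm_def power_int_minus del: of_int_of_nat_eq)
qed

text \<open>Fractions with denominator prime to \<open>p\<close> are visibly closed under addition,
  which makes this description the source of the ultrametric inequality.\<close>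

lemma padic_norm_le_1_iff: "padic_norm p x \<le> 1 \<longleftrightarrow> (\<exists>a b. x = of_int a / of_int b \<and> \<not> int p dvd b)"
proof
  assume le: "padic_norm p x \<le> 1"
  obtain a b where ab: "quotient_of x = (a, b)" by fastforce
  have x: "x = of_int a / of_int b" and cop: "coprime a b" and b: "b > 0"
    using quotient_of_div[OF ab] quotient_of_coprime[OF ab] quotient_of_denom_pos[OF ab] by auto
  have "\<not> int p dvd b"
  proof
    assume d: "int p dvd b"
    then have na: "\<not> int p dvd a" using cop prime_p by (metis coprime_common_divisor not_prime_unit prime_nat_int_transfer)
    then have a0: "a \<noteq> 0" by auto
    then have x0: "x \<noteq> 0" using x b by simp
    have "multiplicity (int p) a = 0" using na by (rule not_dvd_imp_multiplicity_0)
    moreover have "multiplicity (int p) b > 0"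
      using d b prime_gt_1_nat[OF prime_p] by (subst multiplicity_gt_zero_iff) auto
    ultimately have "- pval p x > 0" by (simp add: pval_def ab)
    then have "real p powi (- pval p x) > 1" using p_gt_1 by (auto simp: power_int_def one_less_power)
    then show False using le padic_norm_pval[OF x0] by simp
  qed
  then show "\<exists>a b. x = of_int a / of_int b \<and> \<not> int p dvd b" using x by blast
next
  assume "\<exists>a b. x = of_int a / of_int b \<and> \<not> int p dvd b"
  then obtain a b where ab: "x = of_int a / of_int b" "\<not> int p dvd b" by blast
  show "padic_norm p x \<le> 1"
  proof (cases "a = 0")
    case False
    have b: "b \<noteq> 0" using ab by auto
    have "pval p x \<ge> 0" using pval_divide[OF False b] ab by (simp add: not_dvd_imp_multiplicity_0)
    moreover have "x \<noteq> 0" using ab False b by simp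
    ultimately show ?thesis using p_gt_1 by (simp add: padic_norm_pval power_int_minus one_le_power_int inverse_le_1_iff)
  qed (use ab in simp)
qed

lemma padic_norm_add_le_1: assumes "padic_norm p x \<le> 1" "padic_norm p y \<le> 1" shows "padic_norm p (x + y) \<le> 1"
proof -
  obtain a b c d where *: "x = of_int a / of_int b" "\<not> int p dvd b" "y = of_int c / of_int d" "\<not> int p dvd d"
    using assms padic_norm_le_1_iff by metis
  have "b \<noteq> 0" "d \<noteq> 0" using * by auto
  then have "x + y = of_int (a * d + c * b) / of_int (b * d)" using * by (simp add: add_frac_eq)
  moreover have "\<not> int p dvd b * d" using * prime_p by (simp add: prime_dvd_mult_iff)
  ultimately show ?thesis using padic_norm_le_1_iff by blast
qed

lemma padic_norm_add: "padic_norm p (x + y) \<le> max (padic_norm p x) (padic_norm p y)"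
proof -
  have *: "padic_norm p (x + y) \<le> padic_norm p y" if "padic_norm p x \<le> padic_norm p y" "y \<noteq> 0" for x y
  proof -
    have "padic_norm p (x / y) = padic_norm p x / padic_norm p y"
      by (simp add: divide_inverse padic_norm_mult padic_norm_inverse)
    then have "padic_norm p (x / y) \<le> 1" using that padic_norm_pos[of y] by simp
    then have "padic_norm p (x / y + 1) \<le> 1" by (intro padic_norm_add_le_1) auto
    then have "padic_norm p (y * (x / y + 1)) \<le> padic_norm p y * 1"
      unfolding padic_norm_mult by (intro mult_left_mono padic_norm_nonneg)
    then show ?thesis using that by (simp add: distrib_left)
  qed
  show ?thesis
  proof (cases "x = 0 \<or> y = 0")
    case False
    then show ?thesis using *[of x y] *[of y x] by (cases "padic_norm p x \<le> padic_norm p y") (auto simp: add.commute)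
  qed (auto simp: padic_norm_nonneg)
qed

lemma padic_norm_diff: "padic_norm p (x - y) \<le> max (padic_norm p x) (padic_norm p y)"
  using padic_norm_add[of x "- y"] by simp

lemma padic_norm_triangle: "padic_norm p (x + y) \<le> padic_norm p x + padic_norm p y"
  using padic_norm_add[of x y] padic_norm_nonneg[of x] padic_norm_nonneg[of y] by linarith

lemma padic_norm_abs_diff: "\<bar>padic_norm p x - padic_norm p y\<bar> \<le> padic_norm p (x - y)"
  using padic_norm_triangle[of "x - y" y] padic_norm_triangle[of "y - x" x] padic_norm_uminus[of "x - y"]
  by simp

lemma padic_norm_power: "padic_norm p (x ^ n) = padic_norm p x ^ n"
  by (induction n) (auto simp: padic_norm_mult)

lemma padic_norm_eq_of_diff_less: assumes "padic_norm p (x - y) < padic_norm p x" shows "padic_norm p y = padic_norm p x"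
proof -
  have "padic_norm p x \<le> max (padic_norm p (x - y)) (padic_norm p y)" using padic_norm_add[of "x - y" y] by simp
  moreover have "padic_norm p y \<le> max (padic_norm p (x - y)) (padic_norm p x)"
    using padic_norm_diff[of x "x - y"] by (simp add: max.commute)
  ultimately show ?thesis using assms by linarith
qed

lemma padic_CauchyD: "f \<in> padic_Cauchy p \<Longrightarrow> e > 0 \<Longrightarrow> \<exists>N. \<forall>m\<ge>N. \<forall>n\<ge>N. padic_norm p (f m - f n) < e"
  by (simp add: padic_Cauchy_def)

lemma padic_Cauchy_norm_convergent:
  assumes "f \<in> padic_Cauchy p" shows "convergent (\<lambda>n. padic_norm p (f n))"
  unfolding Cauchy_convergent_iff[symmetric] Cauchy_iff
proof (intro allI impI)
  fix e :: real assume "e > 0"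
  then obtain N where "\<forall>m\<ge>N. \<forall>n\<ge>N. padic_norm p (f m - f n) < e" using padic_CauchyD assms by blast
  then show "\<exists>M. \<forall>m\<ge>M. \<forall>n\<ge>M. norm (padic_norm p (f m) - padic_norm p (f n)) < e"
    using padic_norm_abs_diff by (metis le_less_trans real_norm_def)
qed

lemma padic_Cauchy_const: "(\<lambda>n. c) \<in> padic_Cauchy p"
  by (simp add: padic_Cauchy_def)

lemma padic_Cauchy_add:
  assumes "f \<in> padic_Cauchy p" "g \<in> padic_Cauchy p" shows "(\<lambda>n. f n + g n) \<in> padic_Cauchy p"
  unfolding padic_Cauchy_def
proof (intro CollectI allI impI)
  fix e :: real assume e: "e > 0"
  obtain N where N: "\<forall>m\<ge>N. \<forall>n\<ge>N. padic_norm p (f m - f n) < e" using padic_CauchyD assms e by blast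
  obtain M where M: "\<forall>m\<ge>M. \<forall>n\<ge>M. padic_norm p (g m - g n) < e" using padic_CauchyD assms e by blast
  have "padic_norm p (f m + g m - (f n + g n)) < e" if "m \<ge> max N M" "n \<ge> max N M" for m n
  proof -
    have "padic_norm p (f m - f n) < e" "padic_norm p (g m - g n) < e" using N M that by auto
    then have "padic_norm p ((f m - f n) + (g m - g n)) < e"
      using padic_norm_add[of "f m - f n" "g m - g n"] by linarith
    then show ?thesis by (simp add: algebra_simps)
  qed
  then show "\<exists>N. \<forall>m\<ge>N. \<forall>n\<ge>N. padic_norm p (f m + g m - (f n + g n)) < e" by blast
qed

lemma padic_Cauchy_bounded:
  assumes "f \<in> padic_Cauchy p" shows "\<exists>B>0. \<forall>n. padic_norm p (f n) \<le> B"
proof -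
  have "Bseq (\<lambda>n. padic_norm p (f n))"
    by (intro convergent_imp_Bseq padic_Cauchy_norm_convergent assms)
  then show ?thesis unfolding Bseq_def using padic_norm_nonneg by auto
qed

lemma padic_Cauchy_mult:
  assumes "f \<in> padic_Cauchy p" "g \<in> padic_Cauchy p" shows "(\<lambda>n. f n * g n) \<in> padic_Cauchy p"
  unfolding padic_Cauchy_def
proof (intro CollectI allI impI)
  fix e :: real assume e: "e > 0"
  obtain B where B: "B > 0" "\<And>n. padic_norm p (f n) \<le> B" using padic_Cauchy_bounded assms by blast
  obtain C where C: "C > 0" "\<And>n. padic_norm p (g n) \<le> C" using padic_Cauchy_bounded assms by blast
  obtain N where N: "\<forall>m\<ge>N. \<forall>n\<ge>N. padic_norm p (f m - f n) < e / C"
    using padic_CauchyD assms e C by (meson divide_pos_pos)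
  obtain M where M: "\<forall>m\<ge>M. \<forall>n\<ge>M. padic_norm p (g m - g n) < e / B"
    using padic_CauchyD assms e B by (meson divide_pos_pos)
  have "padic_norm p (f m * g m - f n * g n) < e" if "m \<ge> max N M" "n \<ge> max N M" for m n
  proof -
    have 1: "padic_norm p (f m * (g m - g n)) < e"
    proof -
      have "padic_norm p (f m) * padic_norm p (g m - g n) \<le> B * padic_norm p (g m - g n)"
        by (intro mult_right_mono B padic_norm_nonneg)
      also have "\<dots> < B * (e / B)" using M that B by (intro mult_strict_left_mono) auto
      finally show ?thesis using B by (simp add: padic_norm_mult)
    qed
    have 2: "padic_norm p ((f m - f n) * g n) < e"
    proof -
      have "padic_norm p (f m - f n) * padic_norm p (g n) \<le> padic_norm p (f m - f n) * C"
        by (intro mult_left_mono C padic_norm_nonneg)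
      also have "\<dots> < (e / C) * C" using N that C by (intro mult_strict_right_mono) auto
      finally show ?thesis using C by (simp add: padic_norm_mult)
    qed
    have "f m * g m - f n * g n = f m * (g m - g n) + (f m - f n) * g n" by (simp add: algebra_simps)
    then show ?thesis using padic_norm_add[of "f m * (g m - g n)" "(f m - f n) * g n"] 1 2 by simp
  qed
  then show "\<exists>N. \<forall>m\<ge>N. \<forall>n\<ge>N. padic_norm p (f m * g m - f n * g n) < e" by blast
qed

lemma padic_Cauchy_uminus: "f \<in> padic_Cauchy p \<Longrightarrow> (\<lambda>n. - f n) \<in> padic_Cauchy p"
  using padic_Cauchy_mult[OF padic_Cauchy_const[of "-1"]] by simp

lemma padic_null_eventually:
  "f \<in> padic_null p \<Longrightarrow> e > 0 \<Longrightarrow> eventually (\<lambda>n. padic_norm p (f n) < e) sequentially"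
  unfolding padic_null_def by (auto intro: order_tendstoD(2))

lemma padic_nullI:
  assumes "\<And>e. e > 0 \<Longrightarrow> eventually (\<lambda>n. padic_norm p (f n) < e) sequentially"
  shows "f \<in> padic_null p"
  unfolding padic_null_def
  by (intro CollectI order_tendstoI assms always_eventually allI less_le_trans[OF _ padic_norm_nonneg])

lemma padic_null_add: "f \<in> padic_null p \<Longrightarrow> g \<in> padic_null p \<Longrightarrow> (\<lambda>n. f n + g n) \<in> padic_null p"
proof (rule padic_nullI)
  fix e :: real assume *: "f \<in> padic_null p" "g \<in> padic_null p" "e > 0"
  show "eventually (\<lambda>n. padic_norm p (f n + g n) < e) sequentially"
    using padic_null_eventually[OF *(1,3)] padic_null_eventually[OF *(2,3)]
    by eventually_elim (use padic_norm_add in \<open>fastforce intro: le_less_trans\<close>)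
qed

lemma padic_null_mult:
  assumes "f \<in> padic_Cauchy p" "g \<in> padic_null p" shows "(\<lambda>n. f n * g n) \<in> padic_null p"
proof (rule padic_nullI)
  fix e :: real assume e: "e > 0"
  obtain B where B: "B > 0" "\<And>n. padic_norm p (f n) \<le> B" using padic_Cauchy_bounded assms by blast
  have "e / B > 0" using e B by simp
  from padic_null_eventually[OF assms(2) this] show "eventually (\<lambda>n. padic_norm p (f n * g n) < e) sequentially"
  proof eventually_elim
    case (elim n)
    have "padic_norm p (f n) * padic_norm p (g n) \<le> B * padic_norm p (g n)"
      by (intro mult_right_mono B padic_norm_nonneg)
    also have "\<dots> < B * (e / B)" using elim B by (intro mult_strict_left_mono) auto
    finally show ?case using B by (simp add: padic_norm_mult)
  qed
qed

lemma padic_null_uminus: "f \<in> padic_null p \<Longrightarrow> (\<lambda>n. - f n) \<in> padic_null p"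
  by (simp add: padic_null_def)

lemma padic_null_Cauchy: assumes "f \<in> padic_null p" shows "f \<in> padic_Cauchy p"
  unfolding padic_Cauchy_def
proof (intro CollectI allI impI)
  fix e :: real assume e: "e > 0"
  obtain N where "\<And>n. n \<ge> N \<Longrightarrow> padic_norm p (f n) < e"
    using padic_null_eventually[OF assms e] by (auto simp: eventually_sequentially)
  then show "\<exists>N. \<forall>m\<ge>N. \<forall>n\<ge>N. padic_norm p (f m - f n) < e"
    using padic_norm_diff by (meson le_less_trans max_less_iff_conj)
qed

text \<open>Beyond an index where the terms exceed half the limit of the norms and the differences
  stay below it, the ultrametric inequality forces equal norms. Conditions on the norm of a class
  thus become eventual conditions on a representative.\<close>

lemma padic_nonnull_eventually_const:
  assumes f: "f \<in> padic_Cauchy p" "f \<notin> padic_null p"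
  shows "\<exists>c>0. eventually (\<lambda>n. padic_norm p (f n) = c) sequentially"
proof -
  obtain c where c: "(\<lambda>n. padic_norm p (f n)) \<longlonglongrightarrow> c"
    using padic_Cauchy_norm_convergent[OF f(1)] by (auto simp: convergent_def)
  have "c \<ge> 0" using c by (rule LIMSEQ_le_const) (auto simp: padic_norm_nonneg)
  moreover have "c \<noteq> 0" using f(2) c by (auto simp: padic_null_def)
  ultimately have c0: "c > 0" by simp
  have "eventually (\<lambda>n. padic_norm p (f n) > c / 2) sequentially" using c c0 by (intro order_tendstoD) auto
  then obtain N where N: "\<And>n. n \<ge> N \<Longrightarrow> padic_norm p (f n) > c / 2" by (auto simp: eventually_sequentially)
  obtain M where M: "\<forall>m\<ge>M. \<forall>n\<ge>M. padic_norm p (f m - f n) < c / 2"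
    using padic_CauchyD[OF f(1)] c0 by (meson half_gt_zero)
  define k where "k = max N M"
  have "padic_norm p (f n) = padic_norm p (f k)" if "n \<ge> k" for n
  proof (rule padic_norm_eq_of_diff_less)
    have "padic_norm p (f k - f n) < c / 2" using M that by (auto simp: k_def)
    also have "\<dots> < padic_norm p (f k)" using N[of k] by (simp add: k_def)
    finally show "padic_norm p (f k - f n) < padic_norm p (f k)" .
  qed
  then have "eventually (\<lambda>n. padic_norm p (f n) = padic_norm p (f k)) sequentially"
    unfolding eventually_sequentially by blast
  moreover have "padic_norm p (f k) > 0" using N[of k] c0 by (simp add: k_def)
  ultimately show ?thesis by blast
qed

text \<open>The inverse sequence has the default value \<open>0\<close> where \<open>f\<close>
  vanishes, which happens finitely often, so \<open>f n * inverse (f n)\<close> is \<open>1\<close>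
  up to a null sequence.\<close>

lemma padic_inverse:
  assumes f: "f \<in> padic_Cauchy p" "f \<notin> padic_null p"
  shows "(\<lambda>n. inverse (f n)) \<in> padic_Cauchy p" "(\<lambda>n. f n * inverse (f n) - 1) \<in> padic_null p"
proof -
  obtain c where c: "c > 0" "eventually (\<lambda>n. padic_norm p (f n) = c) sequentially"
    using padic_nonnull_eventually_const[OF f] by blast
  obtain N where N: "\<And>n. n \<ge> N \<Longrightarrow> padic_norm p (f n) = c" using c(2) by (auto simp: eventually_sequentially)
  have nz: "f n \<noteq> 0" if "n \<ge> N" for n using N[OF that] c(1) by auto
  show "(\<lambda>n. inverse (f n)) \<in> padic_Cauchy p"
    unfolding padic_Cauchy_def
  proof (intro CollectI allI impI)
    fix e :: real assume e: "e > 0"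
    then have "e * c * c > 0" using c by simp
    then obtain M where M: "\<forall>m\<ge>M. \<forall>n\<ge>M. padic_norm p (f m - f n) < e * c * c"
      using padic_CauchyD[OF f(1)] by blast
    have "padic_norm p (inverse (f m) - inverse (f n)) < e" if "m \<ge> max N M" "n \<ge> max N M" for m n
    proof -
      have "inverse (f m) - inverse (f n) = (f n - f m) * (inverse (f m) * inverse (f n))"
        using nz[of m] nz[of n] that by (simp add: field_simps)
      then have "padic_norm p (inverse (f m) - inverse (f n)) = padic_norm p (f n - f m) * (inverse c * inverse c)"
        using N[of m] N[of n] that by (simp add: padic_norm_mult padic_norm_inverse)
      also have "\<dots> < (e * c * c) * (inverse c * inverse c)"
        using M that c by (intro mult_strict_right_mono) auto
      also have "\<dots> = e" using c by (simp add: field_simps)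
      finally show ?thesis .
    qed
    then show "\<exists>N. \<forall>m\<ge>N. \<forall>n\<ge>N. padic_norm p (inverse (f m) - inverse (f n)) < e" by blast
  qed
  show "(\<lambda>n. f n * inverse (f n) - 1) \<in> padic_null p"
  proof (rule padic_nullI)
    fix e :: real assume "e > 0"
    then show "eventually (\<lambda>n. padic_norm p (f n * inverse (f n) - 1) < e) sequentially"
      unfolding eventually_sequentially using nz by (intro exI[of _ N]) auto
  qed
qed

end

lemma (in padic_prime) cring_padic_Cauchy_ring: "cring (padic_Cauchy_ring p)"
proof (rule cringI)
  note [simp] = padic_Cauchy_add padic_Cauchy_mult
    padic_Cauchy_const
  show "abelian_group (padic_Cauchy_ring p)"
  proof (rule abelian_groupI)
    fix f assume "f \<in> carrier (padic_Cauchy_ring p)"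
    then show "\<exists>y\<in>carrier (padic_Cauchy_ring p). y \<oplus>\<^bsub>padic_Cauchy_ring p\<^esub> f = \<zero>\<^bsub>padic_Cauchy_ring p\<^esub>"
      using padic_Cauchy_uminus[of f]
      by (intro bexI[of _ "\<lambda>n. - f n"]) (auto simp: padic_Cauchy_ring_def)
  qed (auto simp: padic_Cauchy_ring_def add_ac)
  show "Group.comm_monoid (padic_Cauchy_ring p)"
    by (rule comm_monoidI) (auto simp: padic_Cauchy_ring_def mult_ac)
qed (auto simp: padic_Cauchy_ring_def algebra_simps)

lemma (in padic_prime) ideal_padic_null: "ideal (padic_null p) (padic_Cauchy_ring p)"
proof (rule idealI)
  interpret cring "padic_Cauchy_ring p" by (rule cring_padic_Cauchy_ring)
  show "ring (padic_Cauchy_ring p)" by (rule ring_axioms)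
  show "subgroup (padic_null p) (add_monoid (padic_Cauchy_ring p))"
  proof (rule group.subgroupI[OF a_group])
    show "padic_null p \<subseteq> carrier (add_monoid (padic_Cauchy_ring p))"
      using padic_null_Cauchy by (auto simp: padic_Cauchy_ring_def)
    show "padic_null p \<noteq> {}" using padic_norm_0 by (auto simp: padic_null_def intro!: exI[of _ "\<lambda>n. 0"])
  next
    fix f assume f: "f \<in> padic_null p"
    have "inv\<^bsub>add_monoid (padic_Cauchy_ring p)\<^esub> f = (\<lambda>n. - f n)"
      using padic_Cauchy_uminus padic_null_Cauchy[OF f]
      by (intro group.inv_equality[OF a_group]) (auto simp: padic_Cauchy_ring_def)
    then show "inv\<^bsub>add_monoid (padic_Cauchy_ring p)\<^esub> f \<in> padic_null p"
      using padic_null_uminus[OF f] by simp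
  next
    fix f g assume "f \<in> padic_null p" "g \<in> padic_null p"
    then show "f \<otimes>\<^bsub>add_monoid (padic_Cauchy_ring p)\<^esub> g \<in> padic_null p"
      using padic_null_add by (simp add: padic_Cauchy_ring_def)
  qed
next
  fix f x assume "f \<in> padic_null p" "x \<in> carrier (padic_Cauchy_ring p)"
  then show "x \<otimes>\<^bsub>padic_Cauchy_ring p\<^esub> f \<in> padic_null p" "f \<otimes>\<^bsub>padic_Cauchy_ring p\<^esub> x \<in> padic_null p"
    using padic_null_mult[of x f] by (auto simp: padic_Cauchy_ring_def mult.commute)
qed

text \<open>Representatives of elements of \<open>Zp p\<close>. An eventual bound can replace the
  bound on the limit because the norms become constant or tend to \<open>0\<close>.\<close>

definition padic_integral :: "nat \<Rightarrow> (nat \<Rightarrow> rat) set" where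
  "padic_integral p = {f \<in> padic_Cauchy p. eventually (\<lambda>n. padic_norm p (f n) \<le> 1) sequentially}"

locale Qp_embedding = padic_prime p for p :: nat +
  fixes \<sigma> :: "(nat \<Rightarrow> rat) set \<Rightarrow> 'a::field"
  assumes \<sigma>: "\<sigma> \<in> ring_hom (Qp p) ring_of_type_algebra"
begin

abbreviation "C \<equiv> padic_Cauchy p"

text \<open>The embedding pulled back to Cauchy sequences, so that arithmetic takes place on
  representatives; its kernel consists of the null sequences.\<close>

definition \<phi> :: "(nat \<Rightarrow> rat) \<Rightarrow> 'a" where
  "\<phi> f = \<sigma> (padic_null p +>\<^bsub>padic_Cauchy_ring p\<^esub> f)"

lemma \<phi>_hom: "\<phi> \<in> ring_hom (padic_Cauchy_ring p) ring_of_type_algebra"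
proof -
  have "(+>\<^bsub>padic_Cauchy_ring p\<^esub>) (padic_null p) \<in> ring_hom (padic_Cauchy_ring p) (Qp p)"
    unfolding Qp_def by (rule ideal.rcos_ring_hom[OF ideal_padic_null])
  then have "\<sigma> \<circ> (+>\<^bsub>padic_Cauchy_ring p\<^esub>) (padic_null p) \<in> ring_hom (padic_Cauchy_ring p) ring_of_type_algebra"
    using \<sigma> by (rule ring_hom_trans)
  then show ?thesis by (simp add: \<phi>_def[abs_def] comp_def)
qed

lemma \<phi>_add: "f \<in> C \<Longrightarrow> g \<in> C \<Longrightarrow> \<phi> (\<lambda>n. f n + g n) = \<phi> f + \<phi> g"
  using ring_hom_add[OF \<phi>_hom, of f g] by (simp add: padic_Cauchy_ring_def ring_of_type_algebra_def)

lemma \<phi>_mult: "f \<in> C \<Longrightarrow> g \<in> C \<Longrightarrow> \<phi> (\<lambda>n. f n * g n) = \<phi> f * \<phi> g"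
  using ring_hom_mult[OF \<phi>_hom, of f g] by (simp add: padic_Cauchy_ring_def ring_of_type_algebra_def)

lemma \<phi>_1: "\<phi> (\<lambda>n. 1) = 1"
  using ring_hom_one[OF \<phi>_hom] by (simp add: padic_Cauchy_ring_def ring_of_type_algebra_def)

lemma \<phi>_0: "\<phi> (\<lambda>n. 0) = 0"
proof -
  have "\<phi> (\<lambda>n. 0) + \<phi> (\<lambda>n. 0) = \<phi> (\<lambda>n. 0) + 0"
    using \<phi>_add[of "\<lambda>n. 0" "\<lambda>n. 0"] padic_Cauchy_const by simp
  then show ?thesis by (rule add_left_imp_eq)
qed

lemma \<phi>_null: assumes "f \<in> padic_null p" shows "\<phi> f = 0"
proof -
  interpret ideal "padic_null p" "padic_Cauchy_ring p" by (rule ideal_padic_null)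
  have "(\<lambda>n. 0) \<in> padic_null p" using padic_norm_0 by (simp add: padic_null_def)
  then have "\<phi> f = \<phi> (\<lambda>n. 0)" using assms a_rcos_zero by (simp add: \<phi>_def a_rcos_const)
  then show ?thesis by (simp add: \<phi>_0)
qed

lemma \<phi>_uminus: assumes "f \<in> C" shows "\<phi> (\<lambda>n. - f n) = - \<phi> f"
proof -
  have "\<phi> f + \<phi> (\<lambda>n. - f n) = \<phi> (\<lambda>n. f n + - f n)"
    using assms padic_Cauchy_uminus[OF assms] by (simp only: \<phi>_add)
  then show ?thesis by (simp add: \<phi>_0 eq_neg_iff_add_eq_0 add.commute)
qed

lemma Cauchy_diff: "f \<in> C \<Longrightarrow> g \<in> C \<Longrightarrow> (\<lambda>n. f n - g n) \<in> C"
  using padic_Cauchy_add[of f "\<lambda>n. - g n"] padic_Cauchy_uminus[of g] by simp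

lemma \<phi>_diff: "f \<in> C \<Longrightarrow> g \<in> C \<Longrightarrow> \<phi> (\<lambda>n. f n - g n) = \<phi> f - \<phi> g"
  using \<phi>_add[of f "\<lambda>n. - g n"] padic_Cauchy_uminus[of g] \<phi>_uminus[of g] by simp

lemma \<phi>_inverse: assumes "f \<in> C" "f \<notin> padic_null p"
  shows "\<phi> f * \<phi> (\<lambda>n. inverse (f n)) = 1"
proof -
  note inv = padic_inverse[OF assms]
  have "\<phi> f * \<phi> (\<lambda>n. inverse (f n)) - 1 = \<phi> (\<lambda>n. f n * inverse (f n) - 1)"
    using assms inv(1) padic_Cauchy_const[of 1] padic_Cauchy_mult[OF assms(1) inv(1)]
    by (simp add: \<phi>_diff \<phi>_mult \<phi>_1)
  then show ?thesis using \<phi>_null[OF inv(2)] by simp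
qed

lemma \<phi>_eq_0_iff: "f \<in> C \<Longrightarrow> \<phi> f = 0 \<longleftrightarrow> f \<in> padic_null p"
  using \<phi>_null \<phi>_inverse by fastforce

lemma image_carrier: "\<sigma> ` carrier (Qp p) = \<phi> ` C"
proof -
  have "carrier (Qp p) = (\<lambda>f. padic_null p +>\<^bsub>padic_Cauchy_ring p\<^esub> f) ` C"
    by (auto simp: Qp_def FactRing_def A_RCOSETS_def' padic_Cauchy_ring_def)
  then show ?thesis by (simp add: image_image \<phi>_def)
qed

text \<open>Representatives differ by null sequences, so their norms have the same limit, and the
  class contains \<open>f\<close>. Hence the definite description has exactly one candidate.\<close>

lemma Qp_norm_class:
  assumes f: "f \<in> C" and c: "(\<lambda>n. padic_norm p (f n)) \<longlonglongrightarrow> c"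
  shows "Qp_norm p (padic_null p +>\<^bsub>padic_Cauchy_ring p\<^esub> f) = c"
proof -
  have eq: "padic_null p +>\<^bsub>padic_Cauchy_ring p\<^esub> f = {\<lambda>n. h n + f n | h. h \<in> padic_null p}"
    by (auto simp: a_r_coset_def' padic_Cauchy_ring_def)
  have lim: "(\<lambda>n. padic_norm p (h n + f n)) \<longlonglongrightarrow> c" if h: "h \<in> padic_null p" for h
  proof -
    have "(\<lambda>n. padic_norm p (h n + f n) - padic_norm p (f n)) \<longlonglongrightarrow> 0"
    proof (rule tendsto_0_le)
      show "(\<lambda>n. padic_norm p (h n)) \<longlonglongrightarrow> 0" using h by (simp add: padic_null_def)
      have "norm (padic_norm p (h n + f n) - padic_norm p (f n)) \<le> norm (padic_norm p (h n)) * 1" for n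
        using padic_norm_abs_diff[of "h n + f n" "f n"] by simp
      then show "eventually (\<lambda>n. norm (padic_norm p (h n + f n) - padic_norm p (f n)) \<le> norm (padic_norm p (h n)) * 1) sequentially"
        by (intro always_eventually allI)
    qed
    from tendsto_add[OF this c] show ?thesis by simp
  qed
  have "(\<lambda>n. 0) \<in> padic_null p" using padic_norm_0 by (simp add: padic_null_def)
  then have fm: "f \<in> padic_null p +>\<^bsub>padic_Cauchy_ring p\<^esub> f" unfolding eq by (intro CollectI exI[of _ "\<lambda>n. 0"]) simp
  show ?thesis unfolding Qp_norm_def
  proof (rule the_equality)
    show "\<forall>f\<in>padic_null p +>\<^bsub>padic_Cauchy_ring p\<^esub> f. (\<lambda>n. padic_norm p (f n)) \<longlonglongrightarrow> c"
      unfolding eq using lim by auto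
  next
    fix d assume "\<forall>f\<in>padic_null p +>\<^bsub>padic_Cauchy_ring p\<^esub> f. (\<lambda>n. padic_norm p (f n)) \<longlonglongrightarrow> d"
    then have "(\<lambda>n. padic_norm p (f n)) \<longlonglongrightarrow> d" using fm by blast
    then show "d = c" using c LIMSEQ_unique by blast
  qed
qed

lemma Qp_norm_le_1_iff:
  assumes f: "f \<in> C"
  shows "Qp_norm p (padic_null p +>\<^bsub>padic_Cauchy_ring p\<^esub> f) \<le> 1 \<longleftrightarrow>
    eventually (\<lambda>n. padic_norm p (f n) \<le> 1) sequentially"
proof (cases "f \<in> padic_null p")
  case True
  then have "Qp_norm p (padic_null p +>\<^bsub>padic_Cauchy_ring p\<^esub> f) = 0"
    using f by (intro Qp_norm_class) (auto simp: padic_null_def)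
  moreover have "eventually (\<lambda>n. padic_norm p (f n) < 1) sequentially"
    using padic_null_eventually[OF True] by simp
  ultimately show ?thesis by (auto elim: eventually_mono)
next
  case False
  obtain c where c: "c > 0" "eventually (\<lambda>n. padic_norm p (f n) = c) sequentially"
    using padic_nonnull_eventually_const[OF f False] by blast
  have "Qp_norm p (padic_null p +>\<^bsub>padic_Cauchy_ring p\<^esub> f) = c"
    using c by (intro Qp_norm_class f tendsto_eventually)
  moreover have "eventually (\<lambda>n. padic_norm p (f n) \<le> 1) sequentially \<longleftrightarrow> c \<le> 1"
  proof
    assume "eventually (\<lambda>n. padic_norm p (f n) \<le> 1) sequentially"
    then have "eventually (\<lambda>n. c \<le> 1) sequentially" using c(2) by eventually_elim simp
    then show "c \<le> 1" by simp
  next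
    assume "c \<le> 1"
    show "eventually (\<lambda>n. padic_norm p (f n) \<le> 1) sequentially"
      using c(2) by eventually_elim (use \<open>c \<le> 1\<close> in simp)
  qed
  ultimately show ?thesis by simp
qed

lemma image_Zp: "\<sigma> ` Zp p = \<phi> ` padic_integral p"
proof -
  have "Zp p = (\<lambda>f. padic_null p +>\<^bsub>padic_Cauchy_ring p\<^esub> f) ` padic_integral p"
    using Qp_norm_le_1_iff
    by (auto simp: Zp_def Qp_def FactRing_def A_RCOSETS_def' padic_Cauchy_ring_def padic_integral_def)
  then show ?thesis by (simp add: image_image \<phi>_def)
qed

lemma const_C [simp]: "(\<lambda>n. q) \<in> C" using padic_Cauchy_const .

lemma add_C: "f \<in> C \<Longrightarrow> g \<in> C \<Longrightarrow> (\<lambda>n. f n + g n) \<in> C" using padic_Cauchy_add .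

lemma mult_C: "f \<in> C \<Longrightarrow> g \<in> C \<Longrightarrow> (\<lambda>n. f n * g n) \<in> C" using padic_Cauchy_mult .

lemma \<phi>_of_nat: "\<phi> (\<lambda>n. of_nat k) = of_nat k"
  by (induction k) (simp_all add: \<phi>_0 \<phi>_1 \<phi>_add)

lemma \<phi>_const_mult: "\<phi> (\<lambda>n. q * r) = \<phi> (\<lambda>n. q) * \<phi> (\<lambda>n. r)"
  by (simp add: \<phi>_mult)

lemma \<phi>_const_power: "\<phi> (\<lambda>n. q ^ k) = \<phi> (\<lambda>n. q) ^ k"
  by (induction k) (simp_all add: \<phi>_1 \<phi>_const_mult)

lemma const_notin_null: "q \<noteq> 0 \<Longrightarrow> (\<lambda>n. q) \<notin> padic_null p"
  using padic_norm_eq_0_iff[of q] by (auto simp: padic_null_def LIMSEQ_const_iff)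

lemma \<phi>_const_inverse: "\<phi> (\<lambda>n. inverse q) = inverse (\<phi> (\<lambda>n. q))"
proof (cases "q = 0")
  case False
  then show ?thesis using \<phi>_inverse[OF const_C const_notin_null[OF False]] by (metis inverse_unique)
qed (simp add: \<phi>_0)

lemma \<phi>_const_powi: "\<phi> (\<lambda>n. q powi k) = \<phi> (\<lambda>n. q) powi k"
  by (simp add: power_int_def \<phi>_const_power \<phi>_const_inverse)

lemma p_rat_nz [simp]: "(of_nat p :: rat) \<noteq> 0"
  using prime_gt_0_nat[OF prime_p] by simp

lemma p_nz [simp]: "(of_nat p :: 'a) \<noteq> 0"
  using const_notin_null[OF p_rat_nz] \<phi>_eq_0_iff[OF const_C[of "of_nat p"]] \<phi>_of_nat[of p] by metis

lemma norm_p_powi: "padic_norm p (of_nat p powi k) = real p powi (- k)"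
  using padic_norm_p padic_norm_power padic_norm_inverse padic_norm_1
  by (auto simp: power_int_def power_inverse)

text \<open>Turns a bound on norms into divisibility by a power of \<open>p\<close>, with
  \<open>k\<close> of either sign. Unit decompositions, residues and completeness are all obtained
  through it.\<close>

lemma \<phi>_scale:
  assumes f: "f \<in> C" and b: "eventually (\<lambda>n. padic_norm p (f n) \<le> real p powi (- k)) sequentially"
  shows "\<exists>c\<in>padic_integral p. \<phi> f = of_nat p powi k * \<phi> c"
proof
  let ?c = "\<lambda>n. of_nat p powi (- k) * f n"
  have "eventually (\<lambda>n. padic_norm p (?c n) \<le> 1) sequentially"
    using b
  proof eventually_elim
    case (elim n)
    have "padic_norm p (?c n) = real p powi k * padic_norm p (f n)"
      using norm_p_powi[of "- k"] by (simp add: padic_norm_mult)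
    also have "\<dots> \<le> real p powi k * real p powi (- k)" using elim by (intro mult_left_mono) auto
    also have "\<dots> = 1" using prime_gt_0_nat[OF prime_p] by (simp add: power_int_minus)
    finally show ?case .
  qed
  then show "?c \<in> padic_integral p" using f by (auto simp: padic_integral_def intro: mult_C)
  have "\<phi> ?c = of_nat p powi (- k) * \<phi> f" using f by (simp only: \<phi>_mult const_C \<phi>_const_powi \<phi>_of_nat)
  then show "\<phi> f = of_nat p powi k * \<phi> ?c" by (simp add: power_int_minus)
qed

lemma integral_C: "f \<in> padic_integral p \<Longrightarrow> f \<in> C"
  by (simp add: padic_integral_def)

text \<open>From some index on, \<open>f\<close> stays at distance less than \<open>1/p\<close> from
  one rational number \<open>a / b\<close> with \<open>b\<close> prime to \<open>p\<close>;
  \<open>k\<close> solves \<open>b * k = a\<close> modulo \<open>p\<close>.\<close>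

lemma integral_residue:
  assumes f: "f \<in> padic_integral p"
  shows "\<exists>k::nat. eventually (\<lambda>n. padic_norm p (f n - of_nat k) \<le> inverse (real p)) sequentially"
proof -
  have p0: "real p > 0" using prime_gt_0_nat[OF prime_p] by simp
  then obtain N where N: "\<forall>m\<ge>N. \<forall>n\<ge>N. padic_norm p (f m - f n) < inverse (real p)"
    using padic_CauchyD[OF integral_C[OF f], of "inverse (real p)"] by auto
  obtain M where M: "\<And>n. n \<ge> M \<Longrightarrow> padic_norm p (f n) \<le> 1"
    using f by (auto simp: padic_integral_def eventually_sequentially)
  define l where "l = max N M"
  obtain a b where ab: "f l = of_int a / of_int b" "\<not> int p dvd b"
    using M[of l] padic_norm_le_1_iff by (auto simp: l_def)
  have "coprime b (int p)" using ab prime_p prime_imp_coprime[of "int p" b] by (simp add: coprime_commute)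
  then obtain x where x: "[b * x = 1] (mod int p)" using cong_solve_coprime_int by blast
  define k where "k = nat ((a * x) mod int p)"
  have "int k = (a * x) mod int p" using p0 by (simp add: k_def)
  then have "[b * int k = b * (a * x)] (mod int p)" by (simp add: cong_def mod_mult_right_eq)
  also have "b * (a * x) = a * (b * x)" by simp
  also have "[a * (b * x) = a * 1] (mod int p)" using x by (intro cong_mult cong_refl)
  finally have "int p dvd a - b * int k" by (simp add: cong_iff_dvd_diff dvd_diff_commute)
  then obtain c where c: "a - b * int k = int p * c" by blast
  have b0: "b \<noteq> 0" using ab by auto
  have "of_int (a - b * int k) = (of_int (int p * c) :: rat)" using c by simp
  then have "of_int a - of_int b * of_nat k = (of_nat p * of_int c :: rat)" by simp
  moreover have "f l - of_nat k = (of_int a - of_int b * of_nat k) / of_int b"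
    using b0 by (simp add: ab(1) diff_divide_distrib)
  ultimately have "f l - of_nat k = of_nat p * (of_int c / of_int b)" by simp
  then have "padic_norm p (f l - of_nat k) = inverse (real p) * padic_norm p (of_int c / of_int b)"
    by (simp only: padic_norm_mult padic_norm_p)
  also have "\<dots> \<le> inverse (real p) * 1"
    using padic_norm_le_1_iff ab(2) p0 by (intro mult_left_mono) auto
  finally have fl: "padic_norm p (f l - of_nat k) \<le> inverse (real p)" by simp
  have "padic_norm p (f n - of_nat k) \<le> inverse (real p)" if n: "n \<ge> l" for n
  proof -
    have "padic_norm p (f n - f l) < inverse (real p)" using N n by (simp add: l_def)
    then show ?thesis using padic_norm_add[of "f n - f l" "f l - of_nat k"] fl by simp
  qed
  then show ?thesis unfolding eventually_sequentially by blast
qed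

lemma sum_C: "(\<And>k. k \<in> I \<Longrightarrow> f k \<in> C) \<Longrightarrow> (\<lambda>n. \<Sum>k\<in>I. f k n) \<in> C"
  by (induction I rule: infinite_finite_induct) (auto intro: add_C)

lemma \<phi>_sum: "(\<And>k. k \<in> I \<Longrightarrow> f k \<in> C) \<Longrightarrow> \<phi> (\<lambda>n. \<Sum>k\<in>I. f k n) = (\<Sum>k\<in>I. \<phi> (f k))"
  by (induction I rule: infinite_finite_induct) (auto simp: \<phi>_0 \<phi>_add sum_C)

text \<open>A diagonal argument: \<open>F m\<close> represents the \<open>m\<close>-th partial sum,
  and \<open>Q m\<close> is a rational number within \<open>p ^ (- m)\<close> of the late terms of
  \<open>F m\<close>. The sequence \<open>Q\<close> then represents the sum of the series.\<close>

lemma integral_complete: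
  assumes f: "\<And>k. f k \<in> padic_integral p"
  shows "\<exists>s\<in>padic_integral p. \<forall>m. \<exists>c\<in>padic_integral p.
    \<phi> s - (\<Sum>k<m. of_nat p ^ k * \<phi> (f k)) = of_nat p ^ m * \<phi> c"
proof -
  define r where "r m = inverse (real p) ^ m" for m :: nat
  have p1: "real p > 1" using prime_gt_1_nat[OF prime_p] by simp
  have r0: "r m > 0" for m using p1 by (simp add: r_def)
  have r_mono: "r n \<le> r m" if "m \<le> n" for m n
    unfolding r_def using p1 that by (intro power_decreasing) (auto simp: inverse_le_1_iff)
  define F where "F m = (\<lambda>n. \<Sum>k<m. of_nat p ^ k * f k n)" for m
  have FC: "F m \<in> C" for m unfolding F_def by (intro sum_C mult_C const_C integral_C f)
  have "\<exists>N. \<forall>n\<ge>N. padic_norm p (F m n - F m N) < r m" for m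
    using padic_CauchyD[OF FC r0] by blast
  then obtain N where N: "\<And>m n. n \<ge> N m \<Longrightarrow> padic_norm p (F m n - F m (N m)) < r m" by metis
  define Q where "Q m = F m (N m)" for m
  have step: "padic_norm p (Q (Suc m) - Q m) \<le> r m" for m
  proof -
    obtain M where M: "\<And>n. n \<ge> M \<Longrightarrow> padic_norm p (f m n) \<le> 1"
      using f[of m] by (auto simp: padic_integral_def eventually_sequentially)
    define n where "n = max M (max (N m) (N (Suc m)))"
    have "padic_norm p (F (Suc m) n - Q (Suc m)) < r (Suc m)" using N[of "Suc m" n] by (simp add: Q_def n_def)
    then have 1: "padic_norm p (Q (Suc m) - F (Suc m) n) \<le> r m"
      using r_mono[of m "Suc m"] padic_norm_uminus[of "Q (Suc m) - F (Suc m) n"] by simp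
    have "padic_norm p (F (Suc m) n - F m n) = r m * padic_norm p (f m n)"
      by (simp add: F_def padic_norm_mult padic_norm_power padic_norm_p r_def)
    also have "\<dots> \<le> r m * 1" using M[of n] r0[of m] by (intro mult_left_mono) (auto simp: n_def)
    finally have 2: "padic_norm p (F (Suc m) n - F m n) \<le> r m" by simp
    have 3: "padic_norm p (F m n - Q m) \<le> r m" using N[of m n] by (auto simp: Q_def n_def intro: less_imp_le)
    have "padic_norm p ((Q (Suc m) - F (Suc m) n) + (F (Suc m) n - F m n)) \<le> r m"
      using padic_norm_add 1 2 by (meson max.boundedI order_trans)
    then have "padic_norm p ((Q (Suc m) - F (Suc m) n) + (F (Suc m) n - F m n) + (F m n - Q m)) \<le> r m"
      using padic_norm_add 3 by (meson max.boundedI order_trans)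
    then show ?thesis by simp
  qed
  have diffQ: "padic_norm p (Q j - Q m) \<le> r m" if "m \<le> j" for m j
    using that
  proof (induction j rule: dec_induct)
    case base
    then show ?case using r0[of m] padic_norm_0 by simp
  next
    case (step j)
    have "padic_norm p (Q (Suc j) - Q j) \<le> r m" using \<open>\<And>m. padic_norm p (Q (Suc m) - Q m) \<le> r m\<close>[of j] r_mono[of m j] step by simp
    then have "padic_norm p ((Q (Suc j) - Q j) + (Q j - Q m)) \<le> r m"
      using padic_norm_add step.IH by (meson max.boundedI order_trans)
    then show ?case by simp
  qed
  have QC: "Q \<in> C"
    unfolding padic_Cauchy_def
  proof (intro CollectI allI impI)
    fix e :: real assume "e > 0"
    have "r \<longlonglongrightarrow> 0" unfolding r_def[abs_def] using p1 by (intro LIMSEQ_realpow_zero) (auto simp: inverse_less_1_iff)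
    then have "eventually (\<lambda>m. r m < e) sequentially" using \<open>e > 0\<close> by (rule order_tendstoD)
    then obtain M where M: "r M < e" by (auto simp: eventually_sequentially)
    have "padic_norm p (Q m - Q n) < e" if "m \<ge> M" "n \<ge> M" for m n
      using padic_norm_diff[of "Q m - Q M" "Q n - Q M"] diffQ[OF that(1)] diffQ[OF that(2)] M by simp
    then show "\<exists>N. \<forall>m\<ge>N. \<forall>n\<ge>N. padic_norm p (Q m - Q n) < e" by blast
  qed
  have "Q 0 = 0" by (simp add: Q_def F_def)
  then have "padic_norm p (Q j) \<le> 1" for j using diffQ[of 0 j] by (simp add: r_def)
  then have QI: "Q \<in> padic_integral p" using QC by (simp add: padic_integral_def)
  moreover have "\<exists>c\<in>padic_integral p. \<phi> Q - (\<Sum>k<m. of_nat p ^ k * \<phi> (f k)) = of_nat p ^ m * \<phi> c" for m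
  proof -
    have "padic_norm p (Q j - F m j) \<le> r m" if "j \<ge> max m (N m)" for j
    proof -
      have "padic_norm p (Q j - Q m) \<le> r m" using diffQ that by simp
      moreover have "padic_norm p (F m j - Q m) \<le> r m" using N[of m j] that by (simp add: Q_def)
      ultimately show ?thesis using padic_norm_diff[of "Q j - Q m" "F m j - Q m"] by simp
    qed
    then have "eventually (\<lambda>j. padic_norm p (Q j - F m j) \<le> r m) sequentially"
      unfolding eventually_sequentially by blast
    moreover have "r m = real p powi (- int m)" by (simp add: r_def power_int_minus power_inverse)
    ultimately obtain c where "c \<in> padic_integral p" "\<phi> (\<lambda>n. Q n - F m n) = of_nat p powi int m * \<phi> c"
      using \<phi>_scale[OF Cauchy_diff[OF QC FC]] by metis
    moreover have "\<phi> (F m) = (\<Sum>k<m. of_nat p ^ k * \<phi> (f k))"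
      unfolding F_def using integral_C[OF f]
      by (subst \<phi>_sum) (auto simp: mult_C \<phi>_mult \<phi>_const_power \<phi>_of_nat)
    ultimately show ?thesis by (auto simp: \<phi>_diff[OF QC FC])
  qed
  ultimately show ?thesis by blast
qed

lemma integral_const_of_int: "(\<lambda>n. of_int k) \<in> padic_integral p"
  using padic_norm_le_1_of_int by (simp add: padic_integral_def)

theorem padic_field: "padic_field p (\<sigma> ` Zp p) (\<sigma> ` carrier (Qp p))"
  unfolding image_Zp image_carrier
proof unfold_locales
  show "1 \<in> \<phi> ` C" using \<phi>_1 by (intro image_eqI[of _ _ "\<lambda>n. 1"]) auto
  show "1 \<in> \<phi> ` padic_integral p" using \<phi>_1 integral_const_of_int[of 1] by (intro image_eqI[of _ _ "\<lambda>n. 1"]) auto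
next
  fix x y assume "x \<in> \<phi> ` C" "y \<in> \<phi> ` C"
  then obtain f g where fg: "f \<in> C" "g \<in> C" "x = \<phi> f" "y = \<phi> g" by auto
  then show "x + y \<in> \<phi> ` C" "x * y \<in> \<phi> ` C"
    using image_eqI[of "x + y" \<phi> "\<lambda>n. f n + g n" C] image_eqI[of "x * y" \<phi> "\<lambda>n. f n * g n" C]
    by (simp_all add: \<phi>_add \<phi>_mult add_C mult_C)
next
  fix x assume "x \<in> \<phi> ` C"
  then obtain f where f: "f \<in> C" "x = \<phi> f" by auto
  then show "- x \<in> \<phi> ` C"
    using image_eqI[of "- x" \<phi> "\<lambda>n. - f n" C] by (simp add: \<phi>_uminus padic_Cauchy_uminus prime_p)
  show "inverse x \<in> \<phi> ` C"
  proof (cases "f \<in> padic_null p")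
    case True
    then show ?thesis using f \<phi>_null \<phi>_0 by (intro image_eqI[of _ _ "\<lambda>n. 0"]) auto
  next
    case False
    then show ?thesis using f \<phi>_inverse[OF f(1) False] padic_inverse(1)[OF f(1) False]
      by (intro image_eqI[of _ _ "\<lambda>n. inverse (f n)"]) (auto intro: inverse_unique)
  qed
next
  fix x y assume "x \<in> \<phi> ` padic_integral p" "y \<in> \<phi> ` padic_integral p"
  then obtain f g where fg: "f \<in> padic_integral p" "g \<in> padic_integral p" "x = \<phi> f" "y = \<phi> g" by auto
  have C: "f \<in> C" "g \<in> C" using fg by (auto simp: integral_C)
  have e: "eventually (\<lambda>n. padic_norm p (f n) \<le> 1) sequentially" "eventually (\<lambda>n. padic_norm p (g n) \<le> 1) sequentially"
    using fg by (auto simp: padic_integral_def)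
  have "eventually (\<lambda>n. padic_norm p (f n + g n) \<le> 1) sequentially"
    using e by eventually_elim (use padic_norm_add_le_1 in auto)
  then show "x + y \<in> \<phi> ` padic_integral p" using C fg \<phi>_add add_C
    by (intro image_eqI[of _ _ "\<lambda>n. f n + g n"]) (auto simp: padic_integral_def)
  have "eventually (\<lambda>n. padic_norm p (f n * g n) \<le> 1) sequentially"
    using e by eventually_elim (auto simp: padic_norm_mult padic_norm_nonneg mult_le_one)
  then show "x * y \<in> \<phi> ` padic_integral p" using C fg \<phi>_mult mult_C
    by (intro image_eqI[of _ _ "\<lambda>n. f n * g n"]) (auto simp: padic_integral_def)
next
  fix x assume "x \<in> \<phi> ` padic_integral p"
  then obtain f where f: "f \<in> padic_integral p" "x = \<phi> f" by auto
  then show "- x \<in> \<phi> ` padic_integral p" using \<phi>_uminus[of f] padic_Cauchy_uminus[of f]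
    by (intro image_eqI[of _ _ "\<lambda>n. - f n"]) (auto simp: padic_integral_def padic_norm_uminus)
next
  show "prime p" by (rule prime_p)
  show "\<phi> ` padic_integral p \<subseteq> \<phi> ` C" using integral_C by blast
next
  show "inverse (of_nat p) \<notin> \<phi> ` padic_integral p"
  proof
    assume "inverse (of_nat p) \<in> \<phi> ` padic_integral p"
    then obtain f where f: "f \<in> padic_integral p" "\<phi> f = inverse (of_nat p)" by auto
    have C: "f \<in> C" using f by (simp add: integral_C)
    have "\<phi> (\<lambda>n. of_nat p * f n - 1) = 0" using C f by (simp add: \<phi>_diff \<phi>_mult mult_C \<phi>_of_nat \<phi>_1)
    moreover have "(\<lambda>n. of_nat p * f n - 1) \<in> C" using C by (intro Cauchy_diff mult_C const_C)
    ultimately have "(\<lambda>n. of_nat p * f n - 1) \<in> padic_null p" using \<phi>_eq_0_iff by simp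
    then have "eventually (\<lambda>n. padic_norm p (of_nat p * f n - 1) < 1) sequentially"
      using padic_null_eventually by simp
    moreover have "eventually (\<lambda>n. padic_norm p (f n) \<le> 1) sequentially" using f by (simp add: padic_integral_def)
    ultimately have "eventually (\<lambda>n. False) sequentially"
    proof eventually_elim
      case (elim n)
      have "padic_norm p (of_nat p * f n) \<le> inverse (real p) * 1"
        unfolding padic_norm_mult padic_norm_p using elim by (intro mult_left_mono) auto
      also have "\<dots> < 1" using prime_gt_1_nat[OF prime_p] by (simp add: inverse_less_1_iff)
      finally have "padic_norm p (of_nat p * f n - (of_nat p * f n - 1)) < 1"
        using padic_norm_diff[of "of_nat p * f n" "of_nat p * f n - 1"] elim by linarith
      then show False using padic_norm_1 by simp
    qed
    then show False by simp
  qed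
next
  fix x assume "x \<in> \<phi> ` C" "x \<noteq> 0"
  then obtain f where f: "f \<in> C" "x = \<phi> f" "f \<notin> padic_null p" using \<phi>_null by auto
  obtain c where c: "c > 0" "eventually (\<lambda>n. padic_norm p (f n) = c) sequentially"
    using padic_nonnull_eventually_const[OF f(1,3)] by blast
  then obtain n where n: "padic_norm p (f n) = c" by (auto simp: eventually_sequentially)
  then have "f n \<noteq> 0" using c padic_norm_0 by auto
  then have ck: "c = real p powi (- pval p (f n))" using n padic_norm_pval by metis
  \<comment> \<open>The norm is eventually constant, so its exponent can be read off from a single
    term. Scaling \<open>f\<close> with \<open>k\<close> and the inverse sequence with
    \<open>- k\<close> gives \<open>u\<close> and its inverse, both integral.\<close>
  define k where "k = pval p (f n)"
  have "eventually (\<lambda>n. padic_norm p (f n) \<le> real p powi (- k)) sequentially"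
    using c(2) by eventually_elim (simp add: ck k_def)
  then obtain u where u: "u \<in> padic_integral p" "\<phi> f = of_nat p powi k * \<phi> u" using \<phi>_scale[OF f(1)] by blast
  have "eventually (\<lambda>n. padic_norm p (inverse (f n)) \<le> real p powi (- (- k))) sequentially"
    using c(2) by eventually_elim (simp add: ck k_def padic_norm_inverse power_int_minus)
  then obtain w where w: "w \<in> padic_integral p" "\<phi> (\<lambda>n. inverse (f n)) = of_nat p powi (- k) * \<phi> w"
    using \<phi>_scale[OF padic_inverse(1)[OF f(1,3)]] by blast
  have "1 = \<phi> f * \<phi> (\<lambda>n. inverse (f n))" using \<phi>_inverse f by simp
  also have "\<dots> = \<phi> u * \<phi> w" unfolding u(2) w(2) by (simp add: power_int_minus)
  finally have "inverse (\<phi> u) = \<phi> w" by (intro inverse_unique) simp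
  then show "\<exists>k u. u \<in> \<phi> ` padic_integral p \<and> inverse u \<in> \<phi> ` padic_integral p \<and> x = of_nat p powi k * u"
    using u w f by (intro exI[of _ k] exI[of _ "\<phi> u"]) auto
next
  fix a assume "a \<in> \<phi> ` padic_integral p"
  then obtain f where f: "f \<in> padic_integral p" "a = \<phi> f" by auto
  obtain k :: nat where "eventually (\<lambda>n. padic_norm p (f n - of_nat k) \<le> inverse (real p)) sequentially"
    using integral_residue[OF f(1)] by blast
  then have "eventually (\<lambda>n. padic_norm p (f n - of_nat k) \<le> real p powi (- 1)) sequentially"
    by (simp add: power_int_minus)
  then obtain c where "c \<in> padic_integral p" "\<phi> (\<lambda>n. f n - of_nat k) = of_nat p powi 1 * \<phi> c"
    using \<phi>_scale[OF Cauchy_diff[OF integral_C[OF f(1)] const_C]] by blast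
  then have "a = of_nat k + of_nat p * \<phi> c" "\<phi> c \<in> \<phi> ` padic_integral p"
    using integral_C[OF f(1)] by (auto simp: \<phi>_diff \<phi>_of_nat f(2) algebra_simps)
  then show "\<exists>n. \<exists>c\<in>\<phi> ` padic_integral p. a = of_nat n + of_nat p * c" by blast
next
  fix b :: "nat \<Rightarrow> 'a" assume "\<And>k. b k \<in> \<phi> ` padic_integral p"
  then have "\<forall>k. \<exists>f. f \<in> padic_integral p \<and> b k = \<phi> f" by blast
  then obtain f :: "nat \<Rightarrow> nat \<Rightarrow> rat" where f: "\<And>k. f k \<in> padic_integral p" "\<And>k. b k = \<phi> (f k)" by metis
  show "\<exists>s\<in>\<phi> ` padic_integral p. \<forall>m. \<exists>c\<in>\<phi> ` padic_integral p.
      s - (\<Sum>k<m. of_nat p ^ k * b k) = of_nat p ^ m * c"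
    using integral_complete[of f, OF f(1)] unfolding f(2) by blast
qed

end

section \<open>Roots of unity and Kummer extensions\<close>

lemma primitive_root_inj:
  assumes z: "primitive_root_of_unity n (z::'a::field)" and "i < n" "j < n" "z ^ i = z ^ j"
  shows "i = j"
proof -
  have z0: "z \<noteq> 0"
  proof
    assume "z = 0"
    then show False using z assms(2) by (simp add: primitive_root_of_unity_def power_0_left)
  qed
  have False if "i < j" "j < n" "z ^ i = z ^ j" for i j
  proof -
    have "z ^ i * z ^ (j - i) = z ^ i * 1" using that power_add[of z i "j - i"] by simp
    then have "z ^ (j - i) = 1" using z0 by simp
    then show False using z that by (auto simp: primitive_root_of_unity_def)
  qed
  then show ?thesis using assms by (metis linorder_neqE_nat)
qed

lemma primitive_root_nonzero: "primitive_root_of_unity n (z::'a::field) \<Longrightarrow> n > 0 \<Longrightarrow> z \<noteq> 0"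
  by (auto simp: primitive_root_of_unity_def power_0_left)

text \<open>The powers of \<open>z\<close> are already \<open>n\<close> roots of
  \<open>X ^ n - 1\<close>, which has no more.\<close>

lemma root_of_unity_eq_power:
  assumes z: "primitive_root_of_unity n (z::'a::field)" and n: "n > 0" and x: "x ^ n = 1"
  obtains i where "i < n" "x = z ^ i"
proof -
  define q :: "'a poly" where "q = monom 1 n - 1"
  have deg: "degree q = n"
    unfolding q_def using n by (subst diff_conv_add_uminus, subst degree_add_eq_left) (auto simp: degree_monom_eq)
  then have q0: "q \<noteq> 0" using n by auto
  have roots: "{x. poly q x = 0} = {x. x ^ n = 1}" by (auto simp: q_def poly_monom)
  have sub: "(\<lambda>i. z ^ i) ` {..<n} \<subseteq> {x. poly q x = 0}"
    unfolding roots using z by (auto simp: primitive_root_of_unity_def power_commuting_commutes mult.commute[of _ n] power_mult simp flip: power_mult[of z _ n])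
  have "card ((\<lambda>i. z ^ i) ` {..<n}) = n"
    using primitive_root_inj[OF z] by (subst card_image) (auto intro!: inj_onI)
  moreover have "card {x. poly q x = 0} \<le> n" using card_poly_roots_bound[OF q0] deg by simp
  ultimately have "(\<lambda>i. z ^ i) ` {..<n} = {x. poly q x = 0}"
    using sub poly_roots_finite[OF q0] by (intro card_seteq) auto
  then show ?thesis using x roots that by blast
qed

lemma primitive_root_power:
  assumes z: "primitive_root_of_unity n (z::'a::field)" and "n = d * k" "n > 0"
  shows "primitive_root_of_unity k (z ^ d)"
proof -
  have "(z ^ d) ^ j \<noteq> 1" if "0 < j" "j < k" for j
  proof -
    have "0 < d * j" "d * j < n" using that assms by auto
    then show ?thesis using z by (simp add: primitive_root_of_unity_def flip: power_mult)
  qed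
  then show ?thesis using z assms(2) by (auto simp: primitive_root_of_unity_def simp flip: power_mult)
qed

lemma exists_order:
  assumes "(x::'a::field) ^ M = 1" "M > 0"
  obtains m where "m > 0" "primitive_root_of_unity m x"
proof -
  define m where "m = (LEAST m. m > 0 \<and> x ^ m = 1)"
  have "m > 0 \<and> x ^ m = 1" unfolding m_def by (rule LeastI) (use assms in auto)
  moreover have "\<not> (k > 0 \<and> x ^ k = 1)" if "k < m" for k
    using not_less_Least[of k "\<lambda>m. m > 0 \<and> x ^ m = 1"] that by (auto simp: m_def)
  ultimately show ?thesis using that[of m] by (auto simp: primitive_root_of_unity_def)
qed

text \<open>Homomorphisms are total functions with conditions on \<open>F\<close> alone and without
  a target, so they compose inside the ambient field; that a map stays within an extension is shown
  separately on generators.\<close>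

definition field_hom_on :: "'a::field set \<Rightarrow> ('a \<Rightarrow> 'a) \<Rightarrow> bool" where
  "field_hom_on F h \<longleftrightarrow> h 1 = 1 \<and>
     (\<forall>x\<in>F. \<forall>y\<in>F. h (x + y) = h x + h y) \<and> (\<forall>x\<in>F. \<forall>y\<in>F. h (x * y) = h x * h y)"

context closed_subring
begin

context
  fixes h assumes h: "field_hom_on S h"
begin

lemma hom_1: "h 1 = 1" using h by (simp add: field_hom_on_def)

lemma hom_add: "x \<in> S \<Longrightarrow> y \<in> S \<Longrightarrow> h (x + y) = h x + h y"
  using h by (simp add: field_hom_on_def)

lemma hom_mult: "x \<in> S \<Longrightarrow> y \<in> S \<Longrightarrow> h (x * y) = h x * h y"
  using h by (simp add: field_hom_on_def)

lemma hom_0 [simp]: "h 0 = 0"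
proof -
  have "h 0 + h 0 = h 0 + 0" using hom_add[OF zero_mem zero_mem] by simp
  then show ?thesis by (rule add_left_imp_eq)
qed

lemma hom_power: "x \<in> S \<Longrightarrow> h (x ^ k) = h x ^ k"
  by (induction k) (auto simp: hom_1 hom_mult power_mem)

lemma hom_uminus: "x \<in> S \<Longrightarrow> h (- x) = - h x"
  using hom_add[of x "- x"] uminus_mem by (simp add: eq_neg_iff_add_eq_0 add.commute)

lemma hom_sum: "(\<And>i. i \<in> I \<Longrightarrow> f i \<in> S) \<Longrightarrow> h (\<Sum>i\<in>I. f i) = (\<Sum>i\<in>I. h (f i))"
  by (induction I rule: infinite_finite_induct) (auto simp: hom_add sum_mem)

lemma map_poly_hom_add:
  "coeffs_in S f \<Longrightarrow> coeffs_in S g \<Longrightarrow> map_poly h (f + g) = map_poly h f + map_poly h g"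
  by (intro poly_eqI) (auto simp: coeff_map_poly coeffs_in_def hom_add)

lemma map_poly_hom_uminus: "coeffs_in S f \<Longrightarrow> map_poly h (- f) = - map_poly h f"
  by (intro poly_eqI) (auto simp: coeff_map_poly coeffs_in_def hom_uminus)

lemma map_poly_hom_mult:
  "coeffs_in S f \<Longrightarrow> coeffs_in S g \<Longrightarrow> map_poly h (f * g) = map_poly h f * map_poly h g"
  by (intro poly_eqI) (auto simp: coeff_map_poly coeffs_in_def coeff_mult hom_sum hom_mult mult_mem)

lemma hom_poly:
  assumes "coeffs_in S f" "x \<in> S" shows "h (poly f x) = poly (map_poly h f) (h x)"
proof -
  have "h (poly f x) = (\<Sum>i\<le>degree f. h (coeff f i) * h x ^ i)"
    using assms unfolding poly_altdef
    by (subst hom_sum) (auto simp: coeffs_in_def hom_mult hom_power power_mem intro!: mult_mem)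
  also have "\<dots> = (\<Sum>i\<le>degree f. coeff (map_poly h f) i * h x ^ i)" by (simp add: coeff_map_poly)
  also have "\<dots> = (\<Sum>i\<le>degree (map_poly h f). coeff (map_poly h f) i * h x ^ i)"
    by (intro sum.mono_neutral_right) (auto simp: map_poly_degree_leq coeff_eq_0)
  finally show ?thesis by (simp add: poly_altdef)
qed

end

text \<open>Division by a monic polynomial takes no inverses, so quotient and remainder keep their
  coefficients in the subring.\<close>

lemma coeffs_in_div_monic:
  assumes \<mu>: "coeffs_in S \<mu>" "lead_coeff \<mu> = 1" "degree \<mu> > 0" and f: "coeffs_in S f"
  shows "\<exists>q r. coeffs_in S q \<and> coeffs_in S r \<and> f = q * \<mu> + r \<and> degree r < degree \<mu>"
  using f
proof (induction "degree f" arbitrary: f rule: less_induct)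
  case less
  show ?case
  proof (cases "degree f < degree \<mu>")
    case True
    then show ?thesis using less.prems by (intro exI[of _ 0] exI[of _ f]) auto
  next
    case False
    define m where "m = monom (lead_coeff f) (degree f - degree \<mu>)"
    have m: "coeffs_in S m" unfolding m_def using less.prems by (intro coeffs_in_monom) (simp add: coeffs_in_def)
    define f' where "f' = f - m * \<mu>"
    have f': "coeffs_in S f'" unfolding f'_def by (intro coeffs_in_diff coeffs_in_mult m less.prems \<mu>)
    have "coeff f' i = 0" if "i \<ge> degree f" for i
    proof (cases "i = degree f")
      case True
      then show ?thesis using False \<mu> by (simp add: f'_def m_def coeff_monom_mult)
    next
      case i: False
      have "degree (m * \<mu>) \<le> degree f"
        using degree_mult_le[of m \<mu>] degree_monom_le[of "lead_coeff f" "degree f - degree \<mu>"] False by (simp add: m_def)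
      then show ?thesis using i that by (simp add: f'_def coeff_eq_0)
    qed
    then have "f' = 0 \<or> degree f' < degree f" by (metis leading_coeff_0_iff not_le)
    then have "degree f' < degree f" using False \<mu>(3) by auto
    then obtain q r where "coeffs_in S q" "coeffs_in S r" "f' = q * \<mu> + r" "degree r < degree \<mu>"
      using less.hyps f' by blast
    then show ?thesis using m
      by (intro exI[of _ "q + m"] exI[of _ r]) (auto simp: f'_def algebra_simps intro: coeffs_in_add)
  qed
qed

lemma adjoin_hom_mem:
  assumes h: "field_hom_on (adjoin S x) h" and T: "closed_subring T"
    and "\<And>a. a \<in> S \<Longrightarrow> h a \<in> T" "h x \<in> T" and y: "y \<in> adjoin S x"
  shows "h y \<in> T"
proof -
  interpret X: closed_subring "adjoin S x" by (rule adjoin_closed_subring)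
  obtain f where f: "coeffs_in S f" "y = poly f x" using y by (auto simp: adjoin_def)
  have "coeffs_in (adjoin S x) f" using f adjoin_superset by (auto simp: coeffs_in_def)
  then have "h y = poly (map_poly h f) (h x)" unfolding f(2) using X.hom_poly[OF h] adjoin_mem by blast
  moreover have "coeffs_in T (map_poly h f)" using f assms(3) X.hom_0[OF h]
    by (auto simp: coeffs_in_def coeff_map_poly)
  ultimately show ?thesis using closed_subring.poly_mem[OF T] assms(4) by simp
qed

lemma adjoin_hom_eq:
  assumes g: "field_hom_on (adjoin S x) g" and h: "field_hom_on (adjoin S x) h"
    and "\<And>a. a \<in> S \<Longrightarrow> g a = h a" "g x = h x" and y: "y \<in> adjoin S x"
  shows "g y = h y"
proof -
  interpret X: closed_subring "adjoin S x" by (rule adjoin_closed_subring)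
  obtain f where f: "coeffs_in S f" "y = poly f x" using y by (auto simp: adjoin_def)
  have c: "coeffs_in (adjoin S x) f" using f adjoin_superset by (auto simp: coeffs_in_def)
  have "map_poly g f = map_poly h f"
    using f assms(3) X.hom_0[OF h] X.hom_0[OF g] by (intro poly_eqI) (auto simp: coeffs_in_def coeff_map_poly)
  then show ?thesis unfolding f(2) using X.hom_poly[OF h c] X.hom_poly[OF g c] adjoin_mem assms(4) by simp
qed

text \<open>The image of \<open>poly f \<alpha>\<close> is found by applying \<open>h\<close> to the
  coefficients and evaluating at \<open>\<alpha>'\<close>; the hypothesis makes this independent of
  the choice of \<open>f\<close>.\<close>

lemma extend_hom:
  assumes h: "field_hom_on S h"
    and \<alpha>: "\<And>f. coeffs_in S f \<Longrightarrow> poly f \<alpha> = 0 \<Longrightarrow> poly (map_poly h f) \<alpha>' = 0"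
  obtains h' where "field_hom_on (adjoin S \<alpha>) h'" "\<And>a. a \<in> S \<Longrightarrow> h' a = h a" "h' \<alpha> = \<alpha>'"
proof -
  define rep where "rep x = (SOME f. coeffs_in S f \<and> poly f \<alpha> = x)" for x
  have rep: "coeffs_in S (rep x)" "poly (rep x) \<alpha> = x" if "x \<in> adjoin S \<alpha>" for x
    using someI_ex[of "\<lambda>f. coeffs_in S f \<and> poly f \<alpha> = x"] that by (auto simp: rep_def adjoin_def)
  define h' where "h' x = poly (map_poly h (rep x)) \<alpha>'" for x
  have h': "h' (poly f \<alpha>) = poly (map_poly h f) \<alpha>'" if f: "coeffs_in S f" for f
  proof -
    have x: "poly f \<alpha> \<in> adjoin S \<alpha>" using f by (auto simp: adjoin_def)
    have "poly (map_poly h (rep (poly f \<alpha>) + - f)) \<alpha>' = 0"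
      using rep[OF x] f by (intro \<alpha> coeffs_in_add coeffs_in_uminus) auto
    then show ?thesis using rep[OF x] f h
      by (simp add: h'_def map_poly_hom_add map_poly_hom_uminus coeffs_in_uminus add_eq_0_iff2 del: add_uminus_conv_diff)
  qed
  have "field_hom_on (adjoin S \<alpha>) h'"
    unfolding field_hom_on_def
  proof (intro conjI ballI)
    show "h' 1 = 1" using h'[of 1] hom_1[OF h] by (simp add: map_poly_1')
  next
    fix x y assume "x \<in> adjoin S \<alpha>" "y \<in> adjoin S \<alpha>"
    then obtain f g where fg: "coeffs_in S f" "coeffs_in S g" "x = poly f \<alpha>" "y = poly g \<alpha>" by (auto simp: adjoin_def)
    show "h' (x + y) = h' x + h' y"
      using h'[OF coeffs_in_add[OF fg(1,2)]] h'[OF fg(1)] h'[OF fg(2)] fg by (simp add: map_poly_hom_add[OF h])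
    show "h' (x * y) = h' x * h' y"
      using h'[OF coeffs_in_mult[OF fg(1,2)]] h'[OF fg(1)] h'[OF fg(2)] fg by (simp add: map_poly_hom_mult[OF h])
  qed
  moreover have "h' a = h a" if "a \<in> S" for a
    using h'[of "[:a:]"] that hom_0[OF h] by (simp add: Polynomial.map_poly_pCons)
  moreover have "h' \<alpha> = \<alpha>'"
    using h'[of "[:0, 1:]"] zero_mem one_mem hom_0[OF h] hom_1[OF h] by (simp add: Polynomial.map_poly_pCons)
  ultimately show ?thesis using that by blast
qed

text \<open>The hypothesis of \<open>extend_hom\<close> only has to be checked on the minimal polynomial.\<close>

lemma conjugate_root:
  assumes h: "field_hom_on S h"
    and \<mu>: "coeffs_in S \<mu>" "lead_coeff \<mu> = 1" "degree \<mu> > 0" "poly \<mu> \<alpha> = 0"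
    and minimal: "\<And>f. coeffs_in S f \<Longrightarrow> f \<noteq> 0 \<Longrightarrow> degree f < degree \<mu> \<Longrightarrow> poly f \<alpha> \<noteq> 0"
    and root: "poly (map_poly h \<mu>) \<alpha>' = 0"
    and f: "coeffs_in S f" "poly f \<alpha> = 0"
  shows "poly (map_poly h f) \<alpha>' = 0"
proof -
  obtain q r where qr: "coeffs_in S q" "coeffs_in S r" "f = q * \<mu> + r" "degree r < degree \<mu>"
    using coeffs_in_div_monic[OF \<mu>(1-3) f(1)] by blast
  have "poly r \<alpha> = 0" using f(2) \<mu>(4) qr(3) by simp
  then have "r = 0" using minimal qr by blast
  then show ?thesis using qr(1,3) \<mu>(1) root by (simp add: map_poly_hom_mult[OF h])
qed

end

context closed_subfield
begin

lemma hom_inj: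
  assumes h: "field_hom_on S h" and "x \<in> S" "y \<in> S" "h x = h y"
  shows "x = y"
proof (rule ccontr)
  assume "x \<noteq> y"
  then have "(x - y) * inverse (x - y) = 1" by simp
  then have "h (x - y) * h (inverse (x - y)) = 1"
    using hom_mult[OF h, of "x - y" "inverse (x - y)"] hom_1[OF h] assms by (simp add: diff_mem inverse_mem)
  moreover have "h (x - y) = 0"
    using hom_add[OF h, of x "- y"] hom_uminus[OF h, of y] assms by (simp add: uminus_mem)
  ultimately show False by simp
qed

end

text \<open>The linear factors are treated one at a time: each divides \<open>\<mu>\<close> or the
  cofactor. Subsets of the index set record the choice, so repeated values of \<open>c\<close> cause
  no trouble.\<close>

lemma monic_dvd_prod_linear:
  fixes c :: "'i \<Rightarrow> 'a::field"
  assumes "finite I" "\<mu> dvd (\<Prod>i\<in>I. [:- c i, 1:])" "lead_coeff \<mu> = 1"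
  shows "\<exists>J\<subseteq>I. \<mu> = (\<Prod>i\<in>J. [:- c i, 1:])"
  using assms
proof (induction I arbitrary: \<mu> rule: finite_induct)
  case empty
  then have "is_unit \<mu>" by simp
  then obtain a where "\<mu> = [:a:]" unfolding is_unit_poly_iff by blast
  with empty show ?case by auto
next
  case (insert x I)
  define l where "l = [:- c x, 1:]"
  define R where "R = (\<Prod>i\<in>I. [:- c i, 1:])"
  have l: "poly f (c x) = 0 \<longleftrightarrow> l dvd f" for f by (simp add: l_def poly_eq_0_iff_dvd)
  have l0: "l \<noteq> 0" and ll: "lead_coeff l = 1" by (simp_all add: l_def)
  have ins: "(\<Prod>i\<in>insert x J. [:- c i, 1:]) = l * (\<Prod>i\<in>J. [:- c i, 1:])" if "J \<subseteq> I" for J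
    unfolding l_def using insert.hyps that by (intro prod.insert) (auto intro: finite_subset)
  have dv: "\<mu> dvd l * R" using insert.prems(1) ins[of I] by (simp add: R_def)
  show ?case
  proof (cases "poly \<mu> (c x) = 0")
    case True
    then have "l dvd \<mu>" by (simp add: l)
    then obtain \<nu> where \<nu>: "\<mu> = l * \<nu>" unfolding dvd_def by blast
    have "\<nu> dvd R" using dv l0 by (simp add: \<nu>)
    moreover have "lead_coeff \<nu> = 1" using insert.prems(2) ll unfolding \<nu> lead_coeff_mult by simp
    ultimately obtain J where J: "J \<subseteq> I" "\<nu> = (\<Prod>i\<in>J. [:- c i, 1:])"
      using insert.IH unfolding R_def by blast
    then show ?thesis using ins[OF J(1)] \<nu> by (intro exI[of _ "insert x J"]) auto
  next
    case False
    obtain \<nu> where \<nu>: "l * R = \<mu> * \<nu>" using dv unfolding dvd_def by blast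
    have "poly (l * R) (c x) = 0" by (simp add: l_def)
    then have "l dvd \<nu>" using False by (simp add: \<nu> flip: l)
    then obtain \<rho> where "\<nu> = l * \<rho>" unfolding dvd_def by blast
    then have "l * R = l * (\<mu> * \<rho>)" using \<nu> by (simp add: mult_ac)
    then have "R = \<mu> * \<rho>" using l0 by simp
    then obtain J where "J \<subseteq> I" "\<mu> = (\<Prod>i\<in>J. [:- c i, 1:])"
      using insert.IH[of \<mu>] insert.prems(2) unfolding R_def by auto
    then show ?thesis by blast
  qed
qed

lemma degree_monom_minus_const: "n > 0 \<Longrightarrow> degree (monom 1 n - [:c:] :: 'a::field poly) = n"
  by (subst diff_conv_add_uminus, subst degree_add_eq_left) (auto simp: degree_monom_eq)

lemma lead_coeff_monom_minus_const: "n > 0 \<Longrightarrow> lead_coeff (monom 1 n - [:c:] :: 'a::field poly) = 1"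
  by (simp add: degree_monom_minus_const coeff_pCons split: nat.splits)

lemma degree_prod_linear:
  fixes c :: "'i \<Rightarrow> 'a::field"
  shows "degree (\<Prod>i\<in>I. [:- c i, 1:]) = card I" "lead_coeff (\<Prod>i\<in>I. [:- c i, 1:]) = 1"
proof -
  show "lead_coeff (\<Prod>i\<in>I. [:- c i, 1:]) = 1" unfolding lead_coeff_prod by simp
  show "degree (\<Prod>i\<in>I. [:- c i, 1:]) = card I" by (subst degree_prod_eq_sum_degree) auto
qed

text \<open>Both sides are monic of degree \<open>n\<close>, so a nonzero difference would have
  degree below \<open>n\<close> and yet the \<open>n\<close> distinct roots
  \<open>z ^ i * \<beta>\<close>.\<close>

lemma monom_minus_power_eq_prod:
  assumes z: "primitive_root_of_unity n (z::'a::field)" and n: "n > 0" and \<beta>: "\<beta> \<noteq> 0"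
  shows "monom 1 n - [:\<beta> ^ n:] = (\<Prod>i<n. [:- (z ^ i * \<beta>), 1:])"
proof (rule ccontr)
  define A where "A = monom 1 n - [:\<beta> ^ n:]"
  define B where "B = (\<Prod>i<n. [:- (z ^ i * \<beta>), 1:])"
  assume "monom 1 n - [:\<beta> ^ n:] \<noteq> (\<Prod>i<n. [:- (z ^ i * \<beta>), 1:])"
  then have ne: "A \<noteq> B" by (simp add: A_def B_def)
  have dA: "degree A = n" "lead_coeff A = 1"
    using n degree_monom_minus_const lead_coeff_monom_minus_const unfolding A_def by blast+
  have dB: "degree B = n" "lead_coeff B = 1"
    using degree_prod_linear[of "\<lambda>i. z ^ i * \<beta>" "{..<n}"] unfolding B_def by simp_all
  have "degree (A - B) \<noteq> n"
  proof
    assume "degree (A - B) = n"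
    moreover have "coeff (A - B) n = 0" using dA dB by simp
    ultimately have "lead_coeff (A - B) = 0" by simp
    then show False using ne by (simp del: coeff_diff)
  qed
  moreover have "degree (A - B) \<le> n" using dA dB by (intro degree_diff_le) auto
  ultimately have "degree (A - B) < n" by simp
  moreover have "card ((\<lambda>i. z ^ i * \<beta>) ` {..<n}) \<le> degree (A - B)"
  proof (rule order_trans[OF card_mono])
    show "finite {x. poly (A - B) x = 0}" using ne by (intro poly_roots_finite) simp
    show "card {x. poly (A - B) x = 0} \<le> degree (A - B)" using ne by (intro card_poly_roots_bound) simp
    have zn: "z ^ n = 1" using z by (simp add: primitive_root_of_unity_def)
    have "(z ^ i * \<beta>) ^ n = \<beta> ^ n" for i
      using zn by (simp add: power_mult_distrib mult.commute[of i n] power_mult flip: power_mult[of z i n])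
    moreover have "poly B (z ^ i * \<beta>) = 0" if "i < n" for i
      unfolding B_def poly_prod using that by (intro prod_zero) auto
    ultimately show "(\<lambda>i. z ^ i * \<beta>) ` {..<n} \<subseteq> {x. poly (A - B) x = 0}"
      by (auto simp: poly_monom A_def)
  qed
  moreover have "card ((\<lambda>i. z ^ i * \<beta>) ` {..<n}) = n"
    using primitive_root_inj[OF z] \<beta> by (subst card_image) (auto intro!: inj_onI)
  ultimately show False by simp
qed

text \<open>The minimal polynomial of \<open>\<beta>\<close> divides the product of the
  \<open>X - z ^ i * \<beta>\<close>, so its constant term is \<open>\<beta> ^ d\<close> times a
  nonzero element of \<open>S\<close>. Hence \<open>X ^ d - \<beta> ^ d\<close> is the minimal
  polynomial.\<close>

lemma (in closed_subfield) kummer_degree: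
  assumes z: "primitive_root_of_unity n z" "z \<in> S" and n: "n > 0" and \<beta>: "\<beta> \<noteq> 0" "\<beta> ^ n \<in> S"
  obtains d where "d > 0" "d dvd n" "\<beta> ^ d \<in> S"
    "\<And>f. coeffs_in S f \<Longrightarrow> f \<noteq> 0 \<Longrightarrow> degree f < d \<Longrightarrow> poly f \<beta> \<noteq> 0"
proof -
  define Q where "Q d \<longleftrightarrow> (\<exists>f. coeffs_in S f \<and> f \<noteq> 0 \<and> poly f \<beta> = 0 \<and> degree f = d)" for d
  define d where "d = (LEAST d. Q d)"
  let ?A = "monom 1 n - [:\<beta> ^ n:]"
  have A: "coeffs_in S ?A" using \<beta> by (intro coeffs_in_diff) (auto simp: one_mem)
  have "?A \<noteq> 0" using lead_coeff_monom_minus_const[OF n, of "\<beta> ^ n"] by (metis leading_coeff_0_iff zero_neq_one)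
  then have "Q n" unfolding Q_def using n A
    by (intro exI[of _ ?A]) (auto simp: poly_monom degree_monom_minus_const)
  then have "Q d" unfolding d_def by (rule LeastI)
  then obtain f where f: "coeffs_in S f" "f \<noteq> 0" "poly f \<beta> = 0" "degree f = d" by (auto simp: Q_def)
  have min: "poly g \<beta> \<noteq> 0" if "coeffs_in S g" "g \<noteq> 0" "degree g < d" for g
    using not_less_Least[of "degree g" Q] that by (auto simp: Q_def d_def)
  define \<mu> where "\<mu> = smult (inverse (lead_coeff f)) f"
  have \<mu>: "coeffs_in S \<mu>" "lead_coeff \<mu> = 1" "poly \<mu> \<beta> = 0" "degree \<mu> = d"
    using f by (auto simp: \<mu>_def coeffs_in_def intro!: mult_mem inverse_mem)
  have d0: "d > 0"
  proof (rule ccontr)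
    assume "\<not> d > 0"
    then obtain a where "\<mu> = [:a:]" using \<mu>(4) by (auto elim: degree_eq_zeroE)
    then show False using \<mu> by simp
  qed
  obtain q r where qr: "coeffs_in S q" "coeffs_in S r" "?A = q * \<mu> + r" "degree r < degree \<mu>"
    using coeffs_in_div_monic[OF \<mu>(1,2) _ A] \<mu>(4) d0 by auto
  have "poly (q * \<mu> + r) \<beta> = 0" unfolding qr(3)[symmetric] by (simp add: poly_monom)
  then have "poly r \<beta> = 0" using \<mu>(3) by simp
  then have "r = 0" using min qr \<mu>(4) by blast
  then have "\<mu> dvd (\<Prod>i<n. [:- (z ^ i * \<beta>), 1:])"
    using qr(3) monom_minus_power_eq_prod[OF z(1) n \<beta>(1)] by simp
  then obtain J where J: "J \<subseteq> {..<n}" "\<mu> = (\<Prod>i\<in>J. [:- (z ^ i * \<beta>), 1:])"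
    using monic_dvd_prod_linear[of "{..<n}" \<mu> "\<lambda>i. z ^ i * \<beta>"] \<mu>(2) by auto
  have finJ: "finite J" using J(1) finite_subset by blast
  have "card J = d" using \<mu>(4) unfolding J(2) by (simp add: degree_prod_eq_sum_degree)
  have "poly \<mu> 0 = (\<Prod>i\<in>J. - (z ^ i) * \<beta>)" unfolding J(2) by (simp add: poly_prod)
  also have "\<dots> = (\<Prod>i\<in>J. - (z ^ i)) * \<beta> ^ d"
    using \<open>card J = d\<close> by (simp only: prod.distrib prod_constant)
  finally have e: "poly \<mu> 0 = (\<Prod>i\<in>J. - (z ^ i)) * \<beta> ^ d" .
  have z0: "z \<noteq> 0" using primitive_root_nonzero[OF z(1) n] .
  have "(\<Prod>i\<in>J. - (z ^ i)) \<noteq> 0" using finJ z0 by (simp add: prod_zero_iff)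
  then have "\<beta> ^ d = poly \<mu> 0 / (\<Prod>i\<in>J. - (z ^ i))" using e by (simp add: field_simps)
  also have "\<dots> \<in> S" using \<mu>(1) z(2) by (intro divide_mem poly_mem prod_mem uminus_mem power_mem zero_mem)
  finally have bd: "\<beta> ^ d \<in> S" .
  \<comment> \<open>Otherwise \<open>\<beta> ^ (n mod d)\<close> would lie in \<open>S\<close> as
    well and give a polynomial of degree below \<open>d\<close> with root
    \<open>\<beta>\<close>.\<close>
  have "n mod d = 0"
  proof (rule ccontr)
    assume m: "n mod d \<noteq> 0"
    have "\<beta> ^ n = \<beta> ^ (d * (n div d) + n mod d)" by simp
    also have "\<dots> = (\<beta> ^ d) ^ (n div d) * \<beta> ^ (n mod d)" by (simp only: power_add power_mult)
    finally have "\<beta> ^ (n mod d) = \<beta> ^ n / (\<beta> ^ d) ^ (n div d)" using \<beta>(1) by (simp add: field_simps)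
    also have "\<dots> \<in> S" by (rule divide_mem[OF \<beta>(2) power_mem[OF bd]])
    finally have bm: "\<beta> ^ (n mod d) \<in> S" .
    let ?B = "monom 1 (n mod d) - [:\<beta> ^ (n mod d):]"
    have "coeffs_in S ?B" using bm by (intro coeffs_in_diff) (auto simp: one_mem)
    moreover have "degree ?B = n mod d" using m by (intro degree_monom_minus_const) simp
    ultimately have "poly ?B \<beta> \<noteq> 0" using m d0 by (intro min) auto
    then show False by (simp add: poly_monom)
  qed
  then show ?thesis using that[OF d0 _ bd min] by (simp add: mod_eq_0_iff_dvd)
qed

text \<open>
  Let \<open>g\<close> be the automorphism of \<open>L = K(\<zeta>, \<beta>)\<close> over \<open>K(\<zeta>)\<close> that generates the Galois group and
  \<open>\<tau>\<close> one with \<open>\<tau> \<zeta> = \<zeta>\<^sup>2\<close>. Then \<open>\<tau> g = g\<^sup>2 \<tau>\<close>, whereas on a root of unity all automorphisms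
  act by powers and hence commute. So \<open>g = g\<^sup>2\<close>, that is \<open>g = 1\<close>, on roots of unity.
\<close>

lemma (in closed_subfield) root_of_unity_in_cyclotomic:
  fixes \<zeta> \<beta> :: 'a
  defines "F \<equiv> adjoin S \<zeta>"
  assumes F: "closed_subfield F" and L: "closed_subfield (adjoin F \<beta>)"
    and \<zeta>: "primitive_root_of_unity N \<zeta>" "N > 0"
    and \<Phi>: "coeffs_in S \<Phi>" "lead_coeff \<Phi> = 1" "degree \<Phi> > 0" "poly \<Phi> \<zeta> = 0" "poly \<Phi> (\<zeta>\<^sup>2) = 0"
    and minimal: "\<And>f. coeffs_in S f \<Longrightarrow> f \<noteq> 0 \<Longrightarrow> degree f < degree \<Phi> \<Longrightarrow> poly f \<zeta> \<noteq> 0"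
    and n: "n dvd N" and \<beta>: "\<beta> \<noteq> 0" "\<beta> ^ n \<in> S"
    and \<omega>: "\<omega> \<in> adjoin F \<beta>" "\<omega> ^ M = 1" "M > 0"
  shows "\<omega> \<in> F"
proof -
  interpret F: closed_subfield F by fact
  interpret L: closed_subfield "adjoin F \<beta>" by fact
  have SF: "S \<subseteq> F" unfolding F_def by (rule adjoin_superset)
  have FL: "F \<subseteq> adjoin F \<beta>" by (rule F.adjoin_superset)
  have \<zeta>F: "\<zeta> \<in> F" unfolding F_def by (rule adjoin_mem)
  have \<beta>L: "\<beta> \<in> adjoin F \<beta>" by (rule F.adjoin_mem)
  obtain k where k: "N = k * n" using n by (metis dvd_div_mult_self)
  have n0: "n > 0" using k \<zeta>(2) by (cases n) auto
  define z where "z = \<zeta> ^ k"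
  have z: "primitive_root_of_unity n z" unfolding z_def by (rule primitive_root_power[OF \<zeta>(1) k \<zeta>(2)])
  have zF: "z \<in> F" unfolding z_def by (intro F.power_mem \<zeta>F)
  have zn: "z ^ n = 1" using z by (simp add: primitive_root_of_unity_def)
  obtain d where d: "d > 0" "d dvd n" "\<beta> ^ d \<in> F"
    and dmin: "\<And>f. coeffs_in F f \<Longrightarrow> f \<noteq> 0 \<Longrightarrow> degree f < d \<Longrightarrow> poly f \<beta> \<noteq> 0"
    using F.kummer_degree[OF z zF n0 \<beta>(1)] \<beta>(2) SF by blast
  obtain e where e: "n = e * d" using d(2) by (metis dvd_div_mult_self)
  have e0: "e > 0" using e n0 by (cases e) auto
  define c where "c = \<beta> ^ d"
  define \<mu> where "\<mu> = monom 1 d - [:c:]"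
  have cF: "c \<in> F" using d by (simp add: c_def)
  have c0: "c \<noteq> 0" using \<beta> by (simp add: c_def)
  have \<mu>: "coeffs_in F \<mu>" "lead_coeff \<mu> = 1" "degree \<mu> = d" "poly \<mu> \<beta> = 0"
  proof -
    show "coeffs_in F \<mu>" unfolding \<mu>_def using cF by (intro F.coeffs_in_diff) (auto simp: F.one_mem)
    show "lead_coeff \<mu> = 1" "degree \<mu> = d"
      unfolding \<mu>_def using lead_coeff_monom_minus_const[OF d(1)] degree_monom_minus_const[OF d(1)] by blast+
    show "poly \<mu> \<beta> = 0" by (simp add: \<mu>_def poly_monom c_def)
  qed
  \<comment> \<open>\<open>\<eta>\<close> has exact order \<open>d\<close>, the degree of
    \<open>\<beta>\<close> over \<open>F\<close>, so \<open>g\<close> with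
    \<open>g \<beta> = \<eta> * \<beta>\<close> generates the automorphisms over
    \<open>F\<close>.\<close>
  define \<eta> where "\<eta> = z ^ e"
  have \<eta>: "primitive_root_of_unity d \<eta>" unfolding \<eta>_def by (rule primitive_root_power[OF z e n0])
  have \<eta>F: "\<eta> \<in> F" unfolding \<eta>_def by (intro F.power_mem zF)
  have idF: "field_hom_on F id" by (simp add: field_hom_on_def)
  have \<eta>d: "\<eta> ^ d = 1" using \<eta> by (simp add: primitive_root_of_unity_def)
  have "poly (map_poly id \<mu>) (\<eta> * \<beta>) = 0" using \<eta>d by (simp add: \<mu>_def poly_monom power_mult_distrib c_def)
  then have "poly (map_poly id f) (\<eta> * \<beta>) = 0" if "coeffs_in F f" "poly f \<beta> = 0" for f
    using F.conjugate_root[OF idF \<mu>(1,2) _ \<mu>(4) _ _ that] dmin d(1) by (simp add: \<mu>(3))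
  then obtain g where g: "field_hom_on (adjoin F \<beta>) g" "\<And>a. a \<in> F \<Longrightarrow> g a = id a" "g \<beta> = \<eta> * \<beta>"
    using F.extend_hom[OF idF, of \<beta> "\<eta> * \<beta>"] by blast
  then have g: "field_hom_on (adjoin F \<beta>) g" "\<And>a. a \<in> F \<Longrightarrow> g a = a" "g \<beta> = \<eta> * \<beta>" by auto
  have idS: "field_hom_on S id" by (simp add: field_hom_on_def)
  have "poly (map_poly id f) (\<zeta>\<^sup>2) = 0" if "coeffs_in S f" "poly f \<zeta> = 0" for f
    using conjugate_root[OF idS \<Phi>(1-4) _ _ that] minimal \<Phi>(5) by simp
  then obtain \<tau>\<^sub>0 where "field_hom_on F \<tau>\<^sub>0" "\<And>a. a \<in> S \<Longrightarrow> \<tau>\<^sub>0 a = id a" "\<tau>\<^sub>0 \<zeta> = \<zeta>\<^sup>2"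
    using extend_hom[OF idS, of \<zeta> "\<zeta>\<^sup>2"] unfolding F_def by blast
  then have t0: "field_hom_on F \<tau>\<^sub>0" "\<And>a. a \<in> S \<Longrightarrow> \<tau>\<^sub>0 a = a" "\<tau>\<^sub>0 \<zeta> = \<zeta>\<^sup>2" by auto
  \<comment> \<open>\<open>c ^ e = \<beta> ^ n\<close> lies in \<open>S\<close> and is fixed by
    \<open>\<tau>\<^sub>0\<close>, so \<open>\<tau>\<^sub>0 c / c\<close> is an \<open>e\<close>-th
    root of unity and therefore the \<open>d\<close>-th power of some \<open>z ^ i\<close>. This
    allows \<open>\<tau>\<^sub>0\<close> to be extended with \<open>\<beta>\<close> mapped to
    \<open>z ^ i * \<beta>\<close>.\<close>
  have "(\<tau>\<^sub>0 c / c) ^ e = 1"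
  proof -
    have "\<tau>\<^sub>0 c ^ e = \<tau>\<^sub>0 (\<beta> ^ n)" using F.hom_power[OF t0(1) cF, of e] by (simp add: c_def e mult.commute flip: power_mult)
    also have "\<dots> = c ^ e" using t0(2) \<beta>(2) by (simp add: c_def e mult.commute flip: power_mult)
    finally show ?thesis using c0 by (simp add: power_divide)
  qed
  moreover have "primitive_root_of_unity e (z ^ d)"
    by (rule primitive_root_power[OF z _ n0]) (simp add: e mult.commute)
  ultimately obtain i where "\<tau>\<^sub>0 c / c = (z ^ d) ^ i" using root_of_unity_eq_power[OF _ e0] by metis
  then have t0c: "\<tau>\<^sub>0 c = (z ^ i * \<beta>) ^ d"
    using c0 by (simp add: c_def field_simps power_mult_distrib flip: power_mult)
  have "poly (map_poly \<tau>\<^sub>0 \<mu>) (z ^ i * \<beta>) = 0"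
  proof -
    have "map_poly \<tau>\<^sub>0 \<mu> = monom 1 d - [:\<tau>\<^sub>0 c:]"
      using F.hom_0[OF t0(1)] F.hom_1[OF t0(1)] F.hom_uminus[OF t0(1) cF] d(1)
      by (intro poly_eqI) (auto simp: \<mu>_def coeff_map_poly coeff_pCons split: nat.splits)
    then show ?thesis by (simp add: t0c poly_monom)
  qed
  then have "poly (map_poly \<tau>\<^sub>0 f) (z ^ i * \<beta>) = 0" if "coeffs_in F f" "poly f \<beta> = 0" for f
    using F.conjugate_root[OF t0(1) \<mu>(1,2) _ \<mu>(4) _ _ that] dmin d(1) by (simp add: \<mu>(3))
  then obtain \<tau> where \<tau>: "field_hom_on (adjoin F \<beta>) \<tau>" "\<And>a. a \<in> F \<Longrightarrow> \<tau> a = \<tau>\<^sub>0 a" "\<tau> \<beta> = z ^ i * \<beta>"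
    using F.extend_hom[OF t0(1), of \<beta> "z ^ i * \<beta>"] by blast
  have \<tau>S: "\<tau> a = a" if "a \<in> S" for a using \<tau>(2) t0(2) that SF by auto
  have \<tau>\<zeta>: "\<tau> \<zeta> = \<zeta>\<^sup>2" using \<tau>(2)[OF \<zeta>F] t0(3) by simp
  have \<tau>F: "\<tau> a \<in> F" if "a \<in> F" for a
  proof -
    have "\<tau>\<^sub>0 a \<in> F" using t0 that SF \<zeta>F F.power_mem
      by (intro adjoin_hom_mem[of \<zeta> \<tau>\<^sub>0 F a]) (auto simp: F_def[symmetric] F.closed_subring_axioms)
    then show ?thesis using \<tau>(2) that by simp
  qed
  have gL: "g a \<in> adjoin F \<beta>" if "a \<in> adjoin F \<beta>" for a
  proof (rule F.adjoin_hom_mem[OF g(1) L.closed_subring_axioms _ _ that])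
    show "g a \<in> adjoin F \<beta>" if "a \<in> F" for a using g(2) that FL by auto
    show "g \<beta> \<in> adjoin F \<beta>" unfolding g(3) using \<eta>F FL by (intro L.mult_mem \<beta>L) auto
  qed
  have \<tau>L: "\<tau> a \<in> adjoin F \<beta>" if "a \<in> adjoin F \<beta>" for a
  proof (rule F.adjoin_hom_mem[OF \<tau>(1) L.closed_subring_axioms _ _ that])
    show "\<tau> a \<in> adjoin F \<beta>" if "a \<in> F" for a using \<tau>F that FL by auto
    show "\<tau> \<beta> \<in> adjoin F \<beta>" unfolding \<tau>(3) using zF FL by (intro L.mult_mem L.power_mem \<beta>L) auto
  qed
  have h1: "field_hom_on (adjoin F \<beta>) (\<tau> \<circ> g)"
    using g(1) \<tau>(1) gL unfolding field_hom_on_def comp_apply by metis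
  have h2: "field_hom_on (adjoin F \<beta>) (g \<circ> g \<circ> \<tau>)"
    using g(1) \<tau>(1) gL \<tau>L unfolding field_hom_on_def comp_apply by metis
  have \<tau>z: "\<tau> (\<zeta> ^ j) = (\<zeta> ^ j)\<^sup>2" for j
    using L.hom_power[OF \<tau>(1), of \<zeta>] \<zeta>F FL \<tau>\<zeta> by (auto simp: mult.commute simp flip: power_mult)
  \<comment> \<open>On \<open>F\<close> both sides agree since \<open>g\<close> is the identity
    there and \<open>\<tau>\<close> preserves \<open>F\<close>; on \<open>\<beta>\<close> both give
    \<open>z ^ i * \<eta> ^ 2 * \<beta>\<close>.\<close>
  have comm: "\<tau> (g a) = g (g (\<tau> a))" if "a \<in> adjoin F \<beta>" for a
  proof -
    have "(\<tau> \<circ> g) a = (g \<circ> g \<circ> \<tau>) a"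
    proof (rule F.adjoin_hom_eq[OF h1 h2 _ _ that])
      fix a assume "a \<in> F"
      then show "(\<tau> \<circ> g) a = (g \<circ> g \<circ> \<tau>) a" using g(2) \<tau>F by simp
    next
      have "\<eta> = \<zeta> ^ (k * e)" by (simp add: \<eta>_def z_def flip: power_mult)
      then have "\<tau> \<eta> = \<eta>\<^sup>2" using \<tau>z by simp
      moreover have "\<tau> (\<eta> * \<beta>) = \<tau> \<eta> * \<tau> \<beta>" using \<eta>F FL \<beta>L by (intro L.hom_mult[OF \<tau>(1)]) auto
      moreover have "g (z ^ i * \<beta>) = z ^ i * (\<eta> * \<beta>)"
        using L.hom_mult[OF g(1), of "z ^ i" \<beta>] g(2,3) F.power_mem[OF zF] FL \<beta>L by auto
      moreover have "g (z ^ i * (\<eta> * \<beta>)) = z ^ i * \<eta> * (\<eta> * \<beta>)"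
        using L.hom_mult[OF g(1), of "z ^ i * \<eta>" \<beta>] g(2,3) F.mult_mem[OF F.power_mem[OF zF] \<eta>F] FL \<beta>L
        by (auto simp: mult.assoc)
      ultimately show "(\<tau> \<circ> g) \<beta> = (g \<circ> g \<circ> \<tau>) \<beta>"
        by (simp add: g(3) \<tau>(3) power2_eq_square mult_ac)
    qed
    then show ?thesis by simp
  qed
  obtain m where m: "m > 0" "primitive_root_of_unity m \<omega>" using exists_order[OF \<omega>(2,3)] by blast
  have \<omega>m: "\<omega> ^ m = 1" using m(2) by (simp add: primitive_root_of_unity_def)
  have "g \<omega> ^ m = 1" using L.hom_power[OF g(1) \<omega>(1), of m] L.hom_1[OF g(1)] \<omega>m by simp
  then obtain t where t: "g \<omega> = \<omega> ^ t" using root_of_unity_eq_power[OF m(2,1)] by metis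
  have "\<tau> \<omega> ^ m = 1" using L.hom_power[OF \<tau>(1) \<omega>(1), of m] L.hom_1[OF \<tau>(1)] \<omega>m by simp
  then obtain u where u: "\<tau> \<omega> = \<omega> ^ u" using root_of_unity_eq_power[OF m(2,1)] by metis
  have gp: "g (\<omega> ^ j) = \<omega> ^ (t * j)" for j using L.hom_power[OF g(1) \<omega>(1), of j] t by (simp add: power_mult)
  have \<tau>p: "\<tau> (\<omega> ^ j) = \<omega> ^ (u * j)" for j using L.hom_power[OF \<tau>(1) \<omega>(1), of j] u by (simp add: power_mult)
  \<comment> \<open>The commutation relation reads
    \<open>\<omega> ^ (t * u) = \<omega> ^ (t * t * u)\<close>; injectivity of \<open>\<tau>\<close>
    and then of \<open>g\<close> removes \<open>u\<close> and one factor \<open>t\<close>.\<close>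
  have "\<tau> (\<omega> ^ t) = \<tau> (\<omega> ^ (t * t))"
    using comm[OF \<omega>(1)] by (simp add: t u gp \<tau>p mult_ac)
  then have "\<omega> ^ t = \<omega> ^ (t * t)" using L.hom_inj[OF \<tau>(1)] L.power_mem[OF \<omega>(1)] by blast
  then have "g \<omega> = g (\<omega> ^ t)" using gp[of t] t by metis
  then have "\<omega> = \<omega> ^ t" using L.hom_inj[OF g(1)] L.power_mem[OF \<omega>(1)] \<omega>(1) by blast
  then have g\<omega>: "g \<omega> = \<omega>" using t by simp
  obtain f' where f': "coeffs_in F f'" "\<omega> = poly f' \<beta>" using \<omega>(1) by (auto simp: adjoin_def)
  obtain q f where f: "coeffs_in F q" "coeffs_in F f" "f' = q * \<mu> + f" "degree f < d"
    using F.coeffs_in_div_monic[OF \<mu>(1,2) _ f'(1)] \<mu>(3) d(1) by auto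
  have \<omega>f: "\<omega> = poly f \<beta>" using f' f(3) \<mu>(4) by simp
  \<comment> \<open>\<open>f2\<close> is \<open>f(\<eta> X)\<close>. Because \<open>g\<close> fixes
    \<open>\<omega>\<close>, \<open>f2\<close> and \<open>f\<close> agree at \<open>\<beta>\<close>
    and hence are equal, and \<open>\<eta> ^ i \<noteq> 1\<close> for \<open>0 < i < d\<close>
    leaves only the constant coefficient.\<close>
  define f2 where "f2 = pcompose f [:0, \<eta>:]"
  have f2: "coeffs_in F f2" unfolding f2_def using f(2) \<eta>F by (intro F.coeffs_in_pcompose) (auto simp: F.zero_mem)
  have "g \<omega> = poly (map_poly g f) (g \<beta>)" unfolding \<omega>f using f(2) FL
    by (intro L.hom_poly[OF g(1)] \<beta>L) (auto simp: coeffs_in_def)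
  also have "map_poly g f = f" using f(2) g(2) L.hom_0[OF g(1)] by (intro poly_eqI) (auto simp: coeff_map_poly coeffs_in_def)
  finally have "poly (f2 - f) \<beta> = 0" using g\<omega> \<omega>f by (simp add: g(3) f2_def poly_pcompose mult.commute)
  moreover have "degree (f2 - f) < d"
  proof (intro degree_diff_less)
    have "degree f2 \<le> degree f * degree [:0, \<eta>:]" unfolding f2_def by (rule degree_pcompose_le)
    also have "\<dots> \<le> degree f * 1" by (intro mult_left_mono) auto
    finally show "degree f2 < d" using f(4) by simp
  qed (rule f(4))
  ultimately have "f2 = f" using dmin[of "f2 - f"] F.coeffs_in_diff[OF f2 f(2)] by fastforce
  have "coeff f i = 0" if i: "i > 0" for i
  proof (cases "i < d")
    case True
    have "coeff f i = \<eta> ^ i * coeff f i" using \<open>f2 = f\<close> unfolding f2_def by (metis coeff_pcompose_linear)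
    moreover have "\<eta> ^ i \<noteq> 1" using \<eta> i True by (simp add: primitive_root_of_unity_def)
    ultimately show ?thesis by (metis mult_cancel_right1)
  qed (use f(4) in \<open>simp add: coeff_eq_0\<close>)
  then have "degree f = 0" by (metis degree_0 leading_coeff_0_iff not_gr_zero)
  then obtain a where "f = [:a:]" by (auto elim: degree_eq_zeroE)
  then show ?thesis using \<omega>f f(2) by simp
qed

section \<open>Cyclotomic extensions\<close>

text \<open>For prime \<open>p\<close> and \<open>r > 0\<close> this is the cyclotomic polynomial of
  order \<open>p ^ r\<close>, that is \<open>(X ^ (p ^ r) - 1) / (X ^ (p ^ (r - 1)) - 1)\<close> as
  a geometric sum.\<close>

definition cyclotomic_prime_power :: "nat \<Rightarrow> nat \<Rightarrow> 'a::field poly" where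
  "cyclotomic_prime_power p r = (\<Sum>i<p. monom 1 (i * p ^ (r - 1)))"

lemma cyclotomic_prime_power_degree:
  assumes "p > 1"
  shows "degree (cyclotomic_prime_power p r :: 'a::field poly) = (p - 1) * p ^ (r - 1)"
    and "lead_coeff (cyclotomic_prime_power p r :: 'a poly) = 1"
proof -
  obtain q where q: "p = Suc q" "q > 0" using assms by (cases p) auto
  have eq: "(cyclotomic_prime_power p r :: 'a poly) =
      (\<Sum>i<q. monom 1 (i * p ^ (r - 1))) + monom 1 (q * p ^ (r - 1))"
    by (simp add: cyclotomic_prime_power_def q)
  have less: "degree (\<Sum>i<q. monom (1::'a) (i * p ^ (r - 1))) < q * p ^ (r - 1)"
    using q by (intro degree_sum_less) (auto simp: degree_monom_eq)
  have deg: "degree (cyclotomic_prime_power p r :: 'a poly) = q * p ^ (r - 1)"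
    unfolding eq using less by (subst degree_add_eq_right) (auto simp: degree_monom_eq)
  then show "degree (cyclotomic_prime_power p r :: 'a poly) = (p - 1) * p ^ (r - 1)" by (simp add: q)
  show "lead_coeff (cyclotomic_prime_power p r :: 'a poly) = 1"
    unfolding deg using less by (simp add: eq coeff_eq_0)
qed

lemma (in closed_subring) coeffs_in_cyclotomic_prime_power: "coeffs_in S (cyclotomic_prime_power p r)"
  unfolding cyclotomic_prime_power_def by (intro coeffs_in_sum coeffs_in_monom one_mem)

lemma poly_cyclotomic_prime_power:
  assumes "x ^ p ^ r = 1" "x ^ p ^ (r - 1) \<noteq> 1" "r > 0"
  shows "poly (cyclotomic_prime_power p r) (x::'a::field) = 0"
proof -
  let ?y = "x ^ p ^ (r - 1)"
  have "p ^ r = p ^ (r - 1) * p" using assms(3) by (cases r) auto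
  then have "?y ^ p = 1" using assms(1) by (simp flip: power_mult)
  have "poly (cyclotomic_prime_power p r) x = (\<Sum>i<p. ?y ^ i)"
    by (simp add: cyclotomic_prime_power_def poly_sum poly_monom mult.commute flip: power_mult)
  also have "\<dots> = (?y ^ p - 1) / (?y - 1)" using assms(2) by (rule geometric_sum)
  finally show ?thesis using \<open>?y ^ p = 1\<close> by simp
qed

context valued_extension
begin

text \<open>The strict case of the ultrametric inequality. The hypothesis on \<open>y\<close> is
  guarded because \<open>v 0\<close> is an arbitrary number.\<close>

lemma v_add_eq:
  assumes "x \<in> L" "x \<noteq> 0" "y \<in> L" "y \<noteq> 0 \<Longrightarrow> v x < v y"
  shows "x + y \<noteq> 0" "v (x + y) = v x"
proof -
  have yx: "y / x \<in> P"
  proof (cases "y = 0")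
    case False
    then show ?thesis using P_iff[of "y / x"] assms by (simp add: v_divide L.divide_mem)
  qed (simp add: zero_in_P)
  have "1 + y / x \<notin> P" using P_diff[OF _ yx, of "1 + y / x"] unit_not_P[OF unit_1] by auto
  then have u: "unit (1 + y / x)" using yx by (simp add: P_def V.add_mem V.one_mem)
  have eq: "x + y = x * (1 + y / x)" using assms(2) by (simp add: distrib_left)
  have u0: "1 + y / x \<noteq> 0" using u by (auto simp: unit_def)
  then show "x + y \<noteq> 0" using assms(2) eq by simp
  have uL: "1 + y / x \<in> L" using u unit_V VL by blast
  then show "v (x + y) = v x" unfolding eq using assms u0 u unit_iff[OF uL u0] by (simp add: v_mult)
qed

text \<open>The middle binomial coefficients are divisible by \<open>p\<close>. The linear term is
  kept apart, as it dominates the terms divisible by \<open>p * x ^ 2\<close> when \<open>x\<close>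
  lies in \<open>P\<close>.\<close>

lemma one_plus_power_odd_prime:
  assumes odd: "odd p" and x: "x \<in> V"
  shows "\<exists>w\<in>V. (1 + x) ^ p = 1 + x ^ p + of_nat p * x * (1 + x * w)"
proof
  have p3: "p \<ge> 3" using odd prime_ge_2_nat[OF prime_p] by (cases "p = 2") auto
  define w where "w = (\<Sum>k\<in>{2..<p}. of_nat ((p choose k) div p) * x ^ (k - 2))"
  show "w \<in> V" unfolding w_def using x by (intro V.sum_mem V.mult_mem V.power_mem V.of_nat_mem)
  have "(x + 1) ^ p = (\<Sum>k\<le>p. of_nat (p choose k) * x ^ k)" by (subst binomial_ring) simp
  also have "{..p} = insert 0 (insert 1 (insert p {2..<p}))" using p3 by auto
  also have "(\<Sum>k\<in>insert 0 (insert 1 (insert p {2..<p})). of_nat (p choose k) * x ^ k) =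
      1 + (of_nat p * x + (x ^ p + (\<Sum>k\<in>{2..<p}. of_nat (p choose k) * x ^ k)))"
    using p3 by simp
  also have "(\<Sum>k\<in>{2..<p}. of_nat (p choose k) * x ^ k) = of_nat p * x * (x * w)"
    unfolding w_def sum_distrib_left
  proof (intro sum.cong refl)
    fix k assume k: "k \<in> {2..<p}"
    then have "p dvd (p choose k)" using prime_p by (intro dvd_choose_prime) auto
    then have "p choose k = p * ((p choose k) div p)" by simp
    then have 1: "of_nat (p choose k) = (of_nat p * of_nat ((p choose k) div p) :: 'a)"
      by (metis of_nat_mult)
    have "k = Suc (Suc (k - 2))" using k by auto
    then have 2: "x ^ k = x * (x * x ^ (k - 2))" by (metis power_Suc)
    show "of_nat (p choose k) * x ^ k = of_nat p * x * (x * (of_nat ((p choose k) div p) * x ^ (k - 2)))"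
      unfolding 1 2 by (simp only: mult_ac)
  qed
  finally show "(1 + x) ^ p = 1 + x ^ p + of_nat p * x * (1 + x * w)"
    by (simp add: algebra_simps)
qed

text \<open>For order \<open>p\<close>, expanding \<open>(1 + x) ^ p = 1\<close> with
  \<open>x = z - 1\<close> gives \<open>x ^ (p - 1)\<close> as \<open>- p\<close> times a unit. In
  the induction step \<open>x ^ p\<close> differs from \<open>z ^ p - 1\<close> by an element of
  \<open>p * P\<close>, whose value exceeds \<open>v(p)\<close> and hence that of
  \<open>z ^ p - 1\<close>; so passing to \<open>z\<close> divides the value by
  \<open>p\<close>.\<close>

lemma v_root_of_unity_minus_1:
  assumes odd: "odd p" and z: "primitive_root_of_unity (p ^ Suc r) z" and zL: "z \<in> L"
  shows "z - 1 \<in> P" "z - 1 \<noteq> 0" "v (z - 1) * int ((p - 1) * p ^ r) = int D"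
proof -
  have p1: "p > 1" using prime_gt_1_nat[OF prime_p] .
  have "z - 1 \<in> P \<and> z - 1 \<noteq> 0 \<and> v (z - 1) * int ((p - 1) * p ^ r) = int D"
    using z zL
  proof (induction r arbitrary: z)
    case 0
    have zp: "z ^ p = 1" and z1: "z \<noteq> 1" using 0 p1 unfolding primitive_root_of_unity_def
      by (simp, metis One_nat_def less_numeral_extra(1) power_0 power_one_right power_Suc0_right)
    have zV: "z \<in> V" using power_in_V_iff[OF 0(2) p_pos] zp V.one_mem by simp
    define x where "x = z - 1"
    have xV: "x \<in> V" unfolding x_def by (intro V.diff_mem zV V.one_mem)
    have x0: "x \<noteq> 0" using z1 by (simp add: x_def)
    obtain w where w: "w \<in> V" "(1 + x) ^ p = 1 + x ^ p + of_nat p * x * (1 + x * w)"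
      using one_plus_power_odd_prime[OF odd xV] by blast
    have eq: "x ^ p = of_nat p * (- (x * (1 + x * w)))" using w(2) zp by (simp add: x_def algebra_simps eq_neg_iff_add_eq_0)
    have "x ^ p \<in> P" unfolding eq
      by (intro P_mult p_in_P V.uminus_mem V.mult_mem V.add_mem V.one_mem xV w)
    then have xP: "x \<in> P" using P_power_iff[OF xV p_pos] by simp
    have xwP: "x * w \<in> P" using xP w by (intro P_mult)
    have xwL: "x * w \<in> L" using xwP P_V VL by blast
    have "1 + x * w \<notin> P" using P_diff[OF _ xwP, of "1 + x * w"] unit_not_P[OF unit_1] by auto
    then have u: "unit (1 + x * w)" using P_V[OF xwP] by (simp add: P_def V.add_mem V.one_mem)
    then have u0: "1 + x * w \<noteq> 0" and uL: "1 + x * w \<in> L" using VL by (auto simp: unit_def)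
    have "x * x ^ (p - 1) = x ^ p" using power_minus_mult[OF p_pos, of x] by (simp add: mult.commute)
    also have "\<dots> = x * (of_nat p * - (1 + x * w))" unfolding eq by (simp add: algebra_simps)
    finally have "x ^ (p - 1) = of_nat p * - (1 + x * w)" using x0 by simp
    then have "v (x ^ (p - 1)) = v (of_nat p * - (1 + x * w))" by simp
    also have "\<dots> = int D + v (- (1 + x * w))"
      using uL u0 by (subst v_mult) (auto simp: v_p L.of_nat_mem simp del: minus_add_distrib intro!: L.uminus_mem)
    also have "v (- (1 + x * w)) = 0"
    proof -
      have "unit (- (1 + x * w))" using u by (auto simp: unit_def V.uminus_mem simp del: minus_add_distrib)
      then show ?thesis using unit_iff[of "- (1 + x * w)"] uL u0 by (simp add: L.uminus_mem del: minus_add_distrib)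
    qed
    finally have "int (p - 1) * v x = int D" using x0 xV VL by (subst (asm) v_power) auto
    then show ?case using xP x0 by (simp add: x_def mult.commute)
  next
    case (Suc r)
    have z': "primitive_root_of_unity (p ^ Suc r) (z ^ p)"
      by (rule primitive_root_power[OF Suc.prems(1)]) auto
    have zp: "z ^ p \<in> L" using Suc.prems by (intro L.power_mem)
    define y where "y = z ^ p - 1"
    have y: "y \<in> P" "y \<noteq> 0" "v y * int ((p - 1) * p ^ r) = int D"
      using Suc.IH[OF z' zp] by (auto simp: y_def)
    have "z ^ p = y + 1" by (simp add: y_def)
    then have "z ^ p \<in> V" using V.add_mem[OF P_V[OF y(1)] V.one_mem] by simp
    then have zV: "z \<in> V" using power_in_V_iff[OF Suc.prems(2) p_pos] by simp
    define x where "x = z - 1"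
    have xV: "x \<in> V" unfolding x_def by (intro V.diff_mem zV V.one_mem)
    have xL: "x \<in> L" using xV VL by blast
    have yL: "y \<in> L" using y(1) P_V VL by blast
    have x0: "x \<noteq> 0" using y(2) by (auto simp: x_def y_def)
    obtain w where w: "w \<in> V" "(1 + x) ^ p = 1 + x ^ p + of_nat p * x * (1 + x * w)"
      using one_plus_power_odd_prime[OF odd xV] by blast
    define c where "c = - (x * (1 + x * w))"
    have cV: "c \<in> V" unfolding c_def by (intro V.uminus_mem V.mult_mem V.add_mem V.one_mem xV w)
    have eq: "x ^ p = y + of_nat p * c" using w(2) by (simp add: x_def y_def c_def algebra_simps)
    have "x ^ p \<in> P" unfolding eq by (intro P_add y(1) P_mult p_in_P cV)
    then have xP: "x \<in> P" using P_power_iff[OF xV p_pos] by simp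
    have "1 + x * w \<in> V" by (intro V.mult_mem V.add_mem V.one_mem xV w)
    then have cP: "c \<in> P" unfolding c_def by (intro P_uminus P_mult xP)
    have vy0: "v y > 0" using P_iff[OF yL y(2)] y(1) by simp
    define m where "m = int ((p - 1) * p ^ r)"
    have "(p - 1) * p ^ r > 0" using p1 by simp
    then have "m \<ge> 1" unfolding m_def by linarith
    then have "v y * 1 \<le> v y * m" using vy0 by (intro mult_left_mono) auto
    then have vyD: "v y \<le> int D" using y(3) by (simp add: m_def)
    have "v (x ^ p) = v y" unfolding eq
    proof (rule v_add_eq(2)[OF yL y(2)])
      show "of_nat p * c \<in> L" using cV VL by (auto intro: L.mult_mem L.of_nat_mem)
      assume "of_nat p * c \<noteq> 0"
      then have "c \<noteq> 0" by auto
      moreover have "c \<in> L" using cV VL by blast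
      ultimately show "v y < v (of_nat p * c)" using vyD P_iff[of c] cP
        by (subst v_mult) (auto simp: v_p L.of_nat_mem)
    qed
    then have "int p * v x = v y" using x0 xL by (simp add: v_power)
    then have "v x * int ((p - 1) * p ^ Suc r) = int D" using y(3) by (simp add: mult_ac flip: \<open>int p * v x = v y\<close>)
    then show ?case using xP x0 unfolding x_def by blast
  qed
  then show "z - 1 \<in> P" "z - 1 \<noteq> 0" "v (z - 1) * int ((p - 1) * p ^ r) = int D" by auto
qed

text \<open>Passing to \<open>f(X + 1)\<close> rewrites a polynomial in \<open>z\<close> as one in
  \<open>z - 1\<close>, whose value is positive in the application.\<close>

lemma pcompose_shift:
  assumes "coeffs_in K f" "f \<noteq> 0"
  shows "coeffs_in K (pcompose f [:1, 1:])" "degree (pcompose f [:1, 1:]) = degree f" "pcompose f [:1, 1:] \<noteq> 0"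
    "poly (pcompose f [:1, 1:]) (x - 1) = poly f x"
  using assms by (auto intro!: K.coeffs_in_pcompose simp: degree_pcompose poly_pcompose K.one_mem pcompose_eq_0_iff)

text \<open>The value of \<open>z - 1\<close> is \<open>v(p) / N\<close> for \<open>N\<close> the
  degree of the cyclotomic polynomial, so polynomials in \<open>z - 1\<close> of degree below
  \<open>N\<close> have terms of distinct values. This yields irreducibility of the cyclotomic
  polynomial over \<open>K\<close> and, as the second claim, the prime residue field for
  \<open>K(z)\<close>.\<close>

theorem cyclotomic_totally_ramified:
  assumes odd: "odd p" and r: "r > 0" and z: "primitive_root_of_unity (p ^ r) z" and zL: "z \<in> L"
  shows "\<And>f. coeffs_in K f \<Longrightarrow> f \<noteq> 0 \<Longrightarrow> degree f < (p - 1) * p ^ (r - 1) \<Longrightarrow> poly f z \<noteq> 0"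
    and "\<And>x. x \<in> adjoin K z \<Longrightarrow> x \<in> V \<Longrightarrow> \<exists>k::nat. x - of_nat k \<in> P"
proof -
  have "p ^ r = p ^ Suc (r - 1)" using r by simp
  note vz = v_root_of_unity_minus_1[OF odd z[unfolded this] zL]
  define N where "N = (p - 1) * p ^ (r - 1)"
  have zm: "z - 1 \<in> L" using vz(1) P_V VL by blast
  have vpos: "v (z - 1) > 0" using P_iff[OF zm vz(2)] vz(1) by simp
  note pd = poly_distinct_values[OF zm vz(2) vpos vz(3)]
  have p1: "p > 1" using prime_gt_1_nat[OF prime_p] .
  have N0: "N > 0" using p1 by (simp add: N_def)
  show "poly f z \<noteq> 0" if "coeffs_in K f" "f \<noteq> 0" "degree f < (p - 1) * p ^ (r - 1)" for f
    using pd(1)[of "pcompose f [:1, 1:]"] pcompose_shift[OF that(1,2)] that(3) by simp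
  show "\<exists>k::nat. x - of_nat k \<in> P" if x: "x \<in> adjoin K z" "x \<in> V" for x
  proof -
    obtain f where f: "coeffs_in K f" "x = poly f z" using x(1) by (auto simp: adjoin_def)
    let ?\<Phi> = "cyclotomic_prime_power p r :: 'a poly"
    have "z ^ p ^ (r - 1) \<noteq> 1" using z r p1 by (auto simp: primitive_root_of_unity_def power_strict_increasing_iff)
    then have root: "poly ?\<Phi> z = 0"
      using z r by (intro poly_cyclotomic_prime_power) (auto simp: primitive_root_of_unity_def)
    obtain q g where qg: "coeffs_in K g" "f = q * ?\<Phi> + g" "degree g < N"
      using K.coeffs_in_div_monic[OF K.coeffs_in_cyclotomic_prime_power _ _ f(1), of p r]
        cyclotomic_prime_power_degree[OF p1, of r, where ?'a = 'a] N0 by (auto simp: N_def)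
    have xg: "x = poly g z" using f(2) qg(2) root by simp
    show ?thesis
    proof (cases "g = 0")
      case True
      then show ?thesis using xg by (intro exI[of _ 0]) (simp add: zero_in_P)
    next
      case False
      then show ?thesis
        using pd(2)[of "pcompose g [:1, 1:]"] pcompose_shift[OF qg(1) False] qg(3) x(2) xg by (simp add: N_def)
    qed
  qed
qed

end

section \<open>Total ramification\<close>

lemma (in closed_subring) coeffs_in_char_poly:
  assumes M: "M \<in> carrier_mat n n" and "\<And>i j. i < n \<Longrightarrow> j < n \<Longrightarrow> M $$ (i, j) \<in> S"
  shows "coeffs_in S (char_poly M)"
proof -
  have entry: "coeffs_in S (char_poly_matrix M $$ (i, j))" if "i < n" "j < n" for i j
    using that M assms(2)[OF that] unfolding char_poly_matrix_def
    by (auto simp: zero_mem one_mem uminus_mem intro!: coeffs_in_add)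
  show ?thesis
    unfolding char_poly_def det_def'[OF char_poly_matrix_closed[OF M]]
  proof (intro coeffs_in_sum coeffs_in_mult coeffs_in_prod)
    fix \<pi> assume "\<pi> \<in> {\<pi>. \<pi> permutes {0..<n}}"
    then show "coeffs_in S (char_poly_matrix M $$ (i, \<pi> i))" if "i \<in> {0..<n}" for i
      using that permutes_in_image[of \<pi> "{0..<n}" i] by (intro entry) auto
    show "coeffs_in S (signof \<pi>)"
      by (auto simp: sign_def intro: coeffs_in_uminus)
  qed
qed

text \<open>The determinant trick, with the characteristic polynomial of multiplication by \<open>x\<close>.\<close>

lemma (in closed_subring) integral_of_stable_module:
  fixes e i0 :: nat
  assumes e: "e > 0" "b i0 \<noteq> 0" "i0 < e"
    and st: "\<And>i. i < e \<Longrightarrow> \<exists>a. (\<forall>j<e. a j \<in> S) \<and> x * b i = (\<Sum>j<e. a j * b j)"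
  shows "\<exists>f. coeffs_in S f \<and> lead_coeff f = 1 \<and> poly f x = 0"
proof -
  obtain a where a: "\<And>i j. i < e \<Longrightarrow> j < e \<Longrightarrow> a i j \<in> S" "\<And>i. i < e \<Longrightarrow> x * b i = (\<Sum>j<e. a i j * b j)"
    using st by metis
  define M where "M = mat e e (\<lambda>(i, j). a i j)"
  have M: "M \<in> carrier_mat e e" by (simp add: M_def)
  \<comment> \<open>The generators \<open>b j\<close> themselves, read as a vector over the ambient
    field, form an eigenvector with eigenvalue \<open>x\<close>; \<open>b i0 \<noteq> 0\<close>
    keeps it from being zero.\<close>
  have "eigenvector M (vec e b) x"
    unfolding eigenvector_def
  proof (intro conjI)
    show "vec e b \<in> carrier_vec (dim_row M)" by (simp add: M_def)
    have "vec e b $ i0 \<noteq> 0\<^sub>v e $ i0" using e by simp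
    then show "vec e b \<noteq> 0\<^sub>v (dim_row M)" by (auto simp: M_def)
    show "M *\<^sub>v vec e b = x \<cdot>\<^sub>v vec e b"
    proof (rule eq_vecI)
      fix i assume "i < dim_vec (x \<cdot>\<^sub>v vec e b)"
      then have i: "i < e" by simp
      have "(M *\<^sub>v vec e b) $ i = (\<Sum>j = 0..<e. a i j * b j)"
        using i by (simp add: M_def scalar_prod_def)
      also have "\<dots> = x * b i" using a(2)[OF i] by (simp add: atLeast0LessThan)
      finally show "(M *\<^sub>v vec e b) $ i = (x \<cdot>\<^sub>v vec e b) $ i" using i by simp
    qed (simp add: M_def)
  qed
  then have "poly (char_poly M) x = 0"
    using eigenvalue_root_char_poly[OF M, of x] by (auto simp: eigenvalue_def)
  moreover have "coeffs_in S (char_poly M)" using a(1) by (intro coeffs_in_char_poly[OF M]) (simp add: M_def)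
  moreover have "lead_coeff (char_poly M) = 1" using degree_monic_char_poly[OF M] by auto
  ultimately show ?thesis by blast
qed

section \<open>Translation into the ring structure of the ambient field\<close>

abbreviation "\<R> \<equiv> (ring_of_type_algebra :: 'a::field ring)"

lemma \<R>_simps [simp]:
  "carrier \<R> = UNIV" "x \<oplus>\<^bsub>\<R>\<^esub> y = x + y" "x \<otimes>\<^bsub>\<R>\<^esub> y = x * y" "\<one>\<^bsub>\<R>\<^esub> = 1" "\<zero>\<^bsub>\<R>\<^esub> = 0"
  by (simp_all add: ring_of_type_algebra_def)

lemma field_\<R>: "Ring.field \<R>"
  by (rule field_from_type_algebra)

interpretation \<R>: domain "ring_of_type_algebra :: 'a::field ring"
  by (rule field.axioms(1)[OF field_\<R>])

lemma \<R>_pow [simp]: "x [^]\<^bsub>\<R>\<^esub> (n::nat) = x ^ n"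
  by (induction n) (simp_all add: mult.commute)

lemma \<R>_uminus [simp]: "\<ominus>\<^bsub>\<R>\<^esub> x = - x"
  by (rule \<R>.minus_equality) auto

lemma \<R>_inv: "x \<noteq> 0 \<Longrightarrow> inv\<^bsub>\<R>\<^esub> x = inverse x"
  by (rule \<R>.inv_char) auto

lemma subring_iff_closed_subring: "subring S \<R> \<longleftrightarrow> closed_subring S"
proof
  assume "subring S \<R>"
  note s = subringE[OF this]
  show "closed_subring S"
    by unfold_locales (use s in auto)
next
  assume "closed_subring S"
  then interpret closed_subring S .
  show "subring S \<R>" by (rule \<R>.subringI) (auto intro: ring_mems)
qed

lemma subfield_iff_closed_subfield: "subfield S \<R> \<longleftrightarrow> closed_subfield S"
proof
  assume s: "subfield S \<R>"
  have "closed_subring S" using subfieldE(1)[OF s] by (simp add: subring_iff_closed_subring)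
  moreover have "inverse x \<in> S" if "x \<in> S" for x
  proof (cases "x = 0")
    case False
    then show ?thesis using \<R>.subfield_m_inv(1)[OF s, of x] that by (simp add: \<R>_inv)
  qed (use that in simp)
  ultimately show "closed_subfield S" by (simp add: closed_subfield_def closed_subfield_axioms_def)
next
  assume "closed_subfield S"
  then interpret closed_subfield S .
  show "subfield S \<R>"
    by (rule field.subfieldI'[OF field_\<R>]) (auto simp: subring_iff_closed_subring closed_subring_axioms \<R>_inv inverse_mem)
qed

lemma poly_Poly_append: "poly (Poly (as @ [c])) (x::'a::field) = poly (Poly as) x + c * x ^ length as"
  by (induction as) (simp_all add: algebra_simps)

lemma eval_eq_poly: "\<R>.eval cs x = poly (Poly (rev cs)) x"
  by (induction cs) (simp_all add: poly_Poly_append)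

lemma simple_extension_eq_adjoin:
  assumes "closed_subring S" shows "\<R>.simple_extension S x = adjoin S x"
proof -
  interpret closed_subring S by fact
  have "\<R>.simple_extension S x = \<Inter> {T. subring T \<R> \<and> S \<subseteq> T \<and> x \<in> T}"
    using assms by (intro \<R>.simple_extension_minimal) (auto simp: subring_iff_closed_subring)
  also have "\<dots> = adjoin S x"
    using adjoin_closed_subring[of x] adjoin_superset[of x] adjoin_mem[of x] adjoin_minimal
    by (auto simp: subring_iff_closed_subring)
  finally show ?thesis .
qed

lemma algebraic_of_monic_root:
  assumes "closed_subfield S" "coeffs_in S f" "f \<noteq> 0" "poly f x = 0"
  shows "(\<R>.algebraic over S) x"
proof (rule \<R>.algebraicI)
  show "rev (coeffs f) \<in> carrier (S [X]\<^bsub>\<R>\<^esub>)"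
    using assms(2,3) by (auto simp: univ_poly_def polynomial_def hd_rev last_coeffs_eq_coeff_degree
        coeffs_in_def coeffs_def)
  show "rev (coeffs f) \<noteq> []" using assms(3) by simp
  show "\<R>.eval (rev (coeffs f)) x = \<zero>\<^bsub>\<R>\<^esub>" using assms(4) by (simp add: eval_eq_poly)
qed

text \<open>\<open>combine\<close> stops at the end of the shorter list; the value \<open>0\<close>
  beyond the end of \<open>ks\<close> turns it into a sum over all of \<open>us\<close>.\<close>

lemma combine_eq_sum:
  "\<R>.combine ks us = (\<Sum>i<length us. (if i < length ks then ks ! i else 0) * us ! i)"
proof (induction ks us rule: \<R>.combine.induct)
  case (1 k ks u us)
  then show ?case by (auto simp: sum.lessThan_Suc_shift simp del: sum.lessThan_Suc intro!: sum.cong)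
qed auto

text \<open>Provides the degree hypothesis of \<open>valued_extension\<close>: a list of
  \<open>n + 1\<close> elements, possibly with repetitions, is too long to be independent.\<close>

lemma finite_dimension_relation:
  assumes S: "closed_subfield S" and dim: "\<R>.dimension n S E" and f: "\<And>i. i \<le> n \<Longrightarrow> f i \<in> E"
  shows "\<exists>a. (\<forall>i\<le>n. a i \<in> S) \<and> (\<exists>i\<le>n. a i \<noteq> 0) \<and> (\<Sum>i\<le>n. a i * f i) = 0"
proof -
  interpret closed_subfield S by fact
  have sf: "subfield S \<R>" using S by (simp add: subfield_iff_closed_subfield)
  define us where "us = map f [0..<Suc n]"
  have "\<not> \<R>.independent S us"
  proof
    assume "\<R>.independent S us"
    moreover have "set us \<subseteq> E" using f by (auto simp: us_def less_Suc_eq_le)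
    ultimately have "length us \<le> n" by (rule \<R>.independent_length_le_dimension[OF sf dim])
    then show False by (simp add: us_def)
  qed
  then obtain ks where ks: "length ks = length us" "\<R>.combine ks us = 0" "set ks \<subseteq> S" "set ks \<noteq> {0}"
    using \<R>.dependent_imp_non_trivial_combine[OF sf, of us] by auto
  have len: "length us = Suc n" by (simp add: us_def)
  have nth: "us ! i = f i" if "i \<le> n" for i using that unfolding us_def by (subst nth_map) (auto simp del: upt_Suc)
  have "(\<Sum>i\<le>n. ks ! i * f i) = \<R>.combine ks us"
    unfolding combine_eq_sum len lessThan_Suc_atMost using ks(1) len nth by (intro sum.cong) auto
  moreover have "\<exists>i\<le>n. ks ! i \<noteq> 0"
  proof (rule ccontr)
    assume "\<not> ?thesis"
    then have "set ks \<subseteq> {0}" using ks(1) len by (auto simp: in_set_conv_nth less_Suc_eq_le)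
    moreover have "set ks \<noteq> {}" using ks(1) len by auto
    ultimately show False using ks(4) subset_singletonD by metis
  qed
  moreover have "\<forall>i\<le>n. ks ! i \<in> S" using ks(1,3) len by (auto simp: less_Suc_eq_le subset_iff)
  ultimately show ?thesis using ks(2) by (intro exI[of _ "\<lambda>i. ks ! i"]) simp
qed

lemma dimension_of_basis:
  assumes S: "closed_subfield S" and E: "closed_subfield E" "S \<subseteq> E" and b: "\<And>i. i < e \<Longrightarrow> b i \<in> E"
    and indep: "\<And>a i. (\<And>i. i < e \<Longrightarrow> a i \<in> S) \<Longrightarrow> (\<Sum>i<e. a i * b i) = 0 \<Longrightarrow> i < e \<Longrightarrow> a i = 0"
    and span: "\<And>x. x \<in> E \<Longrightarrow> \<exists>a. (\<forall>i<e. a i \<in> S) \<and> x = (\<Sum>i<e. a i * b i)"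
  shows "\<R>.dimension e S E"
proof -
  interpret S: closed_subfield S by fact
  interpret E: closed_subfield E by fact
  have sf: "subfield S \<R>" using S by (simp add: subfield_iff_closed_subfield)
  define us where "us = map b [0..<e]"
  have comb: "\<R>.combine ks us = (\<Sum>i<e. (if i < length ks then ks ! i else 0) * b i)" for ks
    unfolding combine_eq_sum by (intro sum.cong) (auto simp: us_def)
  have "\<R>.independent S us"
  proof (rule \<R>.trivial_combine_imp_independent[OF sf])
    fix ks assume ks: "set ks \<subseteq> S" "\<R>.combine ks us = \<zero>\<^bsub>\<R>\<^esub>"
    have "(if i < length ks then ks ! i else 0) = 0" if "i < e" for i
      using ks that by (intro indep[of "\<lambda>i. if i < length ks then ks ! i else 0"])
        (auto simp: comb S.zero_mem subset_iff)
    then have "ks ! i = 0" if "i < e" "i < length ks" for i using that by metis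
    then show "set (take (length us) ks) \<subseteq> {\<zero>\<^bsub>\<R>\<^esub>}"
      by (auto simp: in_set_conv_nth us_def)
  qed simp
  moreover have "\<R>.Span S us = E"
  proof -
    have "\<R>.Span S us = {\<R>.combine ks us | ks. set ks \<subseteq> S}"
      by (rule \<R>.Span_eq_combine_set[OF sf]) simp
    also have "\<dots> = E"
    proof (intro equalityI subsetI)
      fix x assume "x \<in> {\<R>.combine ks us | ks. set ks \<subseteq> S}"
      then show "x \<in> E" using b E(2) by (auto simp: comb subset_iff intro!: E.sum_mem E.mult_mem E.zero_mem)
    next
      fix x assume "x \<in> E"
      then obtain a where a: "\<forall>i<e. a i \<in> S" "x = (\<Sum>i<e. a i * b i)" using span by blast
      then have "x = \<R>.combine (map a [0..<e]) us" by (simp add: comb)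
      moreover have "set (map a [0..<e]) \<subseteq> S" using a by auto
      ultimately show "x \<in> {\<R>.combine ks us | ks. set ks \<subseteq> S}" by blast
    qed
    finally show ?thesis .
  qed
  ultimately have "\<R>.dimension (length us) S E" by (intro \<R>.dimensionI[OF sf])
  then show ?thesis by (simp add: us_def)
qed

section \<open>Ideals in subrings of a field\<close>

context closed_subring
begin

abbreviation "RS \<equiv> ring_of_type_algebra\<lparr>carrier := S\<rparr>"

lemma cring_RS: "cring RS"
proof -
  have "subcring S \<R>" by (rule \<R>.subcringI') (simp add: subring_iff_closed_subring closed_subring_axioms)
  then show ?thesis using \<R>.subcring_iff[of S] by simp
qed

lemma ideal_RS_iff:
  "ideal I RS \<longleftrightarrow> I \<subseteq> S \<and> 0 \<in> I \<and> (\<forall>x\<in>I. \<forall>y\<in>I. x + y \<in> I) \<and> (\<forall>s\<in>S. \<forall>x\<in>I. s * x \<in> I)"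
proof
  assume "ideal I RS"
  then interpret ideal I RS .
  note I = ideal.axioms(1)[OF \<open>ideal I RS\<close>]
  show "I \<subseteq> S \<and> 0 \<in> I \<and> (\<forall>x\<in>I. \<forall>y\<in>I. x + y \<in> I) \<and> (\<forall>s\<in>S. \<forall>x\<in>I. s * x \<in> I)"
    using a_subset additive_subgroup.zero_closed[OF I] additive_subgroup.a_closed[OF I] I_l_closed by auto
next
  assume *: "I \<subseteq> S \<and> 0 \<in> I \<and> (\<forall>x\<in>I. \<forall>y\<in>I. x + y \<in> I) \<and> (\<forall>s\<in>S. \<forall>x\<in>I. s * x \<in> I)"
  interpret RS: cring RS by (rule cring_RS)
  show "ideal I RS"
  proof (rule idealI)
    show "ring RS" by (rule RS.ring_axioms)
    show "subgroup I (add_monoid RS)"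
    proof (rule group.subgroupI[OF RS.a_group])
      fix x assume x: "x \<in> I"
      have "(- 1) * x \<in> I" using * x uminus_mem[OF one_mem] by blast
      then have mx: "- x \<in> I" by simp
      then have "inv\<^bsub>add_monoid RS\<^esub> x = - x"
        using * x by (intro group.inv_equality[OF RS.a_group]) auto
      then show "inv\<^bsub>add_monoid RS\<^esub> x \<in> I" using mx by simp
    qed (use * in auto)
    fix a x assume "a \<in> I" "x \<in> carrier RS"
    then have "x * a \<in> I" using * by simp
    then show "x \<otimes>\<^bsub>RS\<^esub> a \<in> I" "a \<otimes>\<^bsub>RS\<^esub> x \<in> I" by (simp_all add: mult.commute)
  qed
qed

lemma maximalideal_RS:
  assumes I: "ideal I RS" "1 \<notin> I" and u: "\<And>x. x \<in> S \<Longrightarrow> x \<notin> I \<Longrightarrow> x \<noteq> 0 \<Longrightarrow> inverse x \<in> S"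
  shows "maximalideal I RS"
proof (rule maximalidealI[OF I(1)])
  show "carrier RS \<noteq> I" using I(2) one_mem by auto
  fix J assume J: "ideal J RS" "I \<subseteq> J" "J \<subseteq> carrier RS"
  show "J = I \<or> J = carrier RS"
  proof (rule ccontr)
    assume n: "\<not> ?thesis"
    then obtain x where x: "x \<in> J" "x \<notin> I" using J(2) by blast
    have xS: "x \<in> S" using J(3) x by auto
    have x0: "x \<noteq> 0" using x I(1) by (auto simp: ideal_RS_iff)
    have "inverse x * x \<in> J" using u[OF xS x(2) x0] J(1) x(1) unfolding ideal_RS_iff by blast
    then have "1 \<in> J" using x0 by simp
    then have "s \<in> J" if "s \<in> S" for s using J(1) that unfolding ideal_RS_iff by force
    then show False using n J(3) by auto
  qed
qed

lemma principal_ideal_RS: "c \<in> S \<Longrightarrow> ideal {c * y | y. y \<in> S} RS"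
  unfolding ideal_RS_iff
proof (intro conjI ballI)
  fix x y assume "x \<in> {c * y | y. y \<in> S}" "y \<in> {c * y | y. y \<in> S}"
  then show "x + y \<in> {c * y | y. y \<in> S}" by (auto simp: add_mem simp flip: distrib_left)
next
  fix s x assume "s \<in> S" "x \<in> {c * y | y. y \<in> S}"
  then obtain y where "y \<in> S" "x = c * y" by blast
  with \<open>s \<in> S\<close> show "s * x \<in> {c * y | y. y \<in> S}" by (auto intro!: exI[of _ "s * y"] mult_mem)
qed (auto intro: mult_mem zero_mem exI[of _ 0])

text \<open>The power is an iterated ideal product; for \<open>k = 0\<close> both sides are the
  whole ring.\<close>

lemma principal_ideal_power:
  assumes c: "c \<in> S"
  shows "{c * y | y. y \<in> S} [^]\<^bsub>ideals_set RS\<^esub> k = {c ^ k * y | y. y \<in> S}"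
proof (induction k)
  case 0
  then show ?case by (simp add: nat_pow_def ideals_set_def)
next
  case (Suc k)
  let ?P = "{c * y | y. y \<in> S}" and ?Q = "{c ^ k * y | y. y \<in> S}"
  have "?P [^]\<^bsub>ideals_set RS\<^esub> Suc k = ideal_prod RS ?Q ?P"
    using Suc by (simp add: nat_pow_def ideals_set_def)
  also have "\<dots> = {c ^ Suc k * y | y. y \<in> S}"
  proof (intro equalityI subsetI)
    fix x assume "x \<in> ideal_prod RS ?Q ?P"
    then show "x \<in> {c ^ Suc k * y | y. y \<in> S}"
    proof (induction rule: ideal_prod.induct)
      case (prod i j)
      then obtain y z where "y \<in> S" "z \<in> S" "i = c ^ k * y" "j = c * z" by blast
      then show ?case by (auto intro!: exI[of _ "y * z"] mult_mem simp: mult_ac)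
    next
      case (sum x y)
      then obtain a b where "a \<in> S" "b \<in> S" "x = c ^ Suc k * a" "y = c ^ Suc k * b" by blast
      then show ?case by (auto intro!: exI[of _ "a + b"] add_mem simp: distrib_left)
    qed
  next
    fix x assume "x \<in> {c ^ Suc k * y | y. y \<in> S}"
    then obtain y where y: "y \<in> S" "x = c ^ Suc k * y" by blast
    have "(c ^ k * y) \<otimes>\<^bsub>RS\<^esub> (c * 1) \<in> ideal_prod RS ?Q ?P"
      using y one_mem by (intro ideal_prod.prod) blast+
    then show "x \<in> ideal_prod RS ?Q ?P" using y by (simp add: mult_ac)
  qed
  finally show ?case .
qed

end

context valued_extension
begin

text \<open>A valuation ring is integrally closed: for \<open>x\<close> outside \<open>V\<close> the
  leading term of a monic equation dominates strictly. Conversely the powers of \<open>\<pi>\<close>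
  generate \<open>V\<close> over \<open>A\<close>, a module stable under multiplication by each
  \<open>x \<in> V\<close>.\<close>

lemma integral_closure_eq:
  assumes e: "e > 0" "\<pi> \<noteq> 0" "\<pi> \<in> V"
    and basis: "\<And>y. y \<in> V \<Longrightarrow> \<exists>a. (\<forall>i<e. a i \<in> A) \<and> y = (\<Sum>i<e. a i * \<pi> ^ i)"
  shows "integral_closure ring_of_type_algebra A L = V"
proof (intro equalityI subsetI)
  fix x assume "x \<in> integral_closure ring_of_type_algebra A L"
  then obtain cs where x: "x \<in> L" and cs: "set cs \<subseteq> A" "poly (Poly (rev (1 # cs))) x = 0"
    unfolding integral_closure_def eval_eq_poly by fastforce
  define c where "c i = rev (1 # cs) ! i" for i
  define m where "m = length cs"
  have sum: "poly (Poly (rev (1 # cs))) x = (\<Sum>i\<le>m. c i * x ^ i)"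
  proof -
    have "poly (Poly as) x = (\<Sum>i<length as. as ! i * x ^ i)" for as
      by (induction as) (simp_all add: sum.lessThan_Suc_shift sum_distrib_left mult_ac del: sum.lessThan_Suc)
    then show ?thesis by (simp add: c_def m_def lessThan_Suc_atMost del: rev.simps)
  qed
  have cA: "c i \<in> A" if "i \<le> m" for i
  proof -
    have "c i \<in> set (rev (1 # cs))" unfolding c_def using that by (intro nth_mem) (simp add: m_def)
    then show ?thesis using cs(1) A.one_mem by auto
  qed
  have cm: "c m = 1" by (simp add: c_def m_def nth_append)
  show "x \<in> V"
  proof (rule ccontr)
    assume xV: "x \<notin> V"
    then have x0: "x \<noteq> 0" using V.zero_mem by auto
    have y: "inverse x \<in> P" using val[OF x] xV by (auto simp: P_def unit_def)
    have "(\<Sum>i\<in>{..m}. c i * x ^ i) \<noteq> 0"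
    proof (rule dominant_sum_nonzero[where j = m])
      show "c m * x ^ m \<noteq> 0" using cm x0 by simp
      show "c i * x ^ i \<in> L" if "i \<in> {..m}" for i using cA[of i] that x A_in_L by (intro L.mult_mem L.power_mem) auto
      fix i assume i: "i \<in> {..m}" "i \<noteq> m"
      have "c i * x ^ i / (c m * x ^ m) = c i * inverse x ^ (m - i)"
        using cm x0 i power_add[of x i "m - i"] by (simp add: power_inverse field_simps)
      also have "\<dots> \<in> P" using cA[of i] i AV y P_power_iff[OF P_V[OF y], of "m - i"] by (intro P_mult') auto
      finally show "c i * x ^ i / (c m * x ^ m) \<in> P" .
    qed auto
    then show False using sum cs(2) by simp
  qed
next
  fix x assume x: "x \<in> V"
  have "\<exists>f. coeffs_in A f \<and> lead_coeff f = 1 \<and> poly f x = 0"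
  proof (rule A.integral_of_stable_module[where b = "\<lambda>i. \<pi> ^ i" and e = e])
    show "\<pi> ^ 0 \<noteq> 0" "0 < e" "e > 0" using e by auto
    fix i
    show "\<exists>a. (\<forall>j<e. a j \<in> A) \<and> x * \<pi> ^ i = (\<Sum>j<e. a j * \<pi> ^ j)"
      by (rule basis) (intro V.mult_mem V.power_mem x e)
  qed
  then obtain f where f: "coeffs_in A f" "lead_coeff f = 1" "poly f x = 0" by blast
  have f0: "f \<noteq> 0" using f by auto
  define cs where "cs = tl (rev (coeffs f))"
  have "hd (rev (coeffs f)) = 1" using f(2) f0 by (simp add: hd_rev last_coeffs_eq_coeff_degree)
  then have 1: "rev (coeffs f) = 1 # cs" unfolding cs_def using f0 by (metis coeffs_eq_Nil list.collapse rev_is_Nil_conv)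
  have "set (coeffs f) \<subseteq> A" using f(1) by (auto simp: coeffs_def coeffs_in_def)
  then have "set (rev (coeffs f)) \<subseteq> A" by simp
  then have "set cs \<subseteq> A" by (simp add: 1)
  moreover have "\<R>.eval (1 # cs) x = 0" unfolding 1[symmetric] using f(3) by (simp add: eval_eq_poly)
  ultimately show "x \<in> integral_closure ring_of_type_algebra A L"
    using x VL by (auto simp: integral_closure_def)
qed

text \<open>Both numbers that total ramification compares are the same \<open>e\<close>: the powers
  of \<open>\<pi>\<close> below \<open>e\<close> are a basis of \<open>L\<close> over
  \<open>K\<close> once denominators are cleared by powers of \<open>p\<close>, and
  \<open>p * V = \<pi> ^ e * V\<close>.\<close>

theorem totally_ramified_of_residue_trivial:
  assumes residue_trivial
  shows "totally_ramified ring_of_type_algebra A K L"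
proof (rule totally_ramified_basis[OF assms])
  fix \<pi> e
  assume pi: "e > 0" "\<pi> \<in> P" "\<And>x. x \<in> P \<Longrightarrow> \<exists>y\<in>V. x = \<pi> * y" "unit (\<pi> ^ e / of_nat p)"
    "\<And>y. y \<in> V \<Longrightarrow> \<exists>a. (\<forall>i<e. a i \<in> A) \<and> y = (\<Sum>i<e. a i * \<pi> ^ i)"
    "\<And>a i. (\<And>i. i < e \<Longrightarrow> a i \<in> K) \<Longrightarrow> (\<Sum>i<e. a i * \<pi> ^ i) = 0 \<Longrightarrow> i < e \<Longrightarrow> a i = 0"
  have pi0: "\<pi> \<noteq> 0" using pi(1,4) by (auto simp: unit_def power_0_left)
  have piV: "\<pi> \<in> V" using pi(2) P_V by blast
  have "\<R>.dimension e K L"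
  proof (rule dimension_of_basis[where b = "\<lambda>i. \<pi> ^ i"])
    show "closed_subfield K" "closed_subfield L" "K \<subseteq> L"
      by (rule K.closed_subfield_axioms, rule L.closed_subfield_axioms, rule K_subset)
    show "\<pi> ^ i \<in> L" for i using piV VL by (intro L.power_mem) auto
    show "a i = 0" if "\<And>i. i < e \<Longrightarrow> a i \<in> K" "(\<Sum>i<e. a i * \<pi> ^ i) = 0" "i < e" for a i
      using pi(6)[OF that] .
    fix x assume x: "x \<in> L"
    have "\<exists>k. of_nat p ^ k * x \<in> V"
    proof (cases "x = 0")
      case False
      \<comment> \<open>So many factors \<open>p\<close> suffice, because each has the value
        \<open>D \<ge> 1\<close>.\<close>
      define k where "k = nat (- v x)"
      have "v (of_nat p ^ k * x) = int k * int D + v x"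
        using x False by (subst v_mult) (auto simp: v_power v_p L.of_nat_mem L.power_mem)
      moreover have "int k * 1 \<le> int k * int D" by (intro mult_left_mono) (use D_pos in linarith)+
      moreover have "- v x \<le> int k" by (simp add: k_def)
      ultimately have "v (of_nat p ^ k * x) \<ge> 0" by linarith
      moreover have "of_nat p ^ k * x \<in> L" using x by (intro L.mult_mem L.power_mem L.of_nat_mem)
      ultimately show ?thesis using V_iff[of "of_nat p ^ k * x"] False by auto
    qed (simp add: V.zero_mem)
    then obtain k where "of_nat p ^ k * x \<in> V" by blast
    then obtain a where a: "\<forall>i<e. a i \<in> A" "of_nat p ^ k * x = (\<Sum>i<e. a i * \<pi> ^ i)" using pi(5) by blast
    have "x = inverse (of_nat p ^ k) * (of_nat p ^ k * x)" by simp
    also have "\<dots> = (\<Sum>i<e. (inverse (of_nat p ^ k) * a i) * \<pi> ^ i)"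
      unfolding a(2) by (simp add: sum_distrib_left mult.assoc)
    finally have "x = (\<Sum>i<e. (inverse (of_nat p ^ k) * a i) * \<pi> ^ i)" .
    moreover have "\<forall>i<e. inverse (of_nat p ^ k) * a i \<in> K"
      using a(1) A_subset by (auto intro!: K.mult_mem K.inverse_mem K.power_mem K.of_nat_mem)
    ultimately show "\<exists>a. (\<forall>i<e. a i \<in> K) \<and> x = (\<Sum>i<e. a i * \<pi> ^ i)"
      by (intro exI[of _ "\<lambda>i. inverse (of_nat p ^ k) * a i"]) simp
  qed
  moreover have "has_ramification_index ring_of_type_algebra A L e"
  proof -
    let ?pA = "{of_nat p * y | y. y \<in> A}"
    have "1 \<notin> ?pA"
    proof
      assume "1 \<in> ?pA"
      then obtain y where y: "y \<in> A" "of_nat p * y = 1" by force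
      then show False using inverse_unique[OF y(2)] inverse_p_notin by simp
    qed
    then have 1: "maximalideal ?pA A.RS"
      using A_unit by (intro A.maximalideal_RS A.principal_ideal_RS A.of_nat_mem) blast+
    have P_eq: "P = {\<pi> * y | y. y \<in> V}" using pi(2,3) P_mult by blast
    have 2: "maximalideal P V.RS"
      using unit_not_P[OF unit_1] piV unfolding P_eq
      by (intro V.maximalideal_RS V.principal_ideal_RS) (auto simp: P_eq[symmetric] P_def unit_def)
    have 3: "genideal V.RS ?pA = P [^]\<^bsub>ideals_set V.RS\<^esub> e"
    proof -
      interpret RV: cring V.RS by (rule V.cring_RS)
      have "P [^]\<^bsub>ideals_set V.RS\<^esub> e = {\<pi> ^ e * y | y. y \<in> V}"
        unfolding P_eq by (rule V.principal_ideal_power[OF piV])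
      also have "\<dots> = pV"
      proof (intro equalityI subsetI)
        fix x assume "x \<in> {\<pi> ^ e * y | y. y \<in> V}"
        then obtain y where y: "y \<in> V" "x = \<pi> ^ e * y" by blast
        then have "x = of_nat p * (\<pi> ^ e / of_nat p * y)" by simp
        then show "x \<in> pV" using unit_V[OF pi(4)] y(1) V.mult_mem unfolding pV_def by blast
      next
        fix x assume "x \<in> pV"
        then obtain y where y: "y \<in> V" "x = of_nat p * y" by (auto simp: pV_def)
        then have "x = \<pi> ^ e * (inverse (\<pi> ^ e / of_nat p) * y)" using pi0 by simp
        moreover have "inverse (\<pi> ^ e / of_nat p) \<in> V" using pi(4) by (simp only: unit_def)
        ultimately show "x \<in> {\<pi> ^ e * y | y. y \<in> V}" using y(1) V.mult_mem by blast
      qed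
      also have "pV = genideal V.RS ?pA"
      proof
        have "ideal pV V.RS" unfolding pV_def by (rule V.principal_ideal_RS[OF V.of_nat_mem])
        then show "genideal V.RS ?pA \<subseteq> pV" by (rule RV.genideal_minimal) (use AV in \<open>auto simp: pV_def\<close>)
        have sub: "?pA \<subseteq> carrier V.RS" using AV by (auto intro!: V.mult_mem V.of_nat_mem)
        have "of_nat p \<in> ?pA" using A.one_mem by force
        then have "of_nat p \<in> genideal V.RS ?pA" using RV.genideal_self[OF sub] by blast
        moreover have "ideal (genideal V.RS ?pA) V.RS" by (rule RV.genideal_ideal[OF sub])
        ultimately show "pV \<subseteq> genideal V.RS ?pA"
          unfolding V.ideal_RS_iff pV_def by (auto simp: mult.commute)
      qed
      finally show ?thesis by simp
    qed
    have "integral_closure ring_of_type_algebra A L = V"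
      by (rule integral_closure_eq[OF pi(1) pi0 piV]) (rule pi(5))
    then show ?thesis
      unfolding has_ramification_index_def Let_def
      by (intro exI[of _ ?pA] exI[of _ P]) (simp only: 1 2 3)
  qed
  ultimately show ?thesis unfolding totally_ramified_def by blast
qed

end

theorem theorem5p5:
  fixes p r s :: nat
    and b :: "(nat \<Rightarrow> rat) set"
    and \<sigma> :: "(nat \<Rightarrow> rat) set \<Rightarrow> 'l::field"
    and \<zeta> \<beta> :: 'l
  assumes "prime p" and "odd p"
    and "1 \<le> s" and "s \<le> r"
    and "b \<in> carrier (Qp p)" and "b \<notin> {x [^]\<^bsub>Qp p\<^esub> p | x. x \<in> carrier (Qp p)}"
    and "\<sigma> \<in> ring_hom (Qp p) ring_of_type_algebra"
    and "primitive_root_of_unity (p ^ r) \<zeta>"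
    and "\<beta> ^ (p ^ s) = \<sigma> b"
  shows "totally_ramified ring_of_type_algebra
           (\<sigma> ` Zp p) (\<sigma> ` carrier (Qp p))
           (generate_field ring_of_type_algebra (\<sigma> ` carrier (Qp p) \<union> {\<zeta>, \<beta>}))"
proof -
  interpret Q: Qp_embedding p \<sigma> using assms(1,7) by unfold_locales
  define A where "A = \<sigma> ` Zp p"
  define K where "K = \<sigma> ` carrier (Qp p)"
  define L where "L = generate_field ring_of_type_algebra (K \<union> {\<zeta>, \<beta>})"
  interpret padic_field p A K unfolding A_def K_def by (rule Q.padic_field)
  have p1: "p > 1" using prime_gt_1_nat[OF assms(1)] .
  have r: "r > 0" using assms(3,4) by simp
  have bK: "\<beta> ^ p ^ s \<in> K" using assms(5,9) by (simp add: K_def)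
  \<comment> \<open>\<open>\<beta> = 0\<close> would give \<open>b = 0\<close> by injectivity of the
    embedding, and \<open>0\<close> is the \<open>p\<close>-th power of \<open>0\<close>.\<close>
  have \<beta>0: "\<beta> \<noteq> 0"
  proof
    assume "\<beta> = 0"
    then have b0: "\<sigma> b = 0" using assms(9) p1 by (simp add: power_0_left)
    have C: "b \<in> (\<lambda>f. padic_null p +>\<^bsub>padic_Cauchy_ring p\<^esub> f) ` padic_Cauchy p"
      using assms(5) by (auto simp: Qp_def FactRing_def A_RCOSETS_def' padic_Cauchy_ring_def)
    then obtain f where f: "f \<in> padic_Cauchy p" "b = padic_null p +>\<^bsub>padic_Cauchy_ring p\<^esub> f" by blast
    have fn: "f \<in> padic_null p" using Q.\<phi>_eq_0_iff[OF f(1)] b0 by (simp add: Q.\<phi>_def f(2))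
    interpret I: ideal "padic_null p" "padic_Cauchy_ring p" by (rule Q.ideal_padic_null)
    have bz: "b = \<zero>\<^bsub>Qp p\<^esub>" unfolding f(2) using fn by (simp add: I.a_rcos_const Qp_def FactRing_def)
    interpret Qr: ring "Qp p" unfolding Qp_def by (rule ideal.quotient_is_ring[OF Q.ideal_padic_null])
    have "\<zero>\<^bsub>Qp p\<^esub> [^]\<^bsub>Qp p\<^esub> p = \<zero>\<^bsub>Qp p\<^esub>" using p1 by (intro Qr.nat_pow_zero) simp
    then show False using assms(6) bz Qr.zero_closed by force
  qed
  define \<Phi> where "\<Phi> = (cyclotomic_prime_power p r :: 'l poly)"
  have zr: "\<zeta> ^ p ^ r = 1" using assms(8) by (simp add: primitive_root_of_unity_def)
  have zr1: "\<zeta> ^ p ^ (r - 1) \<noteq> 1"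
    using assms(8) r p1 by (auto simp: primitive_root_of_unity_def power_strict_increasing_iff)
  have root1: "poly \<Phi> \<zeta> = 0" unfolding \<Phi>_def by (rule poly_cyclotomic_prime_power[OF zr zr1 r])
  have root2: "poly \<Phi> (\<zeta>\<^sup>2) = 0" unfolding \<Phi>_def
  proof (rule poly_cyclotomic_prime_power[OF _ _ r])
    show "(\<zeta>\<^sup>2) ^ p ^ r = 1" using zr by (metis power_mult mult.commute power_one)
    show "(\<zeta>\<^sup>2) ^ p ^ (r - 1) \<noteq> 1"
    proof
      assume "(\<zeta>\<^sup>2) ^ p ^ (r - 1) = 1"
      then have 2: "\<zeta> ^ (2 * p ^ (r - 1)) = 1" by (simp add: power_mult)
      \<comment> \<open>As \<open>p\<close> is odd, \<open>2 * p ^ (r - 1)\<close> lies strictly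
        between \<open>0\<close> and the order \<open>p ^ r\<close> of
        \<open>\<zeta>\<close>.\<close>
      have "p > 2" using p1 assms(2) by (cases "p = 2") auto
      then have "2 * p ^ (r - 1) < p * p ^ (r - 1)" using p1 by simp
      also have "\<dots> = p ^ r" using r by (cases r) auto
      finally show False using assms(8) 2 p1 by (simp add: primitive_root_of_unity_def)
    qed
  qed
  have \<Phi>: "coeffs_in K \<Phi>" "lead_coeff \<Phi> = 1" "degree \<Phi> = (p - 1) * p ^ (r - 1)"
    unfolding \<Phi>_def using cyclotomic_prime_power_degree[OF p1] K.coeffs_in_cyclotomic_prime_power by auto
  have \<Phi>0: "degree \<Phi> > 0" using \<Phi>(3) p1 by simp
  have Ks: "subfield K \<R>" using K.closed_subfield_axioms by (simp add: subfield_iff_closed_subfield)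
  have alg\<zeta>: "(\<R>.algebraic over K) \<zeta>"
    using \<Phi> root1 K.closed_subfield_axioms \<Phi>0 by (intro algebraic_of_monic_root[of K \<Phi>]) auto
  let ?B = "monom 1 (p ^ s) - [:\<beta> ^ p ^ s:]"
  have dB: "degree ?B = p ^ s" using p1 by (intro degree_monom_minus_const) simp
  have alg\<beta>: "(\<R>.algebraic over K) \<beta>"
  proof (rule algebraic_of_monic_root[of K ?B])
    show "?B \<noteq> 0" using dB p1 by (metis degree_0 less_not_refl zero_less_power p_pos)
    show "coeffs_in K ?B" using bK by (intro K.coeffs_in_diff) (auto simp: K.one_mem)
  qed (auto simp: poly_monom K.closed_subfield_axioms)
  define F where "F = adjoin K \<zeta>"
  have F_eq: "F = \<R>.simple_extension K \<zeta>"
    unfolding F_def using simple_extension_eq_adjoin[OF K.closed_subring_axioms] by simp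
  have F: "closed_subfield F"
    unfolding F_eq subfield_iff_closed_subfield[symmetric]
    using \<R>.simple_extension_is_subfield[OF Ks, of \<zeta>] alg\<zeta> by simp
  then interpret F: closed_subfield F .
  \<comment> \<open>In a list of adjoined elements the head is adjoined last, so
    \<open>[\<beta>, \<zeta>]\<close> stands for \<open>\<beta>\<close> on top of
    \<open>K(\<zeta>)\<close>.\<close>
  have FE: "\<R>.finite_extension K [\<beta>, \<zeta>] = adjoin F \<beta>"
    using simple_extension_eq_adjoin[OF F.closed_subring_axioms] by (simp add: F_eq)
  have algs: "\<And>x. x \<in> set [\<beta>, \<zeta>] \<Longrightarrow> (\<R>.algebraic over K) x" using alg\<zeta> alg\<beta> by auto
  have FEs: "subfield (\<R>.finite_extension K [\<beta>, \<zeta>]) \<R>"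
    by (rule \<R>.finite_extension_is_subfield[OF Ks _ algs]) auto
  have L_eq: "L = adjoin F \<beta>"
  proof
    show "L \<subseteq> adjoin F \<beta>"
      unfolding L_def
    proof (rule field.generate_field_min_subfield1[OF field_\<R>])
      show "subfield (adjoin F \<beta>) \<R>" using FEs FE by simp
      show "K \<union> {\<zeta>, \<beta>} \<subseteq> adjoin F \<beta>"
        using F.adjoin_superset[of \<beta>] F.adjoin_mem[of \<beta>] K.adjoin_superset[of \<zeta>] K.adjoin_mem[of \<zeta>]
        by (auto simp: F_def)
    qed simp
    have "subfield L \<R>" unfolding L_def by (rule field.generate_field_is_subfield[OF field_\<R>]) simp
    then show "adjoin F \<beta> \<subseteq> L" unfolding FE[symmetric]
      by (intro \<R>.finite_extension_subring_incl subfieldE(1)) (auto simp: L_def intro: generate_field.incl)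
  qed
  have L: "closed_subfield L" using FEs FE L_eq by (simp add: subfield_iff_closed_subfield)
  have KL: "K \<subseteq> L" unfolding L_def by (auto intro: generate_field.incl)
  have \<zeta>L: "\<zeta> \<in> L" unfolding L_def by (auto intro: generate_field.incl)
  have "\<R>.finite_dimension K L"
    unfolding L_eq FE[symmetric] by (rule \<R>.finite_extension_finite_dimension(1)[OF Ks _ algs]) auto
  then obtain n where n: "\<R>.dimension n K L" by (auto simp: \<R>.finite_dimension_def)
  \<comment> \<open>At this point \<open>V\<close> is just some valuation ring of \<open>L\<close>
    above \<open>A\<close> that omits \<open>1/p\<close>; it is identified with the integral closure
    only after a basis of powers of a uniformizer has been found.\<close>
  obtain V where V: "closed_subring V" "A \<subseteq> V" "V \<subseteq> L" "inverse (of_nat p) \<notin> V"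
    "\<And>x. x \<in> L \<Longrightarrow> x \<in> V \<or> inverse x \<in> V"
    using valuation_ring_extension[OF A.closed_subring_axioms L _ A.of_nat_mem inverse_p_notin] A_subset KL
    by blast
  interpret valued_extension p A K L V n
    using V L KL finite_dimension_relation[OF K.closed_subfield_axioms n]
    by (intro valued_extension.intro valued_extension_axioms.intro padic_field_axioms) auto
  have residue_trivial
  proof (rule residue_trivialI)
    fix \<omega> M assume \<omega>: "\<omega> \<in> V" "M > 0" "\<omega> ^ M = 1"
    note cyc = cyclotomic_totally_ramified[OF assms(2) r assms(8) \<zeta>L]
    have "\<omega> \<in> adjoin K \<zeta>"
    proof (rule K.root_of_unity_in_cyclotomic[OF _ _ assms(8) _ \<Phi>(1,2) \<Phi>0 root1 root2 _ _ \<beta>0 bK])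
      show "closed_subfield (adjoin K \<zeta>)" using F by (simp add: F_def)
      show "closed_subfield (adjoin (adjoin K \<zeta>) \<beta>)" using L by (simp add: L_eq F_def)
      show "0 < p ^ r" "p ^ s dvd p ^ r" "\<omega> ^ M = 1" "0 < M" using p1 assms(4) \<omega> by (auto intro: le_imp_power_dvd)
      show "\<omega> \<in> adjoin (adjoin K \<zeta>) \<beta>" using \<omega>(1) V(3) by (auto simp: L_eq F_def)
      show "poly f \<zeta> \<noteq> 0" if "coeffs_in K f" "f \<noteq> 0" "degree f < degree \<Phi>" for f
        using cyc(1) that \<Phi>(3) by simp
    qed
    then show "\<exists>k::nat. \<omega> - of_nat k \<in> P" using cyc(2) \<omega>(1) by blast
  qed
  then show ?thesis using totally_ramified_of_residue_trivial unfolding L_def A_def K_def by simp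
qed

end
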